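(* Consider the discrete memoryless setting described in the context. Fix $D_y\ge d_{\min}$ such that Assumption A-RD holds. For each $n$ let $P_{Z^n|Y^n}$ be a $D_y$-admissible code of rate $R_n$, with $R_n\to R(D_y)$ as $n\to\infty$. Assume that for every $n$ and almost every $y^n$, $P_{Z^n|Y^n=y^n}$ is absolutely continuous with respect to $P_{Z^{*n}|Y^n=y^n}$, and that $\lim_{n\to\infty}\frac1nD(P_{Z^n}\,\|\,P_{Z^{*n}})=0$. (i) For any estimator $\phi:\mathcal Z\to\Theta_1$, $$\lim_{n\to\infty}\frac1n\sum_{i=1}^n\mathbb E[\rho(\theta_i,\phi(Z_i))]=\mathbb E[\rho(\theta_1,\phi(Z_1^* ))]=D^*_\phi(R(D_y)).$$ In particular, for the Bayes estimator $\phi^B$ (applied coordinatewise), $$\lim_{n\to\infty}\frac1n\sum_{i=1}^n\mathbb E[\rho(\theta_i,\phi^B_i(Z_i))]=D^*(R(D_y)).$$ (ii) For a sequence of Lipschitz estimators $\phi_n:(\mathcal Z^n,\rho_H)\to(\Theta_1^n,\rho)$ whose Lipschitz constants are uniformly bounded in $n$, with $\hat\theta^n=\phi_n(Z^n)$, $$\liminf_{n\to\infty}\frac1n\sum_{i=1}^n\mathbb E[\rho(\theta_i,\hat\theta_i)]\ge D^*(R(D_y)).$$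
   Context: All logarithms are to base 2; $D(\cdot\|\cdot)$ is relative entropy and $I(\cdot;\cdot)$ is mutual information. Discrete memoryless setting: $\theta^n=(\theta_1,\dots,\theta_n)$ are i.i.d. from a distribution $P_{\theta_1}$ with support $\Theta_1$; $P_{Y^n|\theta^n}=\prod_{i=1}^nP_{Y_1|\theta_1}(y_i|\theta_i)$, so $(\theta_i,Y_i)$ are i.i.d. pairs. $\mathcal Z$ is discrete (countable), and $\mathcal Z^n$ carries the normalized Hamming distance $\rho_H(u^n,v^n)=\frac1n\sum_i\mathbf 1_{\{u_i\ne v_i\}}$. $\rho$ is a metric on $\Theta_1$ making it Polish, with $\sup\rho(\theta_1,\hat\theta_1)\le M$ for a constant $M>0$, extended to $\Theta_1^n$ by $\rho(\theta^n,\hat\theta^n)=\frac1n\sum_i\rho(\theta_i,\hat\theta_i)$. The distortion is $d(y^n,z^n)=\sum_{i=1}^nd(y_i,z_i)$ with $d\ge0$, and $d_{\min}=\inf_{y,z}d(y,z)$. Rate-distortion function: $\mathcal R_{Y^n}(D_y)=\min I(Y^n;Z^n)$ over kernels $P_{Z^n|Y^n}$ with $\mathbb E[d(Y^n,Z^n)]\le nD_y$; $R(D_y)=\lim_n\frac1n\mathcal R_{Y^n}(D_y)$. Here $R(D_y)=\inf\{I(Y_1;Z_1):\mathbb E[d(Y_1,Z_1)]\le D_y\}$. Assumption A-RD: for each $n$ the minimum defining $\mathcal R_{Y^n}(D_y)$ is achieved by a unique kernel $P_{Z^{*n}|Y^n}$, which satisfies $\mathbb E[d(Y^n,Z^{*n})]=nD_y$.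 In this setting $P_{Z^{*n}Y^n}=\prod_iP_{Z_i^*Y_i}$ with identical factors. $P_{Z^{*n}}$ is the marginal of $Z^{*n}$, and $\theta^n\to Y^n\to Z^{*n}$ is a Markov chain. Code: an $n$-block code of rate $R_n=\frac1n\log M_n$ is a pair of (possibly random, with randomness independent of $(\theta^n,Y^n)$) maps $f_{\rm enc}:\mathcal Y^n\to\{1,\dots,M_n\}$, $f_{\rm dec}:\{1,\dots,M_n\}\to\mathcal Z^n$ with $Z^n=f_{\rm dec}(f_{\rm enc}(Y^n))$; it is identified with the induced kernel $P_{Z^n|Y^n}$, with output marginal $P_{Z^n}$. It is $D_y$-admissible if $\mathbb E[d(Y^n,Z^n)]\le nD_y$. RD risks: for $\phi:\mathcal Z\to\Theta_1$, $D^*_\phi(R(D_y))=\mathbb E[\rho(\theta_1,\phi(Z_1^* ))]$, and the Bayes RD risk is $D^*(R(D_y))=\inf_\phi D^*_\phi(R(D_y))$. The Bayes estimator is $\phi^B(z^n)=(\phi_1^B(z_1),\dots,\phi_n^B(z_n))$ with $\phi_i^B(z)=\arg\min_{t\in\Theta_1}\mathbb E[\rho(\theta_i,t)\mid Z_i^*=z]$ (assumed to exist where used). *)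

theory Defs
  imports "HOL-Probability.Probability"
begin

text \<open>
  Blocks of length \<open>n\<close> over an alphabet \<open>M\<close> are the points of the product space over
  \<open>{..<n}\<close>, with the product sigma-algebra; coordinate \<open>i\<close> here is coordinate \<open>i + 1\<close> in the
  usual numbering. Only the sigma-algebra of \<open>M\<close> matters when \<open>M\<close> is used as an alphabet.
\<close>

abbreviation block :: "nat \<Rightarrow> 'a measure \<Rightarrow> (nat \<Rightarrow> 'a) measure" where
  "block n M \<equiv> PiM {..<n} (\<lambda>_. M)"

text \<open>The reproduction alphabet is a countable type with the discrete sigma-algebra.\<close>

abbreviation zblock :: "nat \<Rightarrow> (nat \<Rightarrow> 'z::countable) measure" where
  "zblock n \<equiv> block n (count_space UNIV)"

text \<open>
  The law of \<open>(X, Y)\<close> when \<open>X\<close> has law \<open>A\<close> and \<open>k x\<close> is the conditional law of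
  \<open>Y\<close> given \<open>X = x\<close>; the values of \<open>Y\<close> lie in the measurable space \<open>B\<close>.
\<close>

definition kernel_law :: "'a measure \<Rightarrow> 'b measure \<Rightarrow> ('a \<Rightarrow> 'b measure) \<Rightarrow> ('a \<times> 'b) measure" where
  "kernel_law A B k = A \<bind> (\<lambda>x. distr (k x) (A \<Otimes>\<^sub>M B) (Pair x))"

text \<open>
  \<open>rel_entropy N M\<close> is the relative entropy \<open>D(N || M)\<close> in bits. The library's
  \<open>KL_divergence 2 M N\<close> is real-valued, so its value is meaningless when \<open>N\<close> is not absolutely
  continuous with respect to \<open>M\<close> or the log-density is not integrable; for probability
  measures the relative entropy is infinite in both cases, since the negative part of the
  log-density is always \<open>N\<close>-integrable.
\<close>

definition rel_entropy :: "'a measure \<Rightarrow> 'a measure \<Rightarrow> ereal" where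
  "rel_entropy N M =
     (if absolutely_continuous M N \<and> integrable N (entropy_density 2 M N)
      then ereal (KL_divergence 2 M N) else \<infinity>)"

text \<open>Mutual information of the two components of a pair with joint law \<open>J\<close> on \<open>A \<times> B\<close>.\<close>

definition mutual_info :: "'a measure \<Rightarrow> 'b measure \<Rightarrow> ('a \<times> 'b) measure \<Rightarrow> ereal" where
  "mutual_info A B J = rel_entropy J (distr J A fst \<Otimes>\<^sub>M distr J B snd)"


subsection \<open>Source\<close>

text \<open>
  The law of \<open>(\<theta>\<^sup>n, Y\<^sup>n)\<close>: the \<open>\<theta>\<close>'s are i.i.d. with law \<open>P\<close> and, given them, the
  \<open>Y\<close>'s are independent, the \<open>i\<close>-th one with law \<open>K (\<theta> i)\<close>.
\<close>

definition source_law ::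
  "'t measure \<Rightarrow> 'y measure \<Rightarrow> ('t \<Rightarrow> 'y measure) \<Rightarrow> nat \<Rightarrow> ((nat \<Rightarrow> 't) \<times> (nat \<Rightarrow> 'y)) measure" where
  "source_law P MY K n = kernel_law (block n P) (block n MY) (\<lambda>t. PiM {..<n} (\<lambda>i. K (t i)))"

definition obs_law ::
  "'t measure \<Rightarrow> 'y measure \<Rightarrow> ('t \<Rightarrow> 'y measure) \<Rightarrow> nat \<Rightarrow> (nat \<Rightarrow> 'y) measure" where
  "obs_law P MY K n = distr (source_law P MY K n) (block n MY) snd"


subsection \<open>Rate-distortion function\<close>

text \<open>In this part \<open>V\<close> is a law of \<open>Y\<^sup>n\<close> and \<open>k\<close> is a kernel from \<open>Y\<^sup>n\<close> to \<open>Z\<^sup>n\<close>.\<close>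

definition out_law ::
  "nat \<Rightarrow> (nat \<Rightarrow> 'y) measure \<Rightarrow> ((nat \<Rightarrow> 'y) \<Rightarrow> (nat \<Rightarrow> 'z::countable) measure)
    \<Rightarrow> (nat \<Rightarrow> 'z) measure" where
  "out_law n V k = distr (kernel_law V (zblock n) k) (zblock n) snd"

definition kernel_info ::
  "nat \<Rightarrow> (nat \<Rightarrow> 'y) measure \<Rightarrow> ((nat \<Rightarrow> 'y) \<Rightarrow> (nat \<Rightarrow> 'z::countable) measure) \<Rightarrow> ereal" where
  "kernel_info n V k = mutual_info V (zblock n) (kernel_law V (zblock n) k)"

definition kernel_distortion ::
  "('y \<Rightarrow> 'z::countable \<Rightarrow> real) \<Rightarrow> nat \<Rightarrow> (nat \<Rightarrow> 'y) measure
    \<Rightarrow> ((nat \<Rightarrow> 'y) \<Rightarrow> (nat \<Rightarrow> 'z) measure) \<Rightarrow> ennreal" where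
  "kernel_distortion d n V k =
     (\<integral>\<^sup>+ \<omega>. ennreal (\<Sum>i<n. d (fst \<omega> i) (snd \<omega> i)) \<partial>kernel_law V (zblock n) k)"

definition admissible ::
  "('y \<Rightarrow> 'z::countable \<Rightarrow> real) \<Rightarrow> real \<Rightarrow> nat \<Rightarrow> (nat \<Rightarrow> 'y) measure
    \<Rightarrow> ((nat \<Rightarrow> 'y) \<Rightarrow> (nat \<Rightarrow> 'z) measure) \<Rightarrow> bool" where
  "admissible d D n V k \<longleftrightarrow>
     k \<in> V \<rightarrow>\<^sub>M prob_algebra (zblock n) \<and> kernel_distortion d n V k \<le> ennreal (real n * D)"

definition rd_block ::
  "('y \<Rightarrow> 'z::countable \<Rightarrow> real) \<Rightarrow> real \<Rightarrow> nat \<Rightarrow> (nat \<Rightarrow> 'y) measure \<Rightarrow> ereal" where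
  "rd_block d D n V = (INF k\<in>{k. admissible d D n V k}. kernel_info n V k)"

text \<open>Here \<open>Vs n\<close> is the law of \<open>Y\<^sup>n\<close>.\<close>

definition rd_fun ::
  "('y \<Rightarrow> 'z::countable \<Rightarrow> real) \<Rightarrow> real \<Rightarrow> (nat \<Rightarrow> (nat \<Rightarrow> 'y) measure) \<Rightarrow> ereal" where
  "rd_fun d D Vs = lim (\<lambda>n. rd_block d D n (Vs n) / ereal (real n))"

text \<open>
  For each \<open>n\<close>, the kernel \<open>Q\<close> attains the minimum, meets the distortion constraint with
  equality, and is the only minimizer, up to a null set of source blocks.
\<close>

definition unique_rd_kernel ::
  "('y \<Rightarrow> 'z::countable \<Rightarrow> real) \<Rightarrow> real \<Rightarrow> nat \<Rightarrow> (nat \<Rightarrow> 'y) measure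
    \<Rightarrow> ((nat \<Rightarrow> 'y) \<Rightarrow> (nat \<Rightarrow> 'z) measure) \<Rightarrow> bool" where
  "unique_rd_kernel d D n V Q \<longleftrightarrow>
     admissible d D n V Q \<and> kernel_info n V Q = rd_block d D n V \<and>
     (\<forall>k. admissible d D n V k \<and> kernel_info n V k = rd_block d D n V \<longrightarrow> (AE y in V. k y = Q y)) \<and>
     kernel_distortion d n V Q = ennreal (real n * D)"


subsection \<open>Codes\<close>

text \<open>
  The encoder and the decoder may both depend on a random element with law \<open>W\<close>, independent of
  the source. This covers deterministic codes, private randomness and common randomness.
\<close>

definition block_code ::
  "'y measure \<Rightarrow> nat \<Rightarrow> nat \<Rightarrow> 'w measure \<Rightarrow> ('w \<Rightarrow> (nat \<Rightarrow> 'y) \<Rightarrow> nat)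
    \<Rightarrow> ('w \<Rightarrow> nat \<Rightarrow> (nat \<Rightarrow> 'z::countable)) \<Rightarrow> bool" where
  "block_code MY n M W enc dec \<longleftrightarrow>
     prob_space W \<and>
     (\<lambda>(w, y). enc w y) \<in> W \<Otimes>\<^sub>M block n MY \<rightarrow>\<^sub>M count_space {1..M} \<and>
     (\<lambda>(w, m). dec w m) \<in> W \<Otimes>\<^sub>M count_space {1..M} \<rightarrow>\<^sub>M zblock n"

definition code_kernel ::
  "nat \<Rightarrow> 'w measure \<Rightarrow> ('w \<Rightarrow> (nat \<Rightarrow> 'y) \<Rightarrow> nat) \<Rightarrow> ('w \<Rightarrow> nat \<Rightarrow> (nat \<Rightarrow> 'z::countable))
    \<Rightarrow> (nat \<Rightarrow> 'y) \<Rightarrow> (nat \<Rightarrow> 'z) measure" where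
  "code_kernel n W enc dec y = distr W (zblock n) (\<lambda>w. dec w (enc w y))"


subsection \<open>Estimation risks\<close>

text \<open>
  The law of \<open>((\<theta>\<^sup>n, Y\<^sup>n), Z\<^sup>n)\<close>, where \<open>S\<close> is the law of \<open>(\<theta>\<^sup>n, Y\<^sup>n)\<close>; as the kernel
  \<open>k\<close> sees \<open>Y\<^sup>n\<close> only, \<open>\<theta>\<^sup>n \<rightarrow> Y\<^sup>n \<rightarrow> Z\<^sup>n\<close> is a Markov chain.
\<close>

definition full_law ::
  "nat \<Rightarrow> ((nat \<Rightarrow> 't) \<times> (nat \<Rightarrow> 'y)) measure \<Rightarrow> ((nat \<Rightarrow> 'y) \<Rightarrow> (nat \<Rightarrow> 'z::countable) measure)
    \<Rightarrow> (((nat \<Rightarrow> 't) \<times> (nat \<Rightarrow> 'y)) \<times> (nat \<Rightarrow> 'z)) measure" where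
  "full_law n S k = kernel_law S (zblock n) (\<lambda>x. k (snd x))"

text \<open>Expected loss of \<open>g (Z\<^sup>n)\<close> as an estimate of \<open>\<theta>\<^sub>i\<close>.\<close>

definition coord_risk ::
  "nat \<Rightarrow> ((nat \<Rightarrow> 't::metric_space) \<times> (nat \<Rightarrow> 'y)) measure
    \<Rightarrow> ((nat \<Rightarrow> 'y) \<Rightarrow> (nat \<Rightarrow> 'z::countable) measure) \<Rightarrow> nat \<Rightarrow> ((nat \<Rightarrow> 'z) \<Rightarrow> 't) \<Rightarrow> real" where
  "coord_risk n S k i g = (\<integral>\<omega>. dist (fst (fst \<omega>) i) (g (snd \<omega>)) \<partial>full_law n S k)"

text \<open>
  In the next two definitions \<open>S1\<close> is the law of \<open>(\<theta>\<^sub>1, Y\<^sub>1)\<close> and \<open>Q1\<close> the optimal kernel, both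
  seen as blocks of length one.
\<close>

definition rd_risk ::
  "((nat \<Rightarrow> 't::metric_space) \<times> (nat \<Rightarrow> 'y)) measure
    \<Rightarrow> ((nat \<Rightarrow> 'y) \<Rightarrow> (nat \<Rightarrow> 'z::countable) measure) \<Rightarrow> ('z \<Rightarrow> 't) \<Rightarrow> real" where
  "rd_risk S1 Q1 \<phi> = coord_risk 1 S1 Q1 0 (\<lambda>z. \<phi> (z 0))"

definition bayes_rd_risk ::
  "((nat \<Rightarrow> 't::metric_space) \<times> (nat \<Rightarrow> 'y)) measure
    \<Rightarrow> ((nat \<Rightarrow> 'y) \<Rightarrow> (nat \<Rightarrow> 'z::countable) measure) \<Rightarrow> real" where
  "bayes_rd_risk S1 Q1 = (INF \<phi>. rd_risk S1 Q1 \<phi>)"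

text \<open>
  \<open>\<phi> z\<close> minimizes \<open>t \<mapsto> E[\<rho>(\<theta>\<^sub>i, t) | Z\<^sub>i = z]\<close>, for every \<open>z\<close> of positive probability; the
  conditional expectation is undefined at the other points, where \<open>\<phi>\<close> is arbitrary.
\<close>

definition bayes_estimator ::
  "nat \<Rightarrow> ((nat \<Rightarrow> 't::metric_space) \<times> (nat \<Rightarrow> 'y)) measure
    \<Rightarrow> ((nat \<Rightarrow> 'y) \<Rightarrow> (nat \<Rightarrow> 'z::countable) measure) \<Rightarrow> nat \<Rightarrow> ('z \<Rightarrow> 't) \<Rightarrow> bool" where
  "bayes_estimator n S k i \<phi> \<longleftrightarrow>
     (\<forall>z. let J = full_law n S k; E = {\<omega> \<in> space J. snd \<omega> i = z} in
        measure J E > 0 \<longrightarrow>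
        is_arg_min (\<lambda>t. \<integral>\<omega>. dist (fst (fst \<omega>) i) t \<partial>uniform_measure J E) (\<lambda>_. True) (\<phi> z))"

text \<open>
  \<open>g\<close> is \<open>C\<close>-Lipschitz from the normalized Hamming distance to the averaged metric on blocks of
  length \<open>n\<close>.
\<close>

definition hamming_dist :: "nat \<Rightarrow> (nat \<Rightarrow> 'z) \<Rightarrow> (nat \<Rightarrow> 'z) \<Rightarrow> real" where
  "hamming_dist n u v = (\<Sum>i<n. of_bool (u i \<noteq> v i)) / real n"

definition block_dist :: "nat \<Rightarrow> (nat \<Rightarrow> 't::metric_space) \<Rightarrow> (nat \<Rightarrow> 't) \<Rightarrow> real" where
  "block_dist n s t = (\<Sum>i<n. dist (s i) (t i)) / real n"

definition lipschitz_estimator ::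
  "real \<Rightarrow> nat \<Rightarrow> ((nat \<Rightarrow> 'z::countable) \<Rightarrow> (nat \<Rightarrow> 't::metric_space)) \<Rightarrow> bool" where
  "lipschitz_estimator C n g \<longleftrightarrow>
     (\<forall>u\<in>space (zblock n). \<forall>v\<in>space (zblock n).
        block_dist n (g u) (g v) \<le> C * hamming_dist n u v)"

end

theory Submission
  imports Defs
begin

text \<open>
  Among the admissible joint laws, the optimal one is the projection, in relative entropy, of the
  product of its marginals. The Pythagorean inequality for this projection bounds the relative
  entropy of the law of \<open>(Y\<^sup>n, Z\<^sup>n)\<close> with respect to that of \<open>(Y\<^sup>n, Z\<^sup>*\<^sup>n)\<close> by
  \<open>I(Y\<^sup>n; Z\<^sup>n) + D(P\<^sub>Z || P\<^sub>Z\<^sub>*) - R(Y\<^sup>n)\<close>. The mutual information is at most the logarithm of the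
  number of codewords, so this bound is \<open>o(n)\<close>. Uniqueness of the optimal kernels makes them product
  kernels: the triples \<open>(\<theta>\<^sub>i, Y\<^sub>i, Z\<^sub>i\<^sup>*)\<close> are i.i.d., and the accumulated loss, which has
  bounded differences, is sub-Gaussian under their law. The Donsker--Varadhan inequality with
  parameter \<open>t\<close> therefore moves the expected loss from \<open>Z\<^sup>*\<^sup>n\<close> to \<open>Z\<^sup>n\<close> at the cost
  \<open>o(n) / t + O(n t)\<close>, in both directions. Under the product law the risk of a letterwise estimator is
  its single-letter risk, and no estimator does better than the Bayes risk in any coordinate.
\<close>

subsection \<open>Relative entropy\<close>

text \<open>The hypothesis on the outputs controls only the law of \<open>Z\<^sup>n\<close>, while
  the risk depends on its joint law with the source. Optimality of the test channel supplies the
  missing control; this is why the gap between the information of the code and the rate-distortion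
  function enters. The total relative entropy obtained is only \<open>o(n)\<close> and may diverge,
  so a total variation bound on blocks would say nothing. An exponential moment does: the
  unnormalised loss has one-letter differences bounded independently of \<open>n\<close>, so the log
  moment generating function at \<open>t\<close> exceeds \<open>t\<close> times the mean by at most
  \<open>O(n t^2)\<close>. Dividing by \<open>n t\<close> and letting \<open>n\<close> grow before
  \<open>t\<close> shrinks removes both errors. The Lipschitz condition in (ii) enters here:
  changing one letter moves the Hamming distance by at most \<open>1/n\<close>, which cancels the
  normalisation of the averaged metric. Information is measured in nats with values in
  \<open>ennreal\<close>; the factor \<open>ln 2\<close> appears only where the definitions of the
  statement are translated.\<close>

lemma ln_ratio_ge:
  fixes a b :: real
  assumes "a \<ge> 0" "b > 0"
  shows "a * ln (a / b) - a + b \<ge> 0"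
proof (cases "a = 0")
  case False
  then have a: "a > 0" using assms by simp
  have "ln (b / a) \<le> b / a - 1"
    using a assms by (intro ln_le_minus_one) simp
  then have "a * ln (b / a) \<le> a * (b / a - 1)"
    using a by (intro mult_left_mono) auto
  then show ?thesis
    using a assms by (simp add: ln_div algebra_simps)
qed (use assms in simp)

text \<open>
  The terms \<open>- a + b\<close> integrate to \<open>0\<close> for probability densities and make the integrand
  nonnegative, so that relative entropy, here in nats, needs no integrability conditions.
\<close>

definition kl_term :: "real \<Rightarrow> real \<Rightarrow> ennreal" where
  "kl_term a b = (if b = 0 then if a = 0 then 0 else \<top> else ennreal (a * ln (a / b) - a + b))"

definition kl :: "'a measure \<Rightarrow> ('a \<Rightarrow> real) \<Rightarrow> ('a \<Rightarrow> real) \<Rightarrow> ennreal" where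
  "kl M f g = (\<integral>\<^sup>+x. kl_term (f x) (g x) \<partial>M)"

lemma kl_term_simps [simp]:
  "kl_term 0 b = ennreal b" "a \<noteq> 0 \<Longrightarrow> kl_term a 0 = \<top>" "kl_term a a = 0"
  by (auto simp: kl_term_def)

lemma measurable_kl_term [measurable]:
  assumes [measurable]: "f \<in> borel_measurable M" "g \<in> borel_measurable M"
  shows "(\<lambda>x. kl_term (f x) (g x)) \<in> borel_measurable M"
  unfolding kl_term_def by measurable

text \<open>The Fenchel-Young inequality: with \<open>w = exp s\<close>, the convex conjugate of
  \<open>kl_term\<close> in its first argument is \<open>b * (exp s - 1)\<close>. It is
  \<open>ln_ratio_ge\<close> with \<open>b * w\<close> in place of \<open>b\<close>. Infinite values
  are excluded because \<open>enn2real\<close> sends them to 0.\<close>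

lemma kl_term_variational:
  fixes a b w :: real
  assumes "a \<ge> 0" "b \<ge> 0" "w \<ge> 0" "a > 0 \<Longrightarrow> w > 0" "kl_term a b \<noteq> \<top>"
  shows "a * ln w \<le> enn2real (kl_term a b) + b * w - b"
proof (cases "a = 0 \<or> b = 0")
  case True
  with assms show ?thesis by (cases "a = 0") (auto simp: kl_term_def)
next
  case False
  with assms have *: "a > 0" "b > 0" "w > 0" by auto
  have "0 \<le> a * ln (a / (b * w)) - a + b * w"
    using * by (intro ln_ratio_ge) auto
  also have "\<dots> = (a * ln (a / b) - a + b) - a * ln w + b * w - b"
    using * by (simp add: ln_div ln_mult algebra_simps)
  finally have "a * ln w \<le> (a * ln (a / b) - a + b) + b * w - b" by simp
  moreover have "enn2real (kl_term a b) = a * ln (a / b) - a + b"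
    using * ln_ratio_ge[of a b] by (simp add: kl_term_def)
  ultimately show ?thesis by simp
qed

text \<open>The Donsker--Varadhan lower bound, with \<open>w\<close> in the role of an exponential.\<close>

lemma kl_variational:
  assumes [measurable]: "f \<in> borel_measurable M" "g \<in> borel_measurable M" "w \<in> borel_measurable M"
    and nonneg: "\<And>x. x \<in> space M \<Longrightarrow> f x \<ge> 0" "\<And>x. x \<in> space M \<Longrightarrow> g x \<ge> 0"
      "\<And>x. x \<in> space M \<Longrightarrow> w x \<ge> 0"
    and w_pos: "AE x in M. f x > 0 \<longrightarrow> w x > 0"
    and g: "(\<integral>\<^sup>+x. ennreal (g x) \<partial>M) = 1"
    and gw: "(\<integral>\<^sup>+x. ennreal (g x * w x) \<partial>M) \<le> 1"
    and fw: "integrable M (\<lambda>x. f x * ln (w x))"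
  shows "ennreal (\<integral>x. f x * ln (w x) \<partial>M) \<le> kl M f g"
proof (cases "kl M f g = \<top>")
  case False
  define h where "h x = enn2real (kl_term (f x) (g x))" for x
  have [measurable]: "h \<in> borel_measurable M"
    unfolding h_def by measurable
  have h_nonneg: "h x \<ge> 0" for x
    by (simp add: h_def)
  \<comment> \<open>Replacing \<open>\<top>\<close> by the default 0 in \<open>h\<close> is
    harmless, since a finite integral confines infinite values to a null set.\<close>
  have fin: "AE x in M. kl_term (f x) (g x) \<noteq> \<top>"
    using False nn_integral_PInf_AE[of "\<lambda>x. kl_term (f x) (g x)" M] unfolding kl_def by simp
  have kl_h: "kl M f g = (\<integral>\<^sup>+x. ennreal (h x) \<partial>M)"
    unfolding kl_def h_def using fin
    by (intro nn_integral_cong_AE) (auto simp: less_top)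
  have int_h: "integrable M h"
    using False unfolding kl_h by (intro integrableI_nonneg) (auto simp: h_def less_top)
  have int_g: "integrable M g"
    using g nonneg by (intro integrableI_nonneg) auto
  have int_gw: "integrable M (\<lambda>x. g x * w x)"
    using gw nonneg by (intro integrableI_nonneg) (auto simp: less_top[symmetric] top_unique)
  have g1: "(\<integral>x. g x \<partial>M) = 1"
    using g nonneg by (subst integral_eq_nn_integral) auto
  have gw1: "(\<integral>x. g x * w x \<partial>M) \<le> 1"
    using gw nonneg by (subst integral_eq_nn_integral) (auto intro!: enn2real_leI)
  have "(\<integral>x. f x * ln (w x) \<partial>M) \<le> (\<integral>x. h x + g x * w x - g x \<partial>M)"
  proof (rule integral_mono_AE[OF fw])
    show "integrable M (\<lambda>x. h x + g x * w x - g x)"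
      using int_h int_g int_gw by auto
    show "AE x in M. f x * ln (w x) \<le> h x + g x * w x - g x"
      using fin w_pos AE_space
      by eventually_elim (use nonneg in \<open>auto simp: h_def intro!: kl_term_variational\<close>)
  qed
  also have "\<dots> \<le> (\<integral>x. h x \<partial>M)"
    using int_h int_g int_gw g1 gw1 by simp
  finally show ?thesis
    unfolding kl_h using int_h h_nonneg by (simp add: nn_integral_eq_integral ennreal_leI)
qed simp

text \<open>The correction terms \<open>- f + g\<close> have integral 0, so they disappear from the
  value. Where \<open>g\<close> vanishes, the conventions \<open>f x / 0 = 0\<close> and
  \<open>ln 0 = 0\<close> would hide an infinite divergence; \<open>ac\<close> rules this
  out.\<close>

lemma kl_eq_integral:
  assumes [measurable]: "f \<in> borel_measurable M" "g \<in> borel_measurable M"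
    and nonneg: "\<And>x. x \<in> space M \<Longrightarrow> f x \<ge> 0" "\<And>x. x \<in> space M \<Longrightarrow> g x \<ge> 0"
    and ac: "AE x in M. g x = 0 \<longrightarrow> f x = 0"
    and f: "(\<integral>\<^sup>+x. ennreal (f x) \<partial>M) = 1" and g: "(\<integral>\<^sup>+x. ennreal (g x) \<partial>M) = 1"
  shows "kl M f g < \<top> \<longleftrightarrow> integrable M (\<lambda>x. f x * ln (f x / g x))"
    and "kl M f g < \<top> \<Longrightarrow> kl M f g = ennreal (\<integral>x. f x * ln (f x / g x) \<partial>M)"
    and "kl M f g < \<top> \<Longrightarrow> (\<integral>x. f x * ln (f x / g x) \<partial>M) \<ge> 0"
proof -
  define h where "h x = f x * ln (f x / g x) - f x + g x" for x
  have [measurable]: "h \<in> borel_measurable M"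
    unfolding h_def by measurable
  have h_nonneg: "AE x in M. h x \<ge> 0"
    using ac AE_space
  proof eventually_elim
    case (elim x)
    then show ?case
      using nonneg[of x] ln_ratio_ge[of "f x" "g x"] by (cases "g x = 0") (auto simp: h_def)
  qed
  have kl_h: "kl M f g = (\<integral>\<^sup>+x. ennreal (h x) \<partial>M)"
    unfolding kl_def
    by (rule nn_integral_cong_AE, use ac in eventually_elim) (auto simp: h_def kl_term_def)
  have int_f: "integrable M f" and int_g: "integrable M g"
    using f g nonneg by (auto intro!: integrableI_nonneg)
  have f1: "(\<integral>x. f x \<partial>M) = 1" and g1: "(\<integral>x. g x \<partial>M) = 1"
    using f g nonneg by (auto simp: integral_eq_nn_integral)
  have h_alt: "(\<lambda>x. f x * ln (f x / g x)) = (\<lambda>x. h x + f x - g x)"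
    by (auto simp: h_def)
  have int_h: "integrable M h \<longleftrightarrow> integrable M (\<lambda>x. f x * ln (f x / g x))"
  proof
    assume "integrable M h"
    then show "integrable M (\<lambda>x. f x * ln (f x / g x))"
      unfolding h_alt using int_f int_g by auto
  next
    assume "integrable M (\<lambda>x. f x * ln (f x / g x))"
    then show "integrable M h"
      unfolding h_def using int_f int_g by auto
  qed
  have iff: "kl M f g < \<top> \<longleftrightarrow> integrable M h"
  proof
    assume "kl M f g < \<top>"
    then show "integrable M h"
      unfolding kl_h using h_nonneg by (intro integrableI_nonneg) auto
  next
    assume "integrable M h"
    then show "kl M f g < \<top>"
      unfolding kl_h using h_nonneg by (simp add: nn_integral_eq_integral)
  qed
  then show "kl M f g < \<top> \<longleftrightarrow> integrable M (\<lambda>x. f x * ln (f x / g x))"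
    using int_h by simp
  assume "kl M f g < \<top>"
  with iff have ih: "integrable M h" by simp
  have eq: "(\<integral>x. f x * ln (f x / g x) \<partial>M) = (\<integral>x. h x \<partial>M)"
    unfolding h_alt using ih int_f int_g f1 g1 by simp
  show "kl M f g = ennreal (\<integral>x. f x * ln (f x / g x) \<partial>M)"
    unfolding eq kl_h using ih h_nonneg by (intro nn_integral_eq_integral) auto
  show "(\<integral>x. f x * ln (f x / g x) \<partial>M) \<ge> 0"
    unfolding eq using h_nonneg by (intro integral_nonneg_AE) auto
qed

text \<open>The bridge from relative entropy in bits to \<open>kl\<close> in nats. When absolute
  continuity fails, both sides are infinite, as \<open>kl_term\<close> is then \<open>\<top>\<close>
  on a set that is not null.\<close>

lemma rel_entropy_density:
  assumes "sigma_finite_measure M"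
    and [measurable]: "f \<in> borel_measurable M" "g \<in> borel_measurable M"
    and nonneg: "\<And>x. x \<in> space M \<Longrightarrow> f x \<ge> 0" "\<And>x. x \<in> space M \<Longrightarrow> g x \<ge> 0"
    and f: "(\<integral>\<^sup>+x. ennreal (f x) \<partial>M) = 1" and g: "(\<integral>\<^sup>+x. ennreal (g x) \<partial>M) = 1"
  shows "rel_entropy (density M (\<lambda>x. ennreal (f x))) (density M (\<lambda>x. ennreal (g x))) =
    enn2ereal (kl M f g) / ereal (ln 2)"
proof (cases "AE x in M. g x = 0 \<longrightarrow> f x = 0")
  case ac: True
  interpret sigma_finite_measure M by fact
  let ?F = "density M (\<lambda>x. ennreal (f x))" and ?G = "density M (\<lambda>x. ennreal (g x))"
  have "prob_space ?G"
    using g by (intro prob_spaceI) (simp add: emeasure_density cong: nn_integral_cong)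
  then interpret G: prob_space ?G .
  define r where "r x = f x / g x" for x
  have [measurable]: "r \<in> borel_measurable M" unfolding r_def by measurable
  \<comment> \<open>The quotient is a density of \<open>?F\<close> with respect to
    \<open>?G\<close>, so uniqueness identifies it with the Radon-Nikodym derivative inside
    \<open>entropy_density\<close>.\<close>
  have F_eq: "density ?G (\<lambda>x. ennreal (r x)) = ?F"
    unfolding r_def using ac nonneg by (intro density_density_divide) auto
  have AC: "absolutely_continuous ?G ?F"
    unfolding F_eq[symmetric] by (rule absolutely_continuousI_density) auto
  have "AE x in ?G. ennreal (r x) = RN_deriv ?G ?F x"
    by (rule G.RN_deriv_unique) (auto simp: F_eq)
  then have RN: "AE x in ?F. ennreal (r x) = RN_deriv ?G ?F x"
    by (rule absolutely_continuous_AE[OF _ AC, rotated]) simp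
  have ed: "AE x in ?F. entropy_density 2 ?G ?F x = ln (r x) / ln 2"
    using RN AE_space
  proof eventually_elim
    case (elim x)
    have "r x \<ge> 0" using elim nonneg by (auto simp: r_def)
    then show ?case
      unfolding entropy_density_def by (simp add: elim(1)[symmetric] log_def)
  qed
  have [measurable]: "entropy_density 2 ?G ?F \<in> borel_measurable M"
    using measurable_entropy_density[of 2 ?G ?F] by simp
  have int: "integrable ?F (entropy_density 2 ?G ?F) \<longleftrightarrow> kl M f g < \<top>"
  proof -
    have "integrable ?F (entropy_density 2 ?G ?F) \<longleftrightarrow> integrable ?F (\<lambda>x. ln (r x) / ln 2)"
      using ed by (intro integrable_cong_AE) auto
    also have "\<dots> \<longleftrightarrow> integrable ?F (\<lambda>x. ln (r x))"
      using integrable_mult_left_iff[of ?F "1 / ln 2" "\<lambda>x. ln (r x)"] by simp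
    also have "\<dots> \<longleftrightarrow> integrable M (\<lambda>x. f x * ln (r x))"
      using nonneg by (subst integrable_real_density) auto
    finally show ?thesis
      using kl_eq_integral(1)[OF _ _ nonneg ac f g] by (simp add: r_def)
  qed
  show ?thesis
  proof (cases "kl M f g < \<top>")
    case True
    have "KL_divergence 2 ?G ?F = (\<integral>x. ln (r x) / ln 2 \<partial>?F)"
      unfolding KL_divergence_def using ed by (intro integral_cong_AE) auto
    also have "\<dots> = (\<integral>x. f x * ln (r x) \<partial>M) / ln 2"
      using nonneg by (subst integral_real_density) auto
    finally show ?thesis
      using int True AC kl_eq_integral(2,3)[OF _ _ nonneg ac f g True]
      by (simp add: rel_entropy_def r_def enn2ereal_ennreal)
  next
    case False
    then show ?thesis
      using int by (auto simp: rel_entropy_def less_top[symmetric])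
  qed
next
  case nac: False
  let ?F = "density M (\<lambda>x. ennreal (f x))" and ?G = "density M (\<lambda>x. ennreal (g x))"
  \<comment> \<open>This set witnesses the failure: it is null for \<open>?G\<close>, while
    \<open>f\<close> is positive on a non-null part of it.\<close>
  let ?E = "{x\<in>space M. g x = 0}"
  have "\<not> absolutely_continuous ?G ?F"
  proof
    assume ac: "absolutely_continuous ?G ?F"
    have "?E \<in> null_sets ?G"
      using nonneg by (subst null_sets_density_iff) auto
    with ac have "?E \<in> null_sets ?F"
      by (auto simp: absolutely_continuous_def)
    then have "AE x in M. x \<in> ?E \<longrightarrow> ennreal (f x) = 0"
      by (subst (asm) null_sets_density_iff) auto
    then have "AE x in M. g x = 0 \<longrightarrow> f x = 0"
      using AE_space by eventually_elim (use nonneg in \<open>auto simp: ennreal_eq_0_iff intro: antisym\<close>)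
    with nac show False by simp
  qed
  moreover have "kl M f g = \<top>"
  proof (rule ccontr)
    assume "kl M f g \<noteq> \<top>"
    then have "AE x in M. kl_term (f x) (g x) \<noteq> \<top>"
      using nn_integral_PInf_AE[of "\<lambda>x. kl_term (f x) (g x)" M] unfolding kl_def by simp
    then have "AE x in M. g x = 0 \<longrightarrow> f x = 0"
      by eventually_elim (auto simp: kl_term_def split: if_splits)
    with nac show False by simp
  qed
  ultimately show ?thesis
    by (simp add: rel_entropy_def)
qed

subsection \<open>Joint laws of kernels\<close>

lemma emeasure_distr_eq_nn_integral:
  "f \<in> M \<rightarrow>\<^sub>M N \<Longrightarrow> E \<in> sets N \<Longrightarrow> emeasure (distr M N f) E = (\<integral>\<^sup>+x. indicator E (f x) \<partial>M)"
  using nn_integral_distr[of f M N "indicator E"] by simp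

lemma prob_space_densityI:
  "f \<in> borel_measurable M \<Longrightarrow> (\<integral>\<^sup>+x. f x \<partial>M) = 1 \<Longrightarrow> prob_space (density M f)"
  by (intro prob_spaceI) (simp add: emeasure_density cong: nn_integral_cong)

lemma measurable_pair_countable2:
  assumes "countable Z" and "\<And>z. z \<in> Z \<Longrightarrow> (\<lambda>y. f (y, z)) \<in> V \<rightarrow>\<^sub>M M"
  shows "f \<in> V \<Otimes>\<^sub>M count_space Z \<rightarrow>\<^sub>M M"
proof -
  have "(\<lambda>x. f (fst x, snd x)) \<in> V \<Otimes>\<^sub>M count_space Z \<rightarrow>\<^sub>M M"
    using assms by (intro measurable_compose_countable'[where f = "\<lambda>z x. f (fst x, z)" and g = snd and I = Z]) auto
  then show ?thesis by simp
qed

lemma nn_integral_kernel_law: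
  assumes "prob_space A" and k[measurable]: "k \<in> A \<rightarrow>\<^sub>M prob_algebra B"
    and [measurable]: "f \<in> borel_measurable (A \<Otimes>\<^sub>M B)"
  shows "(\<integral>\<^sup>+x. f x \<partial>kernel_law A B k) = (\<integral>\<^sup>+a. \<integral>\<^sup>+b. f (a, b) \<partial>k a \<partial>A)"
proof -
  interpret A: prob_space A by fact
  have "(\<lambda>a. distr (k a) (A \<Otimes>\<^sub>M B) (Pair a)) \<in> A \<rightarrow>\<^sub>M prob_algebra (A \<Otimes>\<^sub>M B)"
    by measurable
  then have "(\<integral>\<^sup>+x. f x \<partial>kernel_law A B k) = (\<integral>\<^sup>+a. \<integral>\<^sup>+x. f x \<partial>distr (k a) (A \<Otimes>\<^sub>M B) (Pair a) \<partial>A)"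
    unfolding kernel_law_def
    by (intro nn_integral_bind[where B = "A \<Otimes>\<^sub>M B"] measurable_prob_algebraD) auto
  also have "\<dots> = (\<integral>\<^sup>+a. \<integral>\<^sup>+b. f (a, b) \<partial>k a \<partial>A)"
  proof (rule nn_integral_cong)
    fix a assume a[measurable]: "a \<in> space A"
    have [measurable_cong]: "sets (k a) = sets B"
      using measurable_space[OF k a] by (simp add: space_prob_algebra)
    show "(\<integral>\<^sup>+x. f x \<partial>distr (k a) (A \<Otimes>\<^sub>M B) (Pair a)) = (\<integral>\<^sup>+b. f (a, b) \<partial>k a)"
      by (subst nn_integral_distr) auto
  qed
  finally show ?thesis .
qed

lemma space_kernel_law:
  assumes "prob_space A" "k \<in> A \<rightarrow>\<^sub>M prob_algebra B"
  shows "kernel_law A B k \<in> space (prob_algebra (A \<Otimes>\<^sub>M B))"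
proof -
  interpret A: prob_space A by fact
  note assms(2)[measurable]
  have A: "A \<in> space (prob_algebra A)"
    using assms by (simp add: space_prob_algebra)
  have k: "(\<lambda>a. distr (k a) (A \<Otimes>\<^sub>M B) (Pair a)) \<in> A \<rightarrow>\<^sub>M prob_algebra (A \<Otimes>\<^sub>M B)"
    by measurable
  show ?thesis
    unfolding kernel_law_def space_prob_algebra
    using sets_bind'[OF A k] prob_space_bind'[OF A k] by auto
qed

lemma prob_space_kernel_law:
  "prob_space A \<Longrightarrow> k \<in> A \<rightarrow>\<^sub>M prob_algebra B \<Longrightarrow> prob_space (kernel_law A B k)"
  using space_kernel_law[of A k B] by (simp add: space_prob_algebra)

lemma sets_kernel_law:
  "prob_space A \<Longrightarrow> k \<in> A \<rightarrow>\<^sub>M prob_algebra B \<Longrightarrow> sets (kernel_law A B k) = sets (A \<Otimes>\<^sub>M B)"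
  using space_kernel_law[of A k B] by (simp add: space_prob_algebra)

lemma emeasure_kernel_law:
  assumes "prob_space A" "k \<in> A \<rightarrow>\<^sub>M prob_algebra B" and E[measurable]: "E \<in> sets (A \<Otimes>\<^sub>M B)"
  shows "emeasure (kernel_law A B k) E = (\<integral>\<^sup>+a. emeasure (k a) (Pair a -` E) \<partial>A)"
proof -
  have "emeasure (kernel_law A B k) E = (\<integral>\<^sup>+x. indicator E x \<partial>kernel_law A B k)"
    using sets_kernel_law[OF assms(1,2)] E by simp
  also have "\<dots> = (\<integral>\<^sup>+a. \<integral>\<^sup>+b. indicator E (a, b) \<partial>k a \<partial>A)"
    by (rule nn_integral_kernel_law[OF assms(1,2)]) simp
  also have "\<dots> = (\<integral>\<^sup>+a. emeasure (k a) (Pair a -` E) \<partial>A)"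
  proof (rule nn_integral_cong)
    fix a assume a: "a \<in> space A"
    have "Pair a -` E \<in> sets (k a)"
      using measurable_space[OF assms(2) a] E by (auto simp: space_prob_algebra sets_Pair1)
    moreover have "indicator E (a, b) = (indicator (Pair a -` E) b :: ennreal)" for b
      by (simp split: split_indicator)
    ultimately show "(\<integral>\<^sup>+b. indicator E (a, b) \<partial>k a) = emeasure (k a) (Pair a -` E)"
      by simp
  qed
  finally show ?thesis .
qed

lemma kernel_law_cong_AE:
  assumes "prob_space A" "k \<in> A \<rightarrow>\<^sub>M prob_algebra B" "k' \<in> A \<rightarrow>\<^sub>M prob_algebra B"
    and "AE a in A. k a = k' a"
  shows "kernel_law A B k = kernel_law A B k'"
proof (rule measure_eqI)
  show "sets (kernel_law A B k) = sets (kernel_law A B k')"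
    using assms by (simp add: sets_kernel_law)
  fix E assume "E \<in> sets (kernel_law A B k)"
  then have "E \<in> sets (A \<Otimes>\<^sub>M B)" using assms by (simp add: sets_kernel_law)
  then show "emeasure (kernel_law A B k) E = emeasure (kernel_law A B k') E"
    using assms by (auto simp: emeasure_kernel_law intro!: nn_integral_cong_AE)
qed

lemma distr_kernel_law_fst:
  assumes "prob_space A" "k \<in> A \<rightarrow>\<^sub>M prob_algebra B"
  shows "distr (kernel_law A B k) A fst = A"
proof (rule measure_eqI)
  fix E assume "E \<in> sets (distr (kernel_law A B k) A fst)"
  then have E[measurable]: "E \<in> sets A" by simp
  note [measurable_cong] = sets_kernel_law[OF assms]
  have "emeasure (distr (kernel_law A B k) A fst) E = (\<integral>\<^sup>+x. indicator E (fst x) \<partial>kernel_law A B k)"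
    by (rule emeasure_distr_eq_nn_integral) auto
  also have "\<dots> = (\<integral>\<^sup>+a. \<integral>\<^sup>+b. indicator E a \<partial>k a \<partial>A)"
    by (subst nn_integral_kernel_law[OF assms]) auto
  also have "\<dots> = (\<integral>\<^sup>+a. indicator E a \<partial>A)"
  proof (rule nn_integral_cong)
    fix a assume "a \<in> space A"
    then interpret k: prob_space "k a"
      using measurable_space[OF assms(2)] by (simp add: space_prob_algebra)
    show "(\<integral>\<^sup>+b. indicator E a \<partial>k a) = (indicator E a :: ennreal)"
      by (simp add: k.emeasure_space_1)
  qed
  finally show "emeasure (distr (kernel_law A B k) A fst) E = emeasure A E" by simp
qed simp

text \<open>Relabelling the input does not affect the output: after a change of variables both sides
  integrate over \<open>A\<close> against \<open>k (f a)\<close>.\<close>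

lemma kernel_law_distr:
  assumes "prob_space A" and f[measurable]: "f \<in> A \<rightarrow>\<^sub>M A'" and k[measurable]: "k \<in> A' \<rightarrow>\<^sub>M prob_algebra B"
  shows "kernel_law (distr A A' f) B k =
    distr (kernel_law A B (\<lambda>a. k (f a))) (A' \<Otimes>\<^sub>M B) (\<lambda>(a, b). (f a, b))"
proof (rule measure_eqI)
  interpret A: prob_space A by fact
  have D: "prob_space (distr A A' f)" by (rule A.prob_space_distr) fact
  have [measurable]: "(\<lambda>a. k (f a)) \<in> A \<rightarrow>\<^sub>M prob_algebra B" by measurable
  have k': "k \<in> distr A A' f \<rightarrow>\<^sub>M prob_algebra B" by simp
  note [measurable_cong] = sets_kernel_law[OF assms(1), of "\<lambda>a. k (f a)" B]
  show "sets (kernel_law (distr A A' f) B k) =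
      sets (distr (kernel_law A B (\<lambda>a. k (f a))) (A' \<Otimes>\<^sub>M B) (\<lambda>(a, b). (f a, b)))"
    by (simp add: sets_kernel_law[OF D k'] cong: sets_pair_measure_cong)
  fix E assume "E \<in> sets (kernel_law (distr A A' f) B k)"
  then have E[measurable]: "E \<in> sets (A' \<Otimes>\<^sub>M B)"
    by (simp add: sets_kernel_law[OF D k'] cong: sets_pair_measure_cong)
  have E': "E \<in> sets (distr A A' f \<Otimes>\<^sub>M B)"
    using E by (simp cong: sets_pair_measure_cong)
  have "emeasure (kernel_law (distr A A' f) B k) E = (\<integral>\<^sup>+x. indicator E x \<partial>kernel_law (distr A A' f) B k)"
    using sets_kernel_law[OF D k'] E' by simp
  also have "\<dots> = (\<integral>\<^sup>+a'. \<integral>\<^sup>+b. indicator E (a', b) \<partial>k a' \<partial>distr A A' f)"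
    using E' by (intro nn_integral_kernel_law[OF D k']) simp
  also have "\<dots> = (\<integral>\<^sup>+a. \<integral>\<^sup>+b. indicator E (f a, b) \<partial>k (f a) \<partial>A)"
  proof (rule nn_integral_distr)
    have "(\<lambda>a'. \<integral>\<^sup>+b. (\<lambda>(a', b). indicator E (a', b)) (a', b) \<partial>k a') \<in> borel_measurable A'"
      by (rule nn_integral_measurable_subprob_algebra2[where N = B])
         (auto intro!: measurable_prob_algebraD)
    then show "(\<lambda>a'. \<integral>\<^sup>+b. indicator E (a', b) \<partial>k a') \<in> borel_measurable (distr A A' f)" by simp
  qed fact
  also have "\<dots> = (\<integral>\<^sup>+x. indicator E (case x of (a, b) \<Rightarrow> (f a, b)) \<partial>kernel_law A B (\<lambda>a. k (f a)))"
    by (subst nn_integral_kernel_law[OF assms(1)]) (auto simp: case_prod_beta)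
  also have "\<dots> = emeasure (distr (kernel_law A B (\<lambda>a. k (f a))) (A' \<Otimes>\<^sub>M B) (\<lambda>(a, b). (f a, b))) E"
    by (rule emeasure_distr_eq_nn_integral[symmetric]) auto
  finally show "emeasure (kernel_law (distr A A' f) B k) E = \<dots>" .
qed

subsection \<open>Kernels into a countable alphabet\<close>

text \<open>Mixtures and averaged channels are given by their masses; this makes them kernels.
  Countability reduces joint measurability to measurability in \<open>y\<close> for each fixed
  letter.\<close>

lemma kernel_of_pmf:
  fixes p :: "'a \<Rightarrow> 'b \<Rightarrow> real"
  assumes Z: "countable Z"
    and meas: "\<And>z. z \<in> Z \<Longrightarrow> (\<lambda>y. p y z) \<in> borel_measurable V"
    and sum: "\<And>y. y \<in> space V \<Longrightarrow> (\<integral>\<^sup>+z. ennreal (p y z) \<partial>count_space Z) = 1"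
  shows "(\<lambda>y. density (count_space Z) (\<lambda>z. ennreal (p y z))) \<in> V \<rightarrow>\<^sub>M prob_algebra (count_space Z)"
proof (rule measurable_prob_algebraI)
  interpret sigma_finite_measure "count_space Z"
    by (rule sigma_finite_measure_count_space_countable) fact
  show "prob_space (density (count_space Z) (\<lambda>z. ennreal (p y z)))" if "y \<in> space V" for y
    using sum[OF that] by (intro prob_space_densityI) auto
  then show "(\<lambda>y. density (count_space Z) (\<lambda>z. ennreal (p y z))) \<in> V \<rightarrow>\<^sub>M subprob_algebra (count_space Z)"
  proof (intro measurable_subprob_algebra prob_space_imp_subprob_space)
    fix E assume E: "E \<in> sets (count_space Z)"
    have [measurable]: "(\<lambda>x. ennreal (p (fst x) (snd x))) \<in> borel_measurable (V \<Otimes>\<^sub>M count_space Z)"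
      using Z meas by (intro measurable_compose[OF measurable_pair_countable2 measurable_ennreal]) auto
    have "(\<lambda>y. \<integral>\<^sup>+z. ennreal (p y z) * indicator E z \<partial>count_space Z) \<in> borel_measurable V"
      using E by measurable
    moreover have "(\<lambda>y. emeasure (density (count_space Z) (\<lambda>z. ennreal (p y z))) E) =
        (\<lambda>y. \<integral>\<^sup>+z. ennreal (p y z) * indicator E z \<partial>count_space Z)"
      using E by (intro ext emeasure_density) auto
    ultimately show "(\<lambda>y. emeasure (density (count_space Z) (\<lambda>z. ennreal (p y z))) E) \<in> borel_measurable V"
      by simp
  qed auto
qed

lemma measure_density_count_space:
  assumes "z \<in> Z" "p z \<ge> 0"
  shows "measure (density (count_space Z) (\<lambda>z. ennreal (p z))) {z} = p z"
proof -
  have "emeasure (density (count_space Z) (\<lambda>z. ennreal (p z))) {z} =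
      (\<integral>\<^sup>+x. ennreal (p z) * indicator {z} x \<partial>count_space Z)"
    using assms by (auto simp: emeasure_density intro!: nn_integral_cong split: split_indicator)
  also have "\<dots> = ennreal (p z)"
    using assms by (simp add: nn_integral_cmult emeasure_count_space)
  finally show ?thesis
    using assms by (simp add: measure_def)
qed

abbreviation joint_pmf :: "('a \<Rightarrow> 'b measure) \<Rightarrow> 'a \<times> 'b \<Rightarrow> real" where
  "joint_pmf k x \<equiv> measure (k (fst x)) {snd x}"

definition out_pmf :: "'a measure \<Rightarrow> ('a \<Rightarrow> 'b measure) \<Rightarrow> 'b \<Rightarrow> real" where
  "out_pmf V k z = (\<integral>y. measure (k y) {z} \<partial>V)"

text \<open>The relative entropy of the joint law of \<open>V\<close> and \<open>k\<close> with
  respect to the product of \<open>V\<close> and the law with masses \<open>r\<close>, both having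
  densities with respect to \<open>V\<close> times counting measure. The masses \<open>r\<close> are
  left free so that output laws of other kernels can serve as reference.\<close>

definition kernel_kl :: "'a measure \<Rightarrow> 'b set \<Rightarrow> ('a \<Rightarrow> 'b measure) \<Rightarrow> ('b \<Rightarrow> real) \<Rightarrow> ennreal" where
  "kernel_kl V Z k r =
     kl (V \<Otimes>\<^sub>M count_space Z) (joint_pmf k) (\<lambda>x. r (snd x))"

text \<open>A countable output alphabet gives every joint law a density with respect to the one
  sigma-finite measure \<open>VZ\<close>, so kernels are compared through their masses.\<close>

locale discrete_channel = prob_space V for V :: "'a measure" +
  fixes Z :: "'b set"
  assumes countable_Z: "countable Z"
begin

sublocale N: sigma_finite_measure "count_space Z"
  by (rule sigma_finite_measure_count_space_countable) (rule countable_Z)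

sublocale VN: pair_sigma_finite V "count_space Z" ..

abbreviation channel :: "('a \<Rightarrow> 'b measure) \<Rightarrow> bool" where
  "channel k \<equiv> k \<in> V \<rightarrow>\<^sub>M prob_algebra (count_space Z)"

abbreviation law :: "('a \<Rightarrow> 'b measure) \<Rightarrow> ('a \<times> 'b) measure" where
  "law k \<equiv> kernel_law V (count_space Z) k"

abbreviation VZ :: "('a \<times> 'b) measure" where
  "VZ \<equiv> V \<Otimes>\<^sub>M count_space Z"

lemma measurable_count_snd:
  "(\<And>z. z \<in> Z \<Longrightarrow> (\<lambda>y. f (y, z)) \<in> V \<rightarrow>\<^sub>M M) \<Longrightarrow> f \<in> VZ \<rightarrow>\<^sub>M M"
  by (rule measurable_pair_countable2[OF countable_Z])

lemma measurable_of_snd [measurable]: "(\<lambda>x. (r (snd x) :: real)) \<in> borel_measurable VZ"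
  by (rule measurable_count_snd) auto

lemma measurable_channel_pmf:
  assumes [measurable]: "channel k" and "z \<in> Z"
  shows "(\<lambda>y. measure (k y) {z}) \<in> borel_measurable V"
proof -
  have [measurable]: "{z} \<in> sets (count_space Z)" using assms by simp
  show ?thesis by measurable
qed

lemma measurable_channel_joint_pmf:
  assumes "channel k"
  shows "(joint_pmf k) \<in> borel_measurable VZ"
  using measurable_channel_pmf[OF assms] by (intro measurable_count_snd) auto

lemma
  assumes "channel k" "y \<in> space V"
  shows prob_space_channel: "prob_space (k y)"
    and sets_channel: "sets (k y) = Pow Z"
    and space_channel: "space (k y) = Z"
  using measurable_space[OF assms] sets_eq_imp_space_eq[of "k y" "count_space Z"]
  by (auto simp: space_prob_algebra)

lemma channel_eq_density:
  assumes "channel k" "y \<in> space V"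
  shows "k y = density (count_space Z) (\<lambda>z. ennreal (measure (k y) {z}))"
proof -
  interpret k: prob_space "k y" by (rule prob_space_channel) fact+
  show ?thesis
    by (rule density_discrete[symmetric])
       (use countable_Z assms in \<open>auto simp: sets_channel k.emeasure_eq_measure\<close>)
qed

lemma nn_integral_channel:
  assumes "channel k" "y \<in> space V"
  shows "(\<integral>\<^sup>+z. f z \<partial>k y) = (\<integral>\<^sup>+z. ennreal (measure (k y) {z}) * f z \<partial>count_space Z)"
  by (subst channel_eq_density[OF assms]) (simp add: nn_integral_density)

lemma nn_integral_channel_pmf:
  assumes "channel k" "y \<in> space V"
  shows "(\<integral>\<^sup>+z. ennreal (measure (k y) {z}) \<partial>count_space Z) = 1"
proof -
  interpret k: prob_space "k y" by (rule prob_space_channel) fact+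
  show ?thesis
    using nn_integral_channel[OF assms, of "\<lambda>_. 1"] by (simp add: k.emeasure_space_1)
qed

lemma channel_pmf_le_1:
  assumes "channel k" "y \<in> space V"
  shows "measure (k y) {z} \<le> 1"
  using prob_space.prob_le_1[OF prob_space_channel[OF assms]] .

lemma integrable_channel_pmf:
  assumes "channel k" "z \<in> Z"
  shows "integrable V (\<lambda>y. measure (k y) {z})"
  using measurable_channel_pmf[OF assms] channel_pmf_le_1[OF assms(1)]
  by (intro integrable_const_bound[where B = 1]) auto

lemma out_pmf_nonneg: "out_pmf V k z \<ge> 0"
  unfolding out_pmf_def by (intro integral_nonneg_AE) auto

lemma nn_integral_out_pmf_inner:
  assumes "channel k" "z \<in> Z"
  shows "(\<integral>\<^sup>+y. ennreal (measure (k y) {z}) \<partial>V) = ennreal (out_pmf V k z)"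
  unfolding out_pmf_def using integrable_channel_pmf[OF assms] by (intro nn_integral_eq_integral) auto

lemma nn_integral_out_pmf:
  assumes "channel k"
  shows "(\<integral>\<^sup>+z. ennreal (out_pmf V k z) \<partial>count_space Z) = 1"
proof -
  note [measurable] = measurable_channel_joint_pmf[OF assms]
  have "(\<integral>\<^sup>+z. ennreal (out_pmf V k z) \<partial>count_space Z) =
      (\<integral>\<^sup>+z. \<integral>\<^sup>+y. ennreal (measure (k y) {z}) \<partial>V \<partial>count_space Z)"
    by (intro nn_integral_cong) (simp add: nn_integral_out_pmf_inner assms)
  also have "\<dots> = (\<integral>\<^sup>+y. \<integral>\<^sup>+z. ennreal (measure (k y) {z}) \<partial>count_space Z \<partial>V)"
    by (rule VN.Fubini') simp
  also have "\<dots> = (\<integral>\<^sup>+y. 1 \<partial>V)"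
    by (intro nn_integral_cong) (simp add: nn_integral_channel_pmf assms)
  finally show ?thesis by (simp add: emeasure_space_1)
qed

lemma nn_integral_channel_law:
  assumes k: "channel k" and [measurable]: "f \<in> borel_measurable VZ"
  shows "(\<integral>\<^sup>+x. f x \<partial>law k) =
    (\<integral>\<^sup>+x. ennreal (joint_pmf k x) * f x \<partial>VZ)"
proof -
  note [measurable] = measurable_channel_joint_pmf[OF k]
  have "(\<integral>\<^sup>+x. f x \<partial>law k) = (\<integral>\<^sup>+y. \<integral>\<^sup>+z. f (y, z) \<partial>k y \<partial>V)"
    by (rule nn_integral_kernel_law[OF prob_space_axioms k]) fact
  also have "\<dots> = (\<integral>\<^sup>+y. \<integral>\<^sup>+z. ennreal (measure (k y) {z}) * f (y, z) \<partial>count_space Z \<partial>V)"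
    by (intro nn_integral_cong) (simp add: nn_integral_channel k)
  also have "\<dots> = (\<integral>\<^sup>+x. ennreal (joint_pmf k x) * f x \<partial>VZ)"
    by (subst N.nn_integral_fst[symmetric]) auto
  finally show ?thesis .
qed

lemma channel_law_eq_density:
  assumes k: "channel k"
  shows "law k =
    density VZ (\<lambda>x. ennreal (joint_pmf k x))"
proof (rule measure_eqI)
  note [measurable] = measurable_channel_joint_pmf[OF k]
  note sets = sets_kernel_law[OF prob_space_axioms k]
  show "sets (law k) =
      sets (density VZ (\<lambda>x. ennreal (joint_pmf k x)))"
    using sets by simp
  fix E assume E: "E \<in> sets (law k)"
  then have [measurable]: "E \<in> sets VZ" using sets by simp
  show "emeasure (law k) E =
      emeasure (density VZ (\<lambda>x. ennreal (joint_pmf k x))) E"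
    using nn_integral_channel_law[OF k, of "indicator E"] E by (simp add: emeasure_density)
qed

lemma distr_channel_law_snd:
  assumes k: "channel k"
  shows "distr (law k) (count_space Z) snd =
    density (count_space Z) (\<lambda>z. ennreal (out_pmf V k z))"
proof (rule measure_eqI_countable[where A = Z])
  note [measurable] = measurable_channel_joint_pmf[OF k]
  note [measurable_cong] = sets_kernel_law[OF prob_space_axioms k]
  fix z assume z: "z \<in> Z"
  then have [measurable]: "{z} \<in> sets (count_space Z)" by simp
  have "emeasure (distr (law k) (count_space Z) snd) {z} =
      (\<integral>\<^sup>+x. indicator {z} (snd x) \<partial>law k)"
    by (rule emeasure_distr_eq_nn_integral) (use z in auto)
  also have "\<dots> = (\<integral>\<^sup>+x. ennreal (joint_pmf k x) * indicator {z} (snd x) \<partial>VZ)"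
    by (rule nn_integral_channel_law[OF k]) measurable
  also have "\<dots> = (\<integral>\<^sup>+z'. \<integral>\<^sup>+y. ennreal (measure (k y) {z'}) * indicator {z} z' \<partial>V \<partial>count_space Z)"
    by (subst VN.nn_integral_snd[symmetric]) auto
  also have "\<dots> = (\<integral>\<^sup>+z'. ennreal (out_pmf V k z') * indicator {z} z' \<partial>count_space Z)"
    using measurable_channel_pmf[OF k]
    by (intro nn_integral_cong) (simp add: nn_integral_multc nn_integral_out_pmf_inner k)
  also have "\<dots> = emeasure (density (count_space Z) (\<lambda>z. ennreal (out_pmf V k z))) {z}"
    using z by (simp add: emeasure_density)
  finally show "emeasure (distr (law k) (count_space Z) snd) {z} = \<dots>" .
qed (use countable_Z in auto)

lemma nn_integral_joint_pmf:
  assumes k: "channel k"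
  shows "(\<integral>\<^sup>+x. ennreal (joint_pmf k x) \<partial>VZ) = 1"
proof -
  interpret J: prob_space "law k"
    by (rule prob_space_kernel_law[OF prob_space_axioms k])
  show ?thesis
    using nn_integral_channel_law[OF k, of "\<lambda>_. 1"] by (simp add: J.emeasure_space_1)
qed

lemma nn_integral_product_pmf:
  assumes "(\<integral>\<^sup>+z. ennreal (r z) \<partial>count_space Z) = 1"
  shows "(\<integral>\<^sup>+x. ennreal (r (snd x)) \<partial>VZ) = 1"
proof -
  show ?thesis
    using assms by (subst VN.nn_integral_snd[symmetric]) (auto simp: emeasure_space_1)
qed

lemma mutual_info_channel:
  assumes k: "channel k"
  shows "mutual_info V (count_space Z) (law k) =
    enn2ereal (kernel_kl V Z k (out_pmf V k)) / ereal (ln 2)"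
proof -
  note [measurable] = measurable_channel_joint_pmf[OF k]
  have "prob_space (density (count_space Z) (\<lambda>z. ennreal (out_pmf V k z)))"
    using nn_integral_out_pmf[OF k] by (intro prob_space_densityI) auto
  then interpret D: prob_space "density (count_space Z) (\<lambda>z. ennreal (out_pmf V k z))" .
  \<comment> \<open>\<open>V\<close> is written as a density with constant value 1 so that the rule
    for products of densities applies.\<close>
  have "V \<Otimes>\<^sub>M density (count_space Z) (\<lambda>z. ennreal (out_pmf V k z)) =
      density V (\<lambda>_. 1) \<Otimes>\<^sub>M density (count_space Z) (\<lambda>z. ennreal (out_pmf V k z))"
    by (simp add: density_1)
  also have "\<dots> = density VZ (\<lambda>(y, z). 1 * ennreal (out_pmf V k z))"
    by (rule pair_measure_density) (auto intro: N.sigma_finite_measure_axioms D.sigma_finite_measure_axioms)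
  finally have prod: "V \<Otimes>\<^sub>M density (count_space Z) (\<lambda>z. ennreal (out_pmf V k z)) =
      density VZ (\<lambda>x. ennreal (out_pmf V k (snd x)))"
    by (simp add: case_prod_unfold)
  show ?thesis
    unfolding mutual_info_def distr_kernel_law_fst[OF prob_space_axioms k]
      distr_channel_law_snd[OF k] prod kernel_kl_def
    unfolding channel_law_eq_density[OF k]
    by (rule rel_entropy_density)
       (auto simp: out_pmf_nonneg nn_integral_joint_pmf k nn_integral_product_pmf nn_integral_out_pmf
         intro: VN.P.sigma_finite_measure_axioms)
qed

lemma rel_entropy_out:
  assumes k: "channel k" and k': "channel k'"
  shows "rel_entropy (distr (law k) (count_space Z) snd)
      (distr (law k') (count_space Z) snd) =
    enn2ereal (kl (count_space Z) (out_pmf V k) (out_pmf V k')) / ereal (ln 2)"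
  unfolding distr_channel_law_snd[OF k] distr_channel_law_snd[OF k']
  by (rule rel_entropy_density)
     (auto simp: out_pmf_nonneg nn_integral_out_pmf k k' intro: N.sigma_finite_measure_axioms)

end

section \<open>Compensation identities, mixtures and the projection inequality\<close>

text \<open>The lower bound is \<open>ln_ratio_ge\<close> at \<open>b = 1\<close>. It makes
  \<open>p * ln p\<close> integrable for any random mass \<open>p\<close> on a probability
  space.\<close>

lemma abs_mult_ln_le_1:
  fixes x :: real
  assumes "0 \<le> x" "x \<le> 1"
  shows "\<bar>x * ln x\<bar> \<le> 1"
proof (cases "x = 0")
  case False
  have "1 - x + x * ln x \<ge> 0"
    using ln_ratio_ge[of x 1] assms by (simp add: algebra_simps)
  moreover have "x * ln x \<le> 0"
    using assms False by (simp add: mult_nonneg_nonpos)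
  ultimately show ?thesis using assms by (simp add: abs_le_iff)
qed simp

text \<open>\<open>kl_term\<close> is a Bregman divergence: its dependence on \<open>r\<close> is
  affine in \<open>p\<close> up to a term in \<open>r\<close> alone, so the expected divergence to
  \<open>r\<close> splits at the mean of \<open>p\<close>.\<close>

lemma (in prob_space) nn_integral_kl_term_mean:
  fixes p :: "'a \<Rightarrow> real"
  assumes p[measurable]: "p \<in> borel_measurable M"
    and p01: "\<And>y. y \<in> space M \<Longrightarrow> 0 \<le> p y" "\<And>y. y \<in> space M \<Longrightarrow> p y \<le> 1"
    and r: "r \<ge> 0"
  shows "(\<integral>\<^sup>+y. kl_term (p y) r \<partial>M) =
    (\<integral>\<^sup>+y. kl_term (p y) (expectation p) \<partial>M) + kl_term (expectation p) r"
proof -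
  define q where "q = expectation p"
  have int_p: "integrable M p"
    using p01 by (intro integrable_const_bound[where B = 1]) auto
  have q_nonneg: "q \<ge> 0"
    unfolding q_def using p01 by (intro integral_nonneg_AE AE_I2) auto
  have q0_iff: "q = 0 \<longleftrightarrow> (AE y in M. p y = 0)"
    unfolding q_def using p01 int_p by (intro integral_nonneg_eq_0_iff_AE AE_I2) auto
  \<comment> \<open>The algebraic identity needs \<open>q\<close> and \<open>r\<close> positive. If
    \<open>q = 0\<close> then \<open>p\<close> vanishes almost everywhere; if only
    \<open>r = 0\<close> then both sides are infinite.\<close>
  consider "q = 0" | "q > 0" "r = 0" | "q > 0" "r > 0"
    using q_nonneg r by linarith
  then have "(\<integral>\<^sup>+y. kl_term (p y) r \<partial>M) = (\<integral>\<^sup>+y. kl_term (p y) q \<partial>M) + kl_term q r"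
  proof cases
    case 1
    then have ae: "AE y in M. p y = 0" using q0_iff by simp
    have "(\<integral>\<^sup>+y. kl_term (p y) x \<partial>M) = (\<integral>\<^sup>+y. ennreal x \<partial>M)" for x
      using ae by (intro nn_integral_cong_AE) auto
    then show ?thesis
      using 1 by (simp add: emeasure_space_1)
  next
    case 2
    have "(\<integral>\<^sup>+y. kl_term (p y) r \<partial>M) = \<top>"
    proof (rule ccontr)
      assume "(\<integral>\<^sup>+y. kl_term (p y) r \<partial>M) \<noteq> \<top>"
      then have "AE y in M. kl_term (p y) r \<noteq> \<top>"
        using nn_integral_PInf_AE[of "\<lambda>y. kl_term (p y) r" M] by simp
      then have "AE y in M. p y = 0"
        by eventually_elim (auto simp: kl_term_def 2 split: if_splits)
      with 2 q0_iff show False by simp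
    qed
    with 2 show ?thesis by (simp add: kl_term_def)
  next
    case 3
    have int_ln: "integrable M (\<lambda>y. p y * ln (p y))"
      using p01 abs_mult_ln_le_1 by (intro integrable_const_bound[where B = 1]) auto
    have eq: "(\<integral>\<^sup>+y. kl_term (p y) x \<partial>M) = ennreal (expectation (\<lambda>y. p y * ln (p y)) - q * ln x - q + x)"
      and nn: "expectation (\<lambda>y. p y * ln (p y)) - q * ln x - q + x \<ge> 0"
      if x: "x > 0" for x
    proof -
      have alt: "p y * ln (p y / x) - p y + x = p y * ln (p y) - p y * ln x - p y + x"
        if "y \<in> space M" for y
        using p01[OF that] x by (cases "p y = 0") (auto simp: ln_div algebra_simps)
      have int: "integrable M (\<lambda>y. p y * ln (p y) - p y * ln x - p y + x)"
        using int_ln int_p by auto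
      have nonneg: "p y * ln (p y) - p y * ln x - p y + x \<ge> 0" if "y \<in> space M" for y
        using ln_ratio_ge[of "p y" x] p01[OF that] x alt[OF that] by simp
      have "(\<integral>\<^sup>+y. kl_term (p y) x \<partial>M) = (\<integral>\<^sup>+y. ennreal (p y * ln (p y) - p y * ln x - p y + x) \<partial>M)"
        using x alt by (intro nn_integral_cong) (simp add: kl_term_def)
      also have "\<dots> = ennreal (expectation (\<lambda>y. p y * ln (p y) - p y * ln x - p y + x))"
        using int nonneg by (intro nn_integral_eq_integral AE_I2) auto
      also have "expectation (\<lambda>y. p y * ln (p y) - p y * ln x - p y + x) =
          expectation (\<lambda>y. p y * ln (p y)) - q * ln x - q + x"
        using int_ln int_p by (simp add: q_def prob_space)
      finally show "(\<integral>\<^sup>+y. kl_term (p y) x \<partial>M) = ennreal (expectation (\<lambda>y. p y * ln (p y)) - q * ln x - q + x)" .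
      have "expectation (\<lambda>y. p y * ln (p y) - p y * ln x - p y + x) \<ge> 0"
        using nonneg by (intro integral_nonneg_AE AE_I2) auto
      then show "expectation (\<lambda>y. p y * ln (p y)) - q * ln x - q + x \<ge> 0"
        using int_ln int_p by (simp add: q_def prob_space)
    qed
    have "kl_term q r = ennreal (q * ln q - q * ln r - q + r)" "q * ln q - q * ln r - q + r \<ge> 0"
      using 3 ln_ratio_ge[of q r] by (auto simp: kl_term_def ln_div algebra_simps)
    then show ?thesis
      unfolding eq[OF 3(1)] eq[OF 3(2)] using nn[OF 3(1)]
      by (simp flip: ennreal_plus)
  qed
  then show ?thesis by (simp add: q_def)
qed

text \<open>The same splitting for a two-point distribution with weights \<open>1 - t\<close> and
  \<open>t\<close>. As both weights are positive, \<open>m\<close> vanishes only together with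
  \<open>a\<close> and \<open>b\<close>, so the divergences to \<open>m\<close> are always
  finite.\<close>

lemma kl_term_compensation:
  fixes a b r t :: real
  assumes t: "0 < t" "t < 1" and nonneg: "a \<ge> 0" "b \<ge> 0" "r \<ge> 0"
  defines "m \<equiv> (1 - t) * a + t * b"
  shows "ennreal (1 - t) * kl_term a r + ennreal t * kl_term b r =
    kl_term m r + (ennreal (1 - t) * kl_term a m + ennreal t * kl_term b m)"
proof -
  have m0: "m = 0 \<longleftrightarrow> a = 0 \<and> b = 0"
    unfolding m_def using t nonneg by (simp add: add_nonneg_eq_0_iff)
  have m_nonneg: "m \<ge> 0" unfolding m_def using t nonneg by simp
  consider "m = 0" | "m > 0" "r = 0" | "m > 0" "r > 0"
    using m_nonneg nonneg by linarith
  then show ?thesis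
  proof cases
    case 1
    then have "ennreal (1 - t) * ennreal r + ennreal t * ennreal r = ennreal r"
      using t by (simp flip: distrib_right ennreal_plus)
    with 1 m0 show ?thesis by simp
  next
    case 2
    then have "a \<noteq> 0 \<or> b \<noteq> 0" using m0 by auto
    then have "ennreal (1 - t) * kl_term a r + ennreal t * kl_term b r = \<top>"
      using 2 t by (auto simp: kl_term_def ennreal_mult_eq_top_iff)
    with 2 show ?thesis by simp
  next
    case 3
    define L where "L x y = x * ln x - x * ln y - x + y" for x y :: real
    have L: "kl_term x y = ennreal (L x y)" "L x y \<ge> 0" if "x \<ge> 0" "y > 0" for x y
    proof -
      have "x * ln (x / y) - x + y = L x y"
        using that by (cases "x = 0") (auto simp: L_def ln_div algebra_simps)
      then show "kl_term x y = ennreal (L x y)" "L x y \<ge> 0"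
        using that ln_ratio_ge[of x y] by (auto simp: kl_term_def)
    qed
    have "(1 - t) * L a r + t * L b r = L m r + ((1 - t) * L a m + t * L b m)"
    proof -
      have "(1 - t) * L a m + t * L b m =
          (1 - t) * (a * ln a) + t * (b * ln b) - m * ln m - m + m"
        by (simp add: L_def m_def algebra_simps)
      moreover have "(1 - t) * L a r + t * L b r =
          (1 - t) * (a * ln a) + t * (b * ln b) - m * ln r - m + r"
        by (simp add: L_def m_def algebra_simps)
      ultimately show ?thesis by (simp add: L_def)
    qed
    then show ?thesis
      using 3 nonneg t L by (simp flip: ennreal_mult ennreal_plus)
  qed
qed

text \<open>A convex combination of kernels, encoded by masses so that \<open>kernel_of_pmf\<close>
  yields its measurability.\<close>

definition mix_kernel :: "'b set \<Rightarrow> real \<Rightarrow> ('a \<Rightarrow> 'b measure) \<Rightarrow> ('a \<Rightarrow> 'b measure) \<Rightarrow> 'a \<Rightarrow> 'b measure" where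
  "mix_kernel Z t k0 k1 y =
     density (count_space Z) (\<lambda>z. ennreal ((1 - t) * measure (k0 y) {z} + t * measure (k1 y) {z}))"

text \<open>Mutual information in nats, by \<open>mutual_info_channel\<close>; infinity is an
  ordinary value here.\<close>

definition channel_info :: "'a measure \<Rightarrow> 'b set \<Rightarrow> ('a \<Rightarrow> 'b measure) \<Rightarrow> ennreal" where
  "channel_info V Z k = kernel_kl V Z k (out_pmf V k)"

context discrete_channel
begin

abbreviation info :: "('a \<Rightarrow> 'b measure) \<Rightarrow> ennreal" where
  "info \<equiv> channel_info V Z"

lemma kernel_kl_iterated:
  assumes k: "channel k"
  shows "kernel_kl V Z k r = (\<integral>\<^sup>+z. \<integral>\<^sup>+y. kl_term (measure (k y) {z}) (r z) \<partial>V \<partial>count_space Z)"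
proof -
  note [measurable] = measurable_channel_joint_pmf[OF k]
  show ?thesis
    unfolding kernel_kl_def kl_def by (subst VN.nn_integral_snd[symmetric]) auto
qed

text \<open>Topsoe's identity: for each \<open>z\<close> the masses average over \<open>y\<close> to
  \<open>out_pmf V k z\<close>, so \<open>nn_integral_kl_term_mean\<close> applies letter by letter.
  Hence any reference law \<open>r\<close> gives an upper bound on the information, which is how
  \<open>info\<close> is estimated from above below.\<close>

lemma kernel_kl_eq_info_add:
  assumes k: "channel k" and r: "\<And>z. z \<in> Z \<Longrightarrow> r z \<ge> 0"
  shows "kernel_kl V Z k r = info k + kl (count_space Z) (out_pmf V k) r"
proof -
  have "kernel_kl V Z k r =
      (\<integral>\<^sup>+z. (\<integral>\<^sup>+y. kl_term (measure (k y) {z}) (out_pmf V k z) \<partial>V) + kl_term (out_pmf V k z) (r z) \<partial>count_space Z)"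
    unfolding kernel_kl_iterated[OF k] out_pmf_def
    using measurable_channel_pmf[OF k] channel_pmf_le_1[OF k] r
    by (intro nn_integral_cong nn_integral_kl_term_mean) auto
  also have "\<dots> = info k + kl (count_space Z) (out_pmf V k) r"
    unfolding channel_info_def kernel_kl_iterated[OF k] kl_def by (rule nn_integral_add) auto
  finally show ?thesis .
qed

lemma
  assumes k: "channel k0" "channel k1" and t: "0 < t" "t < 1"
  shows channel_mix: "channel (mix_kernel Z t k0 k1)"
    and measure_mix: "z \<in> Z \<Longrightarrow> measure (mix_kernel Z t k0 k1 y) {z} =
      (1 - t) * measure (k0 y) {z} + t * measure (k1 y) {z}"
proof -
  note [measurable] = measurable_channel_pmf[OF k(1)] measurable_channel_pmf[OF k(2)]
  show "channel (mix_kernel Z t k0 k1)"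
    unfolding mix_kernel_def
  proof (rule kernel_of_pmf[OF countable_Z])
    fix y assume y: "y \<in> space V"
    have "(\<integral>\<^sup>+z. ennreal ((1 - t) * measure (k0 y) {z} + t * measure (k1 y) {z}) \<partial>count_space Z) =
        ennreal (1 - t) * (\<integral>\<^sup>+z. ennreal (measure (k0 y) {z}) \<partial>count_space Z) +
        ennreal t * (\<integral>\<^sup>+z. ennreal (measure (k1 y) {z}) \<partial>count_space Z)"
      using t by (simp add: ennreal_mult nn_integral_add nn_integral_cmult)
    also have "\<dots> = 1"
      using y t k by (simp add: nn_integral_channel_pmf flip: ennreal_plus)
    finally show "(\<integral>\<^sup>+z. ennreal ((1 - t) * measure (k0 y) {z} + t * measure (k1 y) {z}) \<partial>count_space Z) = 1" .
  qed measurable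
  show "measure (mix_kernel Z t k0 k1 y) {z} = (1 - t) * measure (k0 y) {z} + t * measure (k1 y) {z}"
    if "z \<in> Z"
    unfolding mix_kernel_def using that t by (intro measure_density_count_space) auto
qed

lemma nn_integral_mix_law:
  assumes k: "channel k0" "channel k1" and t: "0 < t" "t < 1"
    and [measurable]: "f \<in> borel_measurable VZ"
  shows "(\<integral>\<^sup>+x. f x \<partial>law (mix_kernel Z t k0 k1)) =
    ennreal (1 - t) * (\<integral>\<^sup>+x. f x \<partial>law k0) +
    ennreal t * (\<integral>\<^sup>+x. f x \<partial>law k1)"
proof -
  note [measurable] = measurable_channel_joint_pmf[OF k(1)] measurable_channel_joint_pmf[OF k(2)]
  have eq: "ennreal ((1 - t) * measure (k0 y) {z} + t * measure (k1 y) {z}) * c =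
      ennreal (1 - t) * (ennreal (measure (k0 y) {z}) * c) + ennreal t * (ennreal (measure (k1 y) {z}) * c)"
    for y z c
    using t by (simp add: ennreal_mult distrib_right mult.assoc)
  have "(\<integral>\<^sup>+x. f x \<partial>law (mix_kernel Z t k0 k1)) =
      (\<integral>\<^sup>+x. ennreal (1 - t) * (ennreal (joint_pmf k0 x) * f x) +
         ennreal t * (ennreal (joint_pmf k1 x) * f x) \<partial>VZ)"
    using t k
    by (subst nn_integral_channel_law[OF channel_mix[OF k t]])
       (auto intro!: nn_integral_cong
         simp: space_pair_measure measure_mix eq simp del: ennreal_plus)
  also have "\<dots> = ennreal (1 - t) * (\<integral>\<^sup>+x. f x \<partial>law k0) +
    ennreal t * (\<integral>\<^sup>+x. f x \<partial>law k1)"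
    using k by (simp add: nn_integral_add nn_integral_cmult nn_integral_channel_law)
  finally show ?thesis .
qed

text \<open>
  A Pythagorean inequality, with the mixture in place of the minimizer \<open>k0\<close>: averaging the
  compensation identity for the mixture of \<open>k0\<close> and \<open>k1\<close> avoids differentiating in \<open>t\<close>.
\<close>

lemma info_pythagoras:
  assumes k: "channel k0" "channel k1" and t: "0 < t" "t < 1"
    and opt: "info k0 \<le> info (mix_kernel Z t k0 k1)" and fin: "info k0 < \<top>"
  shows "info k0 + kl VZ (joint_pmf k1)
      (joint_pmf (mix_kernel Z t k0 k1)) \<le>
    info k1 + kl (count_space Z) (out_pmf V k1) (out_pmf V k0)"
proof -
  let ?m = "mix_kernel Z t k0 k1" and ?q = "out_pmf V k0" and ?M = "VZ"
  note m = channel_mix[OF k t]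
  note [measurable] = measurable_channel_joint_pmf[OF k(1)] measurable_channel_joint_pmf[OF k(2)]
    measurable_channel_joint_pmf[OF m]
  define K0 where "K0 = kl ?M (joint_pmf k0) (joint_pmf ?m)"
  define K1 where "K1 = kl ?M (joint_pmf k1) (joint_pmf ?m)"
  have "ennreal (1 - t) * kernel_kl V Z k0 ?q + ennreal t * kernel_kl V Z k1 ?q =
      kernel_kl V Z ?m ?q + (ennreal (1 - t) * K0 + ennreal t * K1)"
  proof -
    have "ennreal (1 - t) * kernel_kl V Z k0 ?q + ennreal t * kernel_kl V Z k1 ?q =
       (\<integral>\<^sup>+x. ennreal (1 - t) * kl_term (joint_pmf k0 x) (?q (snd x)) +
          ennreal t * kl_term (joint_pmf k1 x) (?q (snd x)) \<partial>?M)"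
      by (simp add: kernel_kl_def kl_def nn_integral_add nn_integral_cmult)
    also have "\<dots> = (\<integral>\<^sup>+x. kl_term (joint_pmf ?m x) (?q (snd x)) +
        (ennreal (1 - t) * kl_term (joint_pmf k0 x) (joint_pmf ?m x) +
          ennreal t * kl_term (joint_pmf k1 x) (joint_pmf ?m x)) \<partial>?M)"
    proof (rule nn_integral_cong)
      fix x assume "x \<in> space ?M"
      then have "joint_pmf ?m x =
          (1 - t) * joint_pmf k0 x + t * joint_pmf k1 x"
        using measure_mix[OF k t] by (auto simp: space_pair_measure)
      then show "ennreal (1 - t) * kl_term (joint_pmf k0 x) (?q (snd x)) +
          ennreal t * kl_term (joint_pmf k1 x) (?q (snd x)) =
        kl_term (joint_pmf ?m x) (?q (snd x)) +
        (ennreal (1 - t) * kl_term (joint_pmf k0 x) (joint_pmf ?m x) +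
          ennreal t * kl_term (joint_pmf k1 x) (joint_pmf ?m x))"
        using kl_term_compensation[OF t, of "joint_pmf k0 x" "joint_pmf k1 x" "?q (snd x)"]
        by (simp only: measure_nonneg out_pmf_nonneg)
    qed
    also have "\<dots> = kernel_kl V Z ?m ?q + (ennreal (1 - t) * K0 + ennreal t * K1)"
      by (simp add: kernel_kl_def kl_def K0_def K1_def nn_integral_add nn_integral_cmult)
    finally show ?thesis .
  qed
  \<comment> \<open>Measuring the mixture against the output law of \<open>k0\<close> instead of its
    own can only increase the divergence, so optimality survives the change of reference.\<close>
  moreover have "info k0 \<le> kernel_kl V Z ?m ?q"
    unfolding kernel_kl_eq_info_add[OF m out_pmf_nonneg] using opt by (simp add: add_increasing2)
  \<comment> \<open>The nonnegative term with \<open>K0\<close> is dropped. Next,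
    \<open>info k0\<close> is split with weights \<open>1 - t\<close> and \<open>t\<close>, so that
    its finite first part cancels and the factor \<open>t\<close> can be removed.\<close>
  ultimately have "info k0 + ennreal t * K1 \<le> ennreal (1 - t) * info k0 + ennreal t * kernel_kl V Z k1 ?q"
    unfolding channel_info_def by (simp add: add_mono add_increasing)
  moreover have "info k0 = ennreal (1 - t) * info k0 + ennreal t * info k0"
    using t by (simp flip: distrib_right ennreal_plus)
  ultimately have "ennreal (1 - t) * info k0 + (ennreal t * (info k0 + K1)) \<le>
      ennreal (1 - t) * info k0 + ennreal t * kernel_kl V Z k1 ?q"
    by (simp add: distrib_left flip: add.assoc)
  then have "ennreal t * (info k0 + K1) \<le> ennreal t * kernel_kl V Z k1 ?q"
    using fin by (subst (asm) ennreal_add_left_cancel_le) (auto simp: ennreal_mult_eq_top_iff)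
  then have "info k0 + K1 \<le> kernel_kl V Z k1 ?q"
    using t by (subst (asm) ennreal_mult_le_mult_iff) auto
  then show ?thesis
    unfolding K1_def kernel_kl_eq_info_add[OF k(2) out_pmf_nonneg] .
qed

lemma integral_channel_law:
  fixes F :: "'a \<times> 'b \<Rightarrow> real"
  assumes k: "channel k" and F[measurable]: "F \<in> borel_measurable VZ"
  shows "(\<integral>x. F x \<partial>law k) =
      (\<integral>x. joint_pmf k x * F x \<partial>VZ)"
    and "integrable (law k) F \<longleftrightarrow>
      integrable VZ (\<lambda>x. joint_pmf k x * F x)"
proof -
  note [measurable] = measurable_channel_joint_pmf[OF k]
  show "(\<integral>x. F x \<partial>law k) =
      (\<integral>x. joint_pmf k x * F x \<partial>VZ)"
    unfolding channel_law_eq_density[OF k] by (rule integral_real_density) auto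
  show "integrable (law k) F \<longleftrightarrow>
      integrable VZ (\<lambda>x. joint_pmf k x * F x)"
    unfolding channel_law_eq_density[OF k] by (rule integrable_real_density) auto
qed

lemma integrable_channel_law_bounded:
  fixes F :: "'a \<times> 'b \<Rightarrow> real"
  assumes k: "channel k" and F[measurable]: "F \<in> borel_measurable VZ"
    and bounded: "\<And>x. x \<in> space V \<times> Z \<Longrightarrow> \<bar>F x\<bar> \<le> b"
  shows "integrable (law k) F"
proof -
  interpret J: prob_space "law k"
    by (rule prob_space_kernel_law[OF prob_space_axioms k])
  note sets = sets_kernel_law[OF prob_space_axioms k]
  note [measurable_cong] = sets
  show ?thesis
    using bounded sets_eq_imp_space_eq[OF sets]
    by (intro J.integrable_const_bound[where B = b]) (auto simp: space_pair_measure)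
qed

text \<open>By the Pythagorean inequality the divergence from \<open>k1\<close> to every mixture is
  at most \<open>\<Delta>\<close>, so the variational bound holds with the exponential moment under
  the mixture. That moment is affine in \<open>t\<close>, and letting \<open>t\<close> tend to 0 is
  a limit of real numbers.\<close>

lemma expectation_le_of_info:
  fixes F :: "'a \<times> 'b \<Rightarrow> real"
  assumes k: "channel k0" "channel k1"
    and opt: "\<And>t. 0 < t \<Longrightarrow> t < 1 \<Longrightarrow> info k0 \<le> info (mix_kernel Z t k0 k1)"
    and fin: "info k0 < \<top>" and \<Delta>: "\<Delta> \<ge> 0"
    and le: "info k1 + kl (count_space Z) (out_pmf V k1) (out_pmf V k0) \<le> info k0 + ennreal \<Delta>"
    and F[measurable]: "F \<in> borel_measurable VZ"
    and bounded: "\<And>x. x \<in> space V \<times> Z \<Longrightarrow> \<bar>F x\<bar> \<le> b"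
  shows "(\<integral>x. F x \<partial>law k1) \<le>
    \<Delta> + ln (\<integral>x. exp (F x) \<partial>law k0)"
proof -
  let ?M = "VZ"
  define E where "E k = (\<integral>x. exp (F x) \<partial>law k)" for k
  have int_exp: "integrable (law k) (\<lambda>x. exp (F x))" if "channel k" for k
    using that bounded by (intro integrable_channel_law_bounded[where b = "exp b"]) (auto simp: abs_le_iff)
  have int_F: "integrable (law k) F" if "channel k" for k
    using that bounded by (intro integrable_channel_law_bounded[where b = b]) auto
  have E_pos: "E k > 0" if "channel k" for k
  proof -
    interpret J: prob_space "law k"
      by (rule prob_space_kernel_law[OF prob_space_axioms that])
    show ?thesis
      unfolding E_def by (rule J.expectation_greater[OF int_exp[OF that]]) auto
  qed
  have step: "(\<integral>x. F x \<partial>law k1) \<le> \<Delta> + ln ((1 - t) * E k0 + t * E k1)"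
    if t: "0 < t" "t < 1" for t
  proof -
    let ?m = "mix_kernel Z t k0 k1"
    note m = channel_mix[OF k t]
    note [measurable] = measurable_channel_joint_pmf[OF k(1)] measurable_channel_joint_pmf[OF k(2)]
      measurable_channel_joint_pmf[OF m]
    have exp_F[measurable]: "(\<lambda>x. exp (F x)) \<in> borel_measurable ?M" by measurable
    have E_mix: "E ?m = (1 - t) * E k0 + t * E k1"
    proof -
      have nn: "ennreal (E k) = (\<integral>\<^sup>+x. exp (F x) \<partial>law k)" if "channel k" for k
        unfolding E_def using int_exp[OF that] by (intro nn_integral_eq_integral[symmetric]) auto
      have "ennreal (E ?m) = ennreal (1 - t) * ennreal (E k0) + ennreal t * ennreal (E k1)"
        unfolding nn[OF m] nn[OF k(1)] nn[OF k(2)] by (rule nn_integral_mix_law[OF k t]) measurable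
      also have "\<dots> = ennreal ((1 - t) * E k0 + t * E k1)"
        using t E_pos[OF k(1)] E_pos[OF k(2)] by (simp add: ennreal_mult)
      finally show ?thesis
        using t E_pos[OF k(1)] E_pos[OF k(2)] E_pos[OF m] by (subst (asm) ennreal_inj) auto
    qed
    have pos: "E ?m > 0" by (rule E_pos[OF m])
    define K where "K = kl ?M (joint_pmf k1) (joint_pmf ?m)"
    have int1: "integrable ?M (joint_pmf k1)"
      using nn_integral_joint_pmf[OF k(2)] by (intro integrableI_nonneg) auto
    have mass1: "(\<integral>x. joint_pmf k1 x \<partial>?M) = 1"
      using nn_integral_joint_pmf[OF k(2)] by (simp add: integral_eq_nn_integral)
    have intF1: "integrable ?M (\<lambda>x. joint_pmf k1 x * F x)"
      using int_F[OF k(2)] integral_channel_law(2)[OF k(2) F] by simp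
    have ln_w: "joint_pmf k1 x * ln (exp (F x) / E ?m) =
        joint_pmf k1 x * F x - joint_pmf k1 x * ln (E ?m)" for x
      using pos by (simp add: ln_div algebra_simps)
    \<comment> \<open>The test function is the exponential of \<open>F\<close> normalised to have
      mean 1 under the mixture.\<close>
    have "ennreal (\<integral>x. joint_pmf k1 x * ln (exp (F x) / E ?m) \<partial>?M) \<le> K"
      unfolding K_def
    proof (rule kl_variational)
      show "(\<integral>\<^sup>+x. ennreal (joint_pmf ?m x * (exp (F x) / E ?m)) \<partial>?M) \<le> 1"
      proof -
        have "(\<integral>\<^sup>+x. ennreal (joint_pmf ?m x * (exp (F x) / E ?m)) \<partial>?M) =
            (\<integral>\<^sup>+x. ennreal (exp (F x) / E ?m) \<partial>law ?m)"
          using pos by (subst nn_integral_channel_law[OF m]) (auto simp flip: ennreal_mult)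
        also have "\<dots> = ennreal (\<integral>x. exp (F x) / E ?m \<partial>law ?m)"
          using pos int_exp[OF m] by (intro nn_integral_eq_integral) auto
        also have "\<dots> = 1"
          using pos by (simp add: E_def)
        finally show ?thesis by simp
      qed
      show "integrable ?M (\<lambda>x. joint_pmf k1 x * ln (exp (F x) / E ?m))"
        unfolding ln_w using int1 intF1 by auto
    qed (use pos nn_integral_joint_pmf[OF m] in auto)
    also have "(\<integral>x. joint_pmf k1 x * ln (exp (F x) / E ?m) \<partial>?M) =
        (\<integral>x. F x \<partial>law k1) - ln (E ?m)"
      unfolding ln_w using int1 intF1 mass1 by (simp add: integral_channel_law(1)[OF k(2) F])
    also have "K \<le> ennreal \<Delta>"
    proof -
      have "info k0 + K \<le> info k0 + ennreal \<Delta>"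
        unfolding K_def using info_pythagoras[OF k t opt[OF t] fin] le by (rule order_trans)
      then show ?thesis using fin by (subst (asm) ennreal_add_left_cancel_le) auto
    qed
    finally have "(\<integral>x. F x \<partial>law k1) - ln (E ?m) \<le> \<Delta>"
      using \<Delta> by (simp add: ennreal_le_iff)
    then show ?thesis by (simp add: E_mix)
  qed
  have "((\<lambda>t. \<Delta> + ln ((1 - t) * E k0 + t * E k1)) \<longlongrightarrow> \<Delta> + ln ((1 - 0) * E k0 + 0 * E k1)) (at_right 0)"
    using E_pos[OF k(1)] by (intro tendsto_intros) auto
  moreover have "\<forall>\<^sub>F t in at_right 0. (\<integral>x. F x \<partial>law k1) \<le> \<Delta> + ln ((1 - t) * E k0 + t * E k1)"
    using step by (intro eventually_at_rightI[of 0 1]) auto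
  ultimately have "(\<integral>x. F x \<partial>law k1) \<le> \<Delta> + ln ((1 - 0) * E k0 + 0 * E k1)"
    by (rule tendsto_lowerbound) simp
  then show ?thesis by (simp add: E_def)
qed

end

section \<open>Change of source, and the information carried by codes\<close>

text \<open>The masses depend on \<open>x\<close> only through \<open>f x\<close>, so both
  quantities are integrals of functions of \<open>f x\<close>. This lets
  \<open>\<theta>\<^sup>n\<close> be added to the source without changing the information.\<close>

lemma channel_info_distr:
  assumes S: "prob_space S" and f[measurable]: "f \<in> S \<rightarrow>\<^sub>M V0" and Z: "countable Z"
    and k[measurable]: "k \<in> V0 \<rightarrow>\<^sub>M prob_algebra (count_space Z)"
  shows "z \<in> Z \<Longrightarrow> out_pmf (distr S V0 f) k z = out_pmf S (\<lambda>x. k (f x)) z"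
    and "channel_info (distr S V0 f) Z k = channel_info S Z (\<lambda>x. k (f x))"
proof -
  interpret S: discrete_channel S Z
    by (intro discrete_channel.intro discrete_channel_axioms.intro S Z)
  interpret V: discrete_channel "distr S V0 f" Z
    by (intro discrete_channel.intro discrete_channel_axioms.intro S.prob_space_distr f Z)
  have k': "k \<in> distr S V0 f \<rightarrow>\<^sub>M prob_algebra (count_space Z)" by simp
  have kf: "(\<lambda>x. k (f x)) \<in> S \<rightarrow>\<^sub>M prob_algebra (count_space Z)" by measurable
  have meas: "(\<lambda>y. measure (k y) {z}) \<in> borel_measurable V0" if "z \<in> Z" for z
    using V.measurable_channel_pmf[OF k' that] by simp
  show out: "out_pmf (distr S V0 f) k z = out_pmf S (\<lambda>x. k (f x)) z" if "z \<in> Z" for z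
    unfolding out_pmf_def using meas[OF that] by (subst integral_distr) auto
  show "channel_info (distr S V0 f) Z k = channel_info S Z (\<lambda>x. k (f x))"
    unfolding channel_info_def V.kernel_kl_iterated[OF k'] S.kernel_kl_iterated[OF kf]
    using meas by (intro nn_integral_cong) (simp add: out nn_integral_distr)
qed

context discrete_channel
begin

text \<open>
  The reproduction law is compared with the law of a decoded uniformly random codeword, which
  dominates every \<open>k y\<close> up to the factor \<open>M\<close>; this also covers common randomness.
\<close>

lemma info_code_le:
  assumes W: "prob_space W" and k: "channel (\<lambda>y. distr W (count_space Z) (\<lambda>w. dec w (enc w y)))"
    and enc: "(\<lambda>(w, y). enc w y) \<in> W \<Otimes>\<^sub>M V \<rightarrow>\<^sub>M count_space {1..M :: nat}"
    and dec: "(\<lambda>(w, m). dec w m) \<in> W \<Otimes>\<^sub>M count_space {1..M} \<rightarrow>\<^sub>M count_space Z"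
  shows "M \<ge> 1" and "info (\<lambda>y. distr W (count_space Z) (\<lambda>w. dec w (enc w y))) \<le> ennreal (ln (real M))"
proof -
  interpret W: prob_space W by fact
  let ?k = "\<lambda>y. distr W (count_space Z) (\<lambda>w. dec w (enc w y))"
  obtain w y where "w \<in> space W" "y \<in> space V"
    using W.not_empty not_empty by auto
  then have "enc w y \<in> {1..M}"
    using measurable_space[OF enc, of "(w, y)"] by (simp add: space_pair_measure)
  then show M: "M \<ge> 1" by simp
  have dec_m: "(\<lambda>w. dec w m) \<in> W \<rightarrow>\<^sub>M count_space Z" if "m \<in> {1..M}" for m
    using measurable_compose[OF measurable_Pair2'[of m "count_space {1..M}" W] dec] that by simp
  have enc_y: "(\<lambda>w. enc w y) \<in> W \<rightarrow>\<^sub>M count_space {1..M}" if "y \<in> space V" for y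
    using measurable_compose[OF measurable_Pair2'[of y V W] enc] that by simp
  have dec_enc: "(\<lambda>w. dec w (enc w y)) \<in> W \<rightarrow>\<^sub>M count_space Z" if "y \<in> space V" for y
    using measurable_compose[OF measurable_Pair[OF measurable_ident enc_y[OF that]] dec] by simp
  define q where "q z = (\<Sum>m\<in>{1..M}. W.prob {w\<in>space W. dec w m = z}) / M" for z
  have q_nonneg: "q z \<ge> 0" for z
    unfolding q_def by (intro divide_nonneg_nonneg sum_nonneg) auto
  have dec_sets: "{w\<in>space W. dec w m = z} \<in> sets W" if "m \<in> {1..M}" "z \<in> Z" for m z
    using measurable_sets[OF dec_m[OF that(1)], of "{z}"] that by (simp add: vimage_def Int_def conj_commute)
  have sum_q: "(\<integral>\<^sup>+z. ennreal (q z) \<partial>count_space Z) = 1"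
  proof -
    have one: "(\<integral>\<^sup>+z. ennreal (W.prob {w\<in>space W. dec w m = z}) \<partial>count_space Z) = 1"
      if m: "m \<in> {1..M}" for m
    proof -
      interpret D: prob_space "distr W (count_space Z) (\<lambda>w. dec w m)"
        by (rule W.prob_space_distr[OF dec_m[OF m]])
      have "(\<integral>\<^sup>+z. ennreal (W.prob {w\<in>space W. dec w m = z}) \<partial>count_space Z) =
          (\<integral>\<^sup>+z. emeasure (distr W (count_space Z) (\<lambda>w. dec w m)) {z} \<partial>count_space Z)"
        using dec_m[OF m]
        by (intro nn_integral_cong)
           (auto simp: emeasure_distr W.emeasure_eq_measure vimage_def Int_def conj_commute)
      also have "\<dots> = emeasure (distr W (count_space Z) (\<lambda>w. dec w m)) (\<Union>z\<in>Z. {z})"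
        by (rule emeasure_UN_countable[symmetric]) (auto simp: countable_Z disjoint_family_on_def)
      also have "\<dots> = 1"
        using D.emeasure_space_1 by simp
      finally show ?thesis .
    qed
    have "ennreal (q z) = (\<Sum>m\<in>{1..M}. ennreal (1 / M) * ennreal (W.prob {w\<in>space W. dec w m = z}))" for z
      by (simp add: q_def sum_divide_distrib flip: ennreal_mult)
    then have "(\<integral>\<^sup>+z. ennreal (q z) \<partial>count_space Z) = (\<Sum>m\<in>{1..M}. ennreal (1 / M) *
        (\<integral>\<^sup>+z. ennreal (W.prob {w\<in>space W. dec w m = z}) \<partial>count_space Z))"
      by (simp add: nn_integral_sum nn_integral_cmult)
    also have "\<dots> = (\<Sum>m\<in>{1..M}. ennreal (1 / M))"
      using one by (intro sum.cong) auto
    also have "\<dots> = 1"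
      using M by (simp add: ennreal_of_nat_eq_real_of_nat flip: ennreal_mult)
    finally show ?thesis .
  qed
  \<comment> \<open>For fixed \<open>w\<close> the output is one of the words
    \<open>dec w m\<close>, so a union bound over \<open>m\<close> eliminates the encoder, even when
    it shares \<open>w\<close> with the decoder.\<close>
  have p_le: "measure (?k y) {z} \<le> M * q z" if y: "y \<in> space V" and z: "z \<in> Z" for y z
  proof -
    have "measure (?k y) {z} = W.prob {w\<in>space W. dec w (enc w y) = z}"
      using dec_enc[OF y] z by (simp add: measure_distr vimage_def Int_def conj_commute)
    also have "\<dots> \<le> W.prob (\<Union>m\<in>{1..M}. {w\<in>space W. dec w m = z})"
    proof (rule W.finite_measure_mono)
      show "{w\<in>space W. dec w (enc w y) = z} \<subseteq> (\<Union>m\<in>{1..M}. {w\<in>space W. dec w m = z})"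
      proof
        fix w assume w: "w \<in> {w\<in>space W. dec w (enc w y) = z}"
        then have "enc w y \<in> {1..M}"
          using measurable_space[OF enc_y[OF y], of w] by simp
        with w show "w \<in> (\<Union>m\<in>{1..M}. {w\<in>space W. dec w m = z})" by blast
      qed
      show "(\<Union>m\<in>{1..M}. {w\<in>space W. dec w m = z}) \<in> sets W"
        using dec_sets[OF _ z] by (intro sets.finite_UN) auto
    qed
    also have "\<dots> \<le> (\<Sum>m\<in>{1..M}. W.prob {w\<in>space W. dec w m = z})"
      using dec_sets[OF _ z] by (intro W.finite_measure_subadditive_finite) auto
    also have "\<dots> = M * q z"
      using M by (simp add: q_def)
    finally show ?thesis .
  qed
  note [measurable] = measurable_channel_joint_pmf[OF k]
  let ?M = "VZ"
  \<comment> \<open>The added 1 is the mass of the joint law; it cancels the term \<open>- a\<close>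
    of \<open>kl_term\<close> and keeps subtraction out of \<open>ennreal\<close>.\<close>
  have "kernel_kl V Z ?k q + 1 =
      (\<integral>\<^sup>+x. kl_term (joint_pmf ?k x) (q (snd x)) + ennreal (joint_pmf ?k x) \<partial>?M)"
    unfolding kernel_kl_def kl_def
    using nn_integral_joint_pmf[OF k] by (subst nn_integral_add) auto
  also have "\<dots> \<le> (\<integral>\<^sup>+x. ennreal (ln M) * ennreal (joint_pmf ?k x) + ennreal (q (snd x)) \<partial>?M)"
  proof (rule nn_integral_mono)
    fix x assume "x \<in> space ?M"
    then have x: "fst x \<in> space V" "snd x \<in> Z" by (auto simp: space_pair_measure)
    define a where "a = joint_pmf ?k x"
    define b where "b = q (snd x)"
    have a: "0 \<le> a" "a \<le> M * b" and b: "b \<ge> 0"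
      using p_le[OF x] q_nonneg by (auto simp: a_def b_def)
    have "kl_term a b + ennreal a \<le> ennreal (ln M) * ennreal a + ennreal b"
    proof (cases "a = 0")
      case False
      with a b have pos: "a > 0" "b > 0" by (auto simp: zero_less_mult_iff order_less_le)
      \<comment> \<open>This is where the number of codewords enters: \<open>a <= M * b\<close>
        bounds the likelihood ratio by \<open>M\<close>.\<close>
      have "ln (a / b) \<le> ln M"
        using pos a M by (simp add: field_simps)
      then have "a * ln (a / b) \<le> a * ln M"
        using pos by (intro mult_left_mono) auto
      then have "(a * ln (a / b) - a + b) + a \<le> ln M * a + b"
        by (simp add: mult.commute)
      then have "ennreal ((a * ln (a / b) - a + b) + a) \<le> ennreal (ln M * a + b)"
        by (rule ennreal_leI)
      then show ?thesis
        using pos M ln_ratio_ge[of a b] by (simp add: kl_term_def flip: ennreal_mult ennreal_plus)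
    qed simp
    then show "kl_term (joint_pmf ?k x) (q (snd x)) + ennreal (joint_pmf ?k x)
        \<le> ennreal (ln M) * ennreal (joint_pmf ?k x) + ennreal (q (snd x))"
      by (simp add: a_def b_def)
  qed
  also have "\<dots> = ennreal (ln M) + 1"
    using nn_integral_joint_pmf[OF k] nn_integral_product_pmf[OF sum_q]
    by (simp add: nn_integral_add nn_integral_cmult)
  finally have "kernel_kl V Z ?k q \<le> ennreal (ln M)"
    by (simp add: add.commute ennreal_add_left_cancel_le)
  moreover have "info ?k \<le> kernel_kl V Z ?k q"
    using kernel_kl_eq_info_add[OF k, of q] q_nonneg by simp
  ultimately show "info ?k \<le> ennreal (ln M)" by simp
qed

end

subsection \<open>Products of kernels\<close>

lemma emeasure_PiM_prob_space:
  assumes I: "finite I" and M: "\<And>i. i \<in> I \<Longrightarrow> prob_space (M i)"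
    and E: "\<And>i. i \<in> I \<Longrightarrow> E i \<in> sets (M i)"
  shows "emeasure (PiM I M) (Pi\<^sub>E I E) = (\<Prod>i\<in>I. emeasure (M i) (E i))"
proof -
  \<comment> \<open>The product locale asks for a probability measure at every index, so a point
    mass fills the indices outside \<open>I\<close>.\<close>
  define M' where "M' i = (if i \<in> I then M i else return (count_space UNIV) undefined)" for i
  interpret product_prob_space M' I
    using M by (intro product_prob_spaceI) (auto simp: M'_def prob_space_return)
  interpret finite_product_prob_space M' I by standard fact
  have "PiM I M = PiM I M'"
    by (intro PiM_cong) (auto simp: M'_def)
  then show ?thesis
    using E I by (simp add: emeasure_PiM M'_def)
qed

text \<open>Rectangles form an intersection-stable generator, and on a rectangle the measure is a
  finite product of measurable functions of single coordinates.\<close>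

lemma measurable_PiM_kernel:
  assumes I: "finite I" and k: "k \<in> A \<rightarrow>\<^sub>M prob_algebra B"
  shows "(\<lambda>x. PiM I (\<lambda>i. k (x i))) \<in> PiM I (\<lambda>_. A) \<rightarrow>\<^sub>M prob_algebra (PiM I (\<lambda>_. B))"
proof (rule measurable_prob_algebra_generated)
  show "sets (PiM I (\<lambda>_. B)) = sigma_sets (\<Pi>\<^sub>E i\<in>I. space B) {Pi\<^sub>E I E |E. \<forall>i\<in>I. E i \<in> sets B}"
    using sets_PiM[of I "\<lambda>_. B"] prod_algebra_eq_finite[OF I, of "\<lambda>_. B"] by (simp add: Pi_iff)
  show "Int_stable {Pi\<^sub>E I E |E. \<forall>i\<in>I. E i \<in> sets B}"
    by (rule Int_stable_PiE)
  show "{Pi\<^sub>E I E |E. \<forall>i\<in>I. E i \<in> sets B} \<subseteq> Pow (\<Pi>\<^sub>E i\<in>I. space B)"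
  proof (rule subsetI, rule PowI)
    fix X assume "X \<in> {Pi\<^sub>E I E |E. \<forall>i\<in>I. E i \<in> sets B}"
    then obtain E where X: "X = Pi\<^sub>E I E" and E: "\<And>i. i \<in> I \<Longrightarrow> E i \<in> sets B" by auto
    show "X \<subseteq> (\<Pi>\<^sub>E i\<in>I. space B)"
      unfolding X using sets.sets_into_space[OF E] by (rule PiE_mono)
  qed
  have kx: "prob_space (k (x i))" "sets (k (x i)) = sets B"
    if "x \<in> space (PiM I (\<lambda>_. A))" "i \<in> I" for x i
    using measurable_space[OF k, of "x i"] that by (auto simp: space_PiM space_prob_algebra)
  show "prob_space (PiM I (\<lambda>i. k (x i)))" if "x \<in> space (PiM I (\<lambda>_. A))" for x
    using kx[OF that] by (intro prob_space_PiM)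
  show "sets (PiM I (\<lambda>i. k (x i))) = sets (PiM I (\<lambda>_. B))" if "x \<in> space (PiM I (\<lambda>_. A))" for x
    using kx[OF that] by (intro sets_PiM_cong) auto
  fix X assume "X \<in> {Pi\<^sub>E I E |E. \<forall>i\<in>I. E i \<in> sets B}"
  then obtain E where X: "X = Pi\<^sub>E I E" and E: "\<And>i. i \<in> I \<Longrightarrow> E i \<in> sets B" by auto
  have "(\<lambda>x. \<Prod>i\<in>I. emeasure (k (x i)) (E i)) \<in> borel_measurable (PiM I (\<lambda>_. A))"
  proof (rule borel_measurable_prod_ennreal)
    fix i assume i: "i \<in> I"
    note [measurable] = measurable_emeasure_kernel[OF measurable_prob_algebraD[OF k] E[OF i]]
    show "(\<lambda>x. emeasure (k (x i)) (E i)) \<in> borel_measurable (PiM I (\<lambda>_. A))"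
      using i by measurable
  qed
  moreover have "emeasure (PiM I (\<lambda>i. k (x i))) X = (\<Prod>i\<in>I. emeasure (k (x i)) (E i))"
    if x: "x \<in> space (PiM I (\<lambda>_. A))" for x
    unfolding X using kx[OF x] E by (intro emeasure_PiM_prob_space I) auto
  ultimately show "(\<lambda>x. emeasure (PiM I (\<lambda>i. k (x i))) X) \<in> borel_measurable (PiM I (\<lambda>_. A))"
    by (simp cong: measurable_cong)
qed

text \<open>A letterwise kernel acting on i.i.d. inputs makes the input-output pairs i.i.d. A
  product measure is determined by its rectangles, so the comparison is made after zipping the two
  words into one word of pairs; unzipping then recovers the claim.\<close>

lemma kernel_law_PiM:
  fixes I :: "'i set" and A :: "'a measure" and B :: "'b measure"
  assumes I: "finite I" and A: "prob_space A" and k: "k \<in> A \<rightarrow>\<^sub>M prob_algebra B"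
  shows "kernel_law (PiM I (\<lambda>_. A)) (PiM I (\<lambda>_. B)) (\<lambda>x. PiM I (\<lambda>i. k (x i))) =
    distr (PiM I (\<lambda>_. kernel_law A B k)) (PiM I (\<lambda>_. A) \<Otimes>\<^sub>M PiM I (\<lambda>_. B))
      (\<lambda>\<omega>. (\<lambda>i\<in>I. fst (\<omega> i), \<lambda>i\<in>I. snd (\<omega> i)))"
proof -
  let ?A = "PiM I (\<lambda>_. A)" and ?B = "PiM I (\<lambda>_. B)" and ?K = "\<lambda>x. PiM I (\<lambda>i. k (x i))"
  let ?T = "kernel_law A B k"
  define zip where "zip xy = (\<lambda>i\<in>I. (fst xy i, snd xy i))" for xy :: "('i \<Rightarrow> 'a) \<times> ('i \<Rightarrow> 'b)"
  define unzip where "unzip \<omega> = (\<lambda>i\<in>I. fst (\<omega> i), \<lambda>i\<in>I. snd (\<omega> i))" for \<omega> :: "'i \<Rightarrow> 'a \<times> 'b"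
  interpret A: prob_space A by fact
  interpret PA: product_prob_space "\<lambda>_. A" I by (intro product_prob_spaceI A)
  interpret T: prob_space ?T by (rule prob_space_kernel_law[OF A k])
  interpret PT: product_prob_space "\<lambda>_. ?T" I by (intro product_prob_spaceI T.prob_space_axioms)
  have A': "prob_space ?A" by (intro prob_space_PiM A)
  have K: "?K \<in> ?A \<rightarrow>\<^sub>M prob_algebra ?B" by (rule measurable_PiM_kernel[OF I k])
  let ?J = "kernel_law ?A ?B ?K"
  note sets_T[measurable_cong] = sets_kernel_law[OF A k]
  note sets_J[measurable_cong] = sets_kernel_law[OF A' K]
  have zip[measurable]: "zip \<in> ?J \<rightarrow>\<^sub>M PiM I (\<lambda>_. ?T)"
    unfolding zip_def by measurable
  have unzip[measurable]: "unzip \<in> PiM I (\<lambda>_. ?T) \<rightarrow>\<^sub>M ?A \<Otimes>\<^sub>M ?B"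
    unfolding unzip_def by measurable
  have "distr ?J (PiM I (\<lambda>_. ?T)) zip = PiM I (\<lambda>_. ?T)"
  proof (rule PT.PiM_eqI[OF I])
    fix E assume "\<And>i. i \<in> I \<Longrightarrow> E i \<in> sets ?T"
    then have E: "E i \<in> sets (A \<Otimes>\<^sub>M B)" if "i \<in> I" for i
      using that sets_T by simp
    have PE: "Pi\<^sub>E I E \<in> sets (PiM I (\<lambda>_. ?T))"
      using E sets_T by (intro sets_PiM_I_finite I) auto
    have "emeasure (distr ?J (PiM I (\<lambda>_. ?T)) zip) (Pi\<^sub>E I E) = emeasure ?J (zip -` Pi\<^sub>E I E \<inter> space ?J)"
      using PE by (intro emeasure_distr) auto
    also have "\<dots> = (\<integral>\<^sup>+x. emeasure (?K x) (Pair x -` (zip -` Pi\<^sub>E I E \<inter> space ?J)) \<partial>?A)"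
    proof (rule emeasure_kernel_law[OF A' K])
      show "zip -` Pi\<^sub>E I E \<inter> space ?J \<in> sets (?A \<Otimes>\<^sub>M ?B)"
        using measurable_sets[OF zip PE] sets_J by simp
    qed
    also have "\<dots> = (\<integral>\<^sup>+x. (\<Prod>i\<in>I. emeasure (k (x i)) (Pair (x i) -` E i)) \<partial>?A)"
    proof (rule nn_integral_cong)
      fix x assume x: "x \<in> space ?A"
      have kx: "prob_space (k (x i))" "sets (k (x i)) = sets B" if "i \<in> I" for i
        using measurable_space[OF k, of "x i"] that x by (auto simp: space_PiM space_prob_algebra)
      have "E i \<subseteq> space A \<times> space B" if "i \<in> I" for i
        using sets.sets_into_space[OF E[OF that]] by (simp add: space_pair_measure)
      then have "Pair x -` (zip -` Pi\<^sub>E I E \<inter> space ?J) = Pi\<^sub>E I (\<lambda>i. Pair (x i) -` E i)"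
        using x by (auto simp: sets_eq_imp_space_eq[OF sets_J] space_pair_measure space_PiM zip_def
            PiE_iff extensional_def) blast
      moreover have "emeasure (?K x) (Pi\<^sub>E I (\<lambda>i. Pair (x i) -` E i)) = (\<Prod>i\<in>I. emeasure (k (x i)) (Pair (x i) -` E i))"
        using kx sets_Pair1[OF E] by (intro emeasure_PiM_prob_space I) auto
      ultimately show "emeasure (?K x) (Pair x -` (zip -` Pi\<^sub>E I E \<inter> space ?J)) =
          (\<Prod>i\<in>I. emeasure (k (x i)) (Pair (x i) -` E i))" by simp
    qed
    also have "\<dots> = (\<Prod>i\<in>I. \<integral>\<^sup>+a. emeasure (k a) (Pair a -` E i) \<partial>A)"
    proof (rule PA.product_nn_integral_prod[OF I])
      fix i assume "i \<in> I"
      then have "(\<lambda>x. emeasure (k x) {b. (x, b) \<in> E i}) \<in> borel_measurable A"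
        using E[of i] measurable_prob_algebraD[OF k]
      proof (intro emeasure_measurable_subprob_algebra2)
        show "Sigma (space A) (\<lambda>x. {b. (x, b) \<in> E i}) \<in> sets (A \<Otimes>\<^sub>M B)"
        proof -
          have "Sigma (space A) (\<lambda>x. {b. (x, b) \<in> E i}) = E i"
            using sets.sets_into_space[OF E[OF \<open>i \<in> I\<close>]] by (auto simp: space_pair_measure)
          then show ?thesis using E[OF \<open>i \<in> I\<close>] by simp
        qed
      qed
      then show "(\<lambda>a. emeasure (k a) (Pair a -` E i)) \<in> borel_measurable A"
        by (simp add: vimage_def)
    qed
    also have "\<dots> = (\<Prod>i\<in>I. emeasure ?T (E i))"
      using E by (intro prod.cong refl) (simp add: emeasure_kernel_law[OF A k])
    finally show "emeasure (distr ?J (PiM I (\<lambda>_. ?T)) zip) (Pi\<^sub>E I E) = (\<Prod>i\<in>I. emeasure ?T (E i))" .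
  qed simp
  then have "distr (PiM I (\<lambda>_. ?T)) (?A \<Otimes>\<^sub>M ?B) unzip = distr (distr ?J (PiM I (\<lambda>_. ?T)) zip) (?A \<Otimes>\<^sub>M ?B) unzip"
    by simp
  also have "\<dots> = distr ?J (?A \<Otimes>\<^sub>M ?B) (unzip \<circ> zip)"
    by (rule distr_distr) auto
  \<comment> \<open>Words in a product space are \<open>undefined\<close> outside \<open>I\<close>,
    and so are the restricted words built by \<open>zip\<close> and \<open>unzip\<close>; this makes
    the composition the identity.\<close>
  also have "\<dots> = distr ?J ?J (\<lambda>x. x)"
  proof (rule distr_cong)
    fix x assume "x \<in> space ?J"
    then show "(unzip \<circ> zip) x = x"
      using sets_eq_imp_space_eq[OF sets_J]
      by (cases x) (auto simp: space_pair_measure space_PiM zip_def unzip_def PiE_iff extensional_def fun_eq_iff)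
  qed (use sets_J in auto)
  also have "\<dots> = ?J" by simp
  finally show ?thesis by (simp add: unzip_def[abs_def])
qed

subsection \<open>Concentration\<close>

text \<open>McDiarmid's argument: integrating out the last coordinate leaves a function
  \<open>H\<close> of \<open>n\<close> coordinates with the same bounded differences, and
  Hoeffding's lemma bounds the exponential moment of what was integrated out. The constant
  \<open>c^2 / 2\<close> comes from an interval of length \<open>2 * c\<close>.\<close>

lemma mcdiarmid_mgf:
  fixes G :: "(nat \<Rightarrow> 'a) \<Rightarrow> real"
  assumes T: "prob_space T" and s: "s > 0"
    and "G \<in> borel_measurable (PiM {..<n} (\<lambda>_. T))"
    and "\<And>x. x \<in> space (PiM {..<n} (\<lambda>_. T)) \<Longrightarrow> \<bar>G x\<bar> \<le> b"
    and "\<And>x i u. x \<in> space (PiM {..<n} (\<lambda>_. T)) \<Longrightarrow> i < n \<Longrightarrow> u \<in> space T \<Longrightarrow> \<bar>G (x(i := u)) - G x\<bar> \<le> c"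
  shows "(\<integral>x. exp (s * G x) \<partial>PiM {..<n} (\<lambda>_. T)) \<le>
    exp (s * (\<integral>x. G x \<partial>PiM {..<n} (\<lambda>_. T)) + real n * (s\<^sup>2 * c\<^sup>2 / 2))"
  using assms(3-)
proof (induction n arbitrary: G)
  case 0
  then show ?case
    by (simp add: PiM_empty lebesgue_integral_count_space_finite)
next
  case (Suc n)
  note G[measurable] = Suc.prems(1) and bnd = Suc.prems(2) and diff = Suc.prems(3)
  interpret T: prob_space T by fact
  interpret P: product_prob_space "\<lambda>_. T" "{..<n}" by (intro product_prob_spaceI T)
  interpret Q: prob_space "PiM {..<Suc n} (\<lambda>_. T)" by (intro prob_space_PiM T)
  let ?P = "PiM {..<n} (\<lambda>_. T)"
  have ins: "{..<Suc n} = insert n {..<n}" by auto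
  have upd: "x(n := u) \<in> space (PiM {..<Suc n} (\<lambda>_. T))" if "x \<in> space ?P" "u \<in> space T" for x u
    using that unfolding ins by (auto simp: space_PiM PiE_iff extensional_def)
  have upd_meas: "(\<lambda>(x, u). x(n := u)) \<in> ?P \<Otimes>\<^sub>M T \<rightarrow>\<^sub>M PiM {..<Suc n} (\<lambda>_. T)"
    unfolding ins by (rule measurable_add_dim)
  have G_upd[measurable]: "(\<lambda>(x, u). G (x(n := u))) \<in> borel_measurable (?P \<Otimes>\<^sub>M T)"
    using measurable_compose[OF upd_meas G] by (simp add: case_prod_unfold fun_upd_def)
  have G_x: "(\<lambda>u. G (x(n := u))) \<in> borel_measurable T" if "x \<in> space ?P" for x
    using measurable_compose[OF measurable_Pair1'[OF that, of T] G_upd] by simp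
  have int_x: "integrable T (\<lambda>u. G (x(n := u)))" if "x \<in> space ?P" for x
  proof (rule T.integrable_const_bound[where B = b])
    show "AE u in T. norm (G (x(n := u))) \<le> b"
      unfolding real_norm_def by (rule AE_I2) (rule bnd[OF upd[OF that]])
  qed (rule G_x[OF that])
  have int_exp: "integrable M (\<lambda>x. exp (s * g x))"
    if "prob_space M" "g \<in> borel_measurable M" "\<And>x. x \<in> space M \<Longrightarrow> \<bar>g x\<bar> \<le> b"
    for M :: "'d measure" and g
  proof -
    interpret M: prob_space M by fact
    show ?thesis
      using that s by (intro M.integrable_const_bound[where B = "exp (s * b)"]) (auto simp: abs_le_iff)
  qed
  define H where "H x = (\<integral>u. G (x(n := u)) \<partial>T)" for x
  have H[measurable]: "H \<in> borel_measurable ?P"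
    unfolding H_def by measurable
  have H_bnd: "\<bar>H x\<bar> \<le> b" if "x \<in> space ?P" for x
  proof -
    have "\<bar>H x\<bar> \<le> (\<integral>u. \<bar>G (x(n := u))\<bar> \<partial>T)"
      unfolding H_def by (rule integral_abs_bound)
    also have "\<dots> \<le> (\<integral>u. b \<partial>T)"
      using int_x[OF that] by (intro integral_mono bnd[OF upd[OF that]]) auto
    finally show ?thesis by (simp add: T.prob_space)
  qed
  have H_diff: "\<bar>H (x(i := u)) - H x\<bar> \<le> c" if x: "x \<in> space ?P" and i: "i < n" and u: "u \<in> space T" for x i u
  proof -
    have xu: "x(i := u) \<in> space ?P"
      using x u i by (auto simp: space_PiM PiE_iff extensional_def)
    have "H (x(i := u)) - H x = (\<integral>v. G ((x(i := u))(n := v)) - G (x(n := v)) \<partial>T)"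
      unfolding H_def using int_x[OF xu] int_x[OF x] by simp
    also have "\<bar>\<dots>\<bar> \<le> (\<integral>v. \<bar>G ((x(i := u))(n := v)) - G (x(n := v))\<bar> \<partial>T)"
      by (rule integral_abs_bound)
    also have "\<dots> \<le> (\<integral>v. c \<partial>T)"
    proof (rule integral_mono)
      fix v assume v: "v \<in> space T"
      have eq: "(x(i := u))(n := v) = (x(n := v))(i := u)" using i by (auto simp: fun_eq_iff)
      show "\<bar>G ((x(i := u))(n := v)) - G (x(n := v))\<bar> \<le> c"
        unfolding eq by (rule diff[OF upd[OF x v] _ u]) (use i in simp)
    qed (use int_x[OF xu] int_x[OF x] in auto)
    finally show ?thesis by (simp add: T.prob_space)
  qed
  have inner: "(\<integral>u. exp (s * G (x(n := u))) \<partial>T) \<le> exp (s * H x) * exp (s\<^sup>2 * c\<^sup>2 / 2)"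
    if x: "x \<in> space ?P" for x
  proof -
    \<comment> \<open>The interval for Hoeffding's lemma is centred at the value at an arbitrary
      reference letter, with radius \<open>c\<close>.\<close>
    obtain u0 where u0: "u0 \<in> space T" using T.not_empty by auto
    have range: "\<bar>G (x(n := u)) - G (x(n := u0))\<bar> \<le> c" if u: "u \<in> space T" for u
    proof -
      have eq: "x(n := u) = (x(n := u0))(n := u)" by simp
      show ?thesis
        unfolding eq by (rule diff[OF upd[OF x u0] _ u]) simp
    qed
    interpret interval_bounded_random_variable T "\<lambda>u. G (x(n := u))"
      "G (x(n := u0)) - c" "G (x(n := u0)) + c"
    proof
      show "AE u in T. G (x(n := u)) \<in> {G (x(n := u0)) - c..G (x(n := u0)) + c}"
        using range by (intro AE_I2) (fastforce simp: abs_le_iff)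
    qed (rule G_x[OF x])
    have bnd_x: "\<bar>G (x(n := u))\<bar> \<le> b" if "u \<in> space T" for u
      using bnd[OF upd[OF x that]] .
    have ie: "integrable T (\<lambda>u. exp (s * G (x(n := u))))"
      using G_x[OF x] bnd_x by (intro int_exp T) auto
    have "ennreal (\<integral>u. exp (s * (G (x(n := u)) - H x)) \<partial>T) =
        (\<integral>\<^sup>+u. exp (s * (G (x(n := u)) - H x)) \<partial>T)"
      using ie by (intro nn_integral_eq_integral[symmetric]) (auto simp: right_diff_distrib exp_diff)
    also have "\<dots> \<le> ennreal (exp (s\<^sup>2 * (2 * c)\<^sup>2 / 8))"
      using Hoeffdings_lemma_nn_integral[OF s] by (simp add: H_def)
    finally have "(\<integral>u. exp (s * (G (x(n := u)) - H x)) \<partial>T) \<le> exp (s\<^sup>2 * c\<^sup>2 / 2)"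
      by (simp add: power_mult_distrib mult.commute)
    moreover have "(\<integral>u. exp (s * (G (x(n := u)) - H x)) \<partial>T) = (\<integral>u. exp (s * G (x(n := u))) \<partial>T) / exp (s * H x)"
      by (simp add: right_diff_distrib exp_diff)
    ultimately show ?thesis by (simp add: divide_le_eq mult.commute)
  qed
  have "(\<integral>x. exp (s * G x) \<partial>PiM {..<Suc n} (\<lambda>_. T)) = (\<integral>x. (\<integral>u. exp (s * G (x(n := u))) \<partial>T) \<partial>?P)"
    unfolding ins
    by (rule P.product_integral_insert)
       (use int_exp[OF Q.prob_space_axioms G bnd] in \<open>auto simp: ins\<close>)
  also have "\<dots> \<le> (\<integral>x. exp (s * H x) * exp (s\<^sup>2 * c\<^sup>2 / 2) \<partial>?P)"
  proof (rule integral_mono')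
    show "integrable ?P (\<lambda>x. exp (s * H x) * exp (s\<^sup>2 * c\<^sup>2 / 2))"
      using int_exp[OF P.P.prob_space_axioms H H_bnd] by simp
  qed (use inner in auto)
  also have "\<dots> \<le> exp (s * (\<integral>x. H x \<partial>?P) + real n * (s\<^sup>2 * c\<^sup>2 / 2)) * exp (s\<^sup>2 * c\<^sup>2 / 2)"
    using Suc.IH[OF H H_bnd H_diff] by (simp add: mult_right_mono)
  also have "(\<integral>x. H x \<partial>?P) = (\<integral>x. G x \<partial>PiM {..<Suc n} (\<lambda>_. T))"
  proof -
    have "integrable (PiM {..<Suc n} (\<lambda>_. T)) G"
      using bnd by (intro Q.integrable_const_bound[where B = b]) auto
    then show ?thesis
      unfolding ins H_def by (subst P.product_integral_insert) auto
  qed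
  also have "exp (s * (\<integral>x. G x \<partial>PiM {..<Suc n} (\<lambda>_. T)) + real n * (s\<^sup>2 * c\<^sup>2 / 2)) * exp (s\<^sup>2 * c\<^sup>2 / 2) =
      exp (s * (\<integral>x. G x \<partial>PiM {..<Suc n} (\<lambda>_. T)) + real (Suc n) * (s\<^sup>2 * c\<^sup>2 / 2))"
    by (simp add: algebra_simps flip: exp_add)
  finally show ?case .
qed

lemma kl_finite_imp_AE:
  assumes [measurable]: "f \<in> borel_measurable M" "g \<in> borel_measurable M"
    and "kl M f g < \<top>"
  shows "AE x in M. g x = 0 \<longrightarrow> f x = 0"
proof -
  have "AE x in M. kl_term (f x) (g x) \<noteq> \<top>"
    using assms(3) nn_integral_PInf_AE[of "\<lambda>x. kl_term (f x) (g x)" M] unfolding kl_def by simp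
  then show ?thesis
    by eventually_elim (auto simp: kl_term_def split: if_splits)
qed

subsection \<open>Memoryless sources\<close>

abbreviation words :: "nat \<Rightarrow> (nat \<Rightarrow> 'z) set" where
  "words n \<equiv> Pi\<^sub>E {..<n} (\<lambda>_. UNIV)"

lemma countable_words: "countable (words n :: (nat \<Rightarrow> 'z::countable) set)"
  by (intro countable_PiE) auto

text \<open>A finite power of a countable discrete space is discrete, so words form a countable
  alphabet and \<open>discrete_channel\<close> covers blocks as well as letters.\<close>

lemma zblock_eq: "zblock n = count_space (words n :: (nat \<Rightarrow> 'z::countable) set)"
  by (intro count_space_PiM_finite) auto

definition power_kernel :: "nat \<Rightarrow> ('y \<Rightarrow> 'z measure) \<Rightarrow> (nat \<Rightarrow> 'y) \<Rightarrow> (nat \<Rightarrow> 'z) measure" where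
  "power_kernel n k y = PiM {..<n} (\<lambda>i. k (y i))"

text \<open>
  The average over \<open>i < n\<close> of the conditional law of \<open>Z\<^sub>i\<close> given \<open>Y\<^sub>i = u\<close>; as the source is
  memoryless, conditioning amounts to overwriting the \<open>i\<close>-th letter.
\<close>

definition avg_pmf :: "'y measure \<Rightarrow> nat \<Rightarrow> ((nat \<Rightarrow> 'y) \<Rightarrow> (nat \<Rightarrow> 'z) measure) \<Rightarrow> 'y \<Rightarrow> 'z \<Rightarrow> real" where
  "avg_pmf v n k u z =
     (\<Sum>i<n. \<integral>y. measure (k (y(i := u))) {\<zeta>\<in>words n. \<zeta> i = z} \<partial>PiM {..<n} (\<lambda>_. v)) / real n"

definition avg_kernel :: "'y measure \<Rightarrow> nat \<Rightarrow> ((nat \<Rightarrow> 'y) \<Rightarrow> (nat \<Rightarrow> 'z) measure) \<Rightarrow> 'y \<Rightarrow> 'z measure" where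
  "avg_kernel v n k u = density (count_space UNIV) (\<lambda>z. ennreal (avg_pmf v n k u z))"

locale memoryless = prob_space v for v :: "'y measure"
begin

abbreviation Vn :: "nat \<Rightarrow> (nat \<Rightarrow> 'y) measure" where
  "Vn n \<equiv> PiM {..<n} (\<lambda>_. v)"

lemma prob_space_Vn: "prob_space (Vn n)"
  by (intro prob_space_PiM prob_space_axioms)

lemma discrete_v: "discrete_channel v (UNIV :: 'z::countable set)"
  by (intro discrete_channel.intro discrete_channel_axioms.intro prob_space_axioms) auto

lemma discrete_Vn: "discrete_channel (Vn n) (words n :: (nat \<Rightarrow> 'z::countable) set)"
  by (intro discrete_channel.intro discrete_channel_axioms.intro prob_space_Vn countable_words)

abbreviation letter_channel :: "('y \<Rightarrow> 'z::countable measure) \<Rightarrow> bool" where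
  "letter_channel k \<equiv> k \<in> v \<rightarrow>\<^sub>M prob_algebra (count_space UNIV)"

abbreviation word_channel :: "nat \<Rightarrow> ((nat \<Rightarrow> 'y) \<Rightarrow> (nat \<Rightarrow> 'z::countable) measure) \<Rightarrow> bool" where
  "word_channel n k \<equiv> k \<in> Vn n \<rightarrow>\<^sub>M prob_algebra (count_space (words n))"

abbreviation letter_law :: "('y \<Rightarrow> 'z::countable measure) \<Rightarrow> ('y \<times> 'z) measure" where
  "letter_law k \<equiv> kernel_law v (count_space UNIV) k"

abbreviation word_law ::
  "nat \<Rightarrow> ((nat \<Rightarrow> 'y) \<Rightarrow> (nat \<Rightarrow> 'z::countable) measure) \<Rightarrow> ((nat \<Rightarrow> 'y) \<times> (nat \<Rightarrow> 'z)) measure" where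
  "word_law n k \<equiv> kernel_law (Vn n) (count_space (words n)) k"

lemma channel_power:
  assumes "letter_channel (k :: _ \<Rightarrow> 'z::countable measure)"
  shows "word_channel n (power_kernel n k)"
  unfolding power_kernel_def zblock_eq[symmetric] by (rule measurable_PiM_kernel[OF _ assms]) simp

lemma word_law_power:
  assumes k: "letter_channel (k :: _ \<Rightarrow> 'z::countable measure)"
  shows "word_law n (power_kernel n k) = distr (PiM {..<n} (\<lambda>_. letter_law k))
    (Vn n \<Otimes>\<^sub>M count_space (words n)) (\<lambda>\<omega>. (\<lambda>i\<in>{..<n}. fst (\<omega> i), \<lambda>i\<in>{..<n}. snd (\<omega> i)))"
  unfolding power_kernel_def zblock_eq[symmetric] by (rule kernel_law_PiM[OF _ prob_space_axioms k]) simp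

lemma measure_power:
  assumes k: "letter_channel (k :: _ \<Rightarrow> 'z::countable measure)" and y: "y \<in> space (Vn n)" and z: "z \<in> words n"
  shows "measure (power_kernel n k y) {z} = (\<Prod>i<n. measure (k (y i)) {z i})"
proof -
  interpret v: discrete_channel v "UNIV :: 'z set" by (rule discrete_v)
  have yi: "y i \<in> space v" if "i < n" for i
    using y that by (auto simp: space_PiM)
  have z': "{z} = Pi\<^sub>E {..<n} (\<lambda>i. {z i})"
    using z by (intro PiE_singleton[symmetric]) (auto simp: PiE_def)
  have "emeasure (power_kernel n k y) {z} = (\<Prod>i<n. emeasure (k (y i)) {z i})"
    unfolding power_kernel_def z'
    using v.prob_space_channel[OF k yi] v.sets_channel[OF k yi]
    by (intro emeasure_PiM_prob_space) auto
  also have "\<dots> = (\<Prod>i<n. ennreal (measure (k (y i)) {z i}))"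
  proof (rule prod.cong[OF refl])
    fix i assume "i \<in> {..<n}"
    then interpret k: prob_space "k (y i)"
      using v.prob_space_channel[OF k yi] by auto
    show "emeasure (k (y i)) {z i} = ennreal (measure (k (y i)) {z i})"
      by (rule k.emeasure_eq_measure)
  qed
  also have "\<dots> = ennreal (\<Prod>i<n. measure (k (y i)) {z i})"
    by (intro prod_ennreal) auto
  finally show ?thesis
    by (simp add: measure_def prod_nonneg)
qed

lemma measurable_unzip:
  assumes k: "letter_channel (k :: _ \<Rightarrow> 'z::countable measure)"
  shows "(\<lambda>\<omega>. (\<lambda>i\<in>{..<n}. fst (\<omega> i), \<lambda>i\<in>{..<n}. snd (\<omega> i))) \<in>
    PiM {..<n} (\<lambda>_. letter_law k) \<rightarrow>\<^sub>M Vn n \<Otimes>\<^sub>M count_space (words n)"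
proof -
  note [measurable_cong] = sets_kernel_law[OF prob_space_axioms k]
  show ?thesis unfolding zblock_eq[symmetric] by measurable
qed

lemma measurable_letters:
  assumes h: "h \<in> v \<Otimes>\<^sub>M count_space UNIV \<rightarrow>\<^sub>M M" and i: "i < n"
  shows "(\<lambda>x. h (fst x i, snd x i :: 'z::countable)) \<in> Vn n \<Otimes>\<^sub>M count_space (words n) \<rightarrow>\<^sub>M M"
  using i unfolding zblock_eq[symmetric] by (intro measurable_compose[OF _ h]) measurable

text \<open>The log-likelihood ratio against a product reference is a sum of i.i.d. letter ratios,
  each with mean the letter information. \<open>kernel_kl_eq_info_add\<close> then bounds the block
  information without computing the output law of the power kernel.\<close>

lemma info_power_le:
  assumes k: "letter_channel (k :: _ \<Rightarrow> 'z::countable measure)" and fin: "channel_info v UNIV k < \<top>"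
  shows "channel_info (Vn n) (words n) (power_kernel n k) \<le> of_nat n * channel_info v UNIV k"
proof -
  interpret v: discrete_channel v "UNIV :: 'z set" by (rule discrete_v)
  interpret V: discrete_channel "Vn n" "words n :: (nat \<Rightarrow> 'z) set" by (rule discrete_Vn)
  let ?T = "letter_law k" and ?PT = "PiM {..<n} (\<lambda>_. letter_law k)"
  let ?J = "word_law n (power_kernel n k)"
  let ?u = "\<lambda>\<omega> :: nat \<Rightarrow> 'y \<times> 'z. (\<lambda>i\<in>{..<n}. fst (\<omega> i), \<lambda>i\<in>{..<n}. snd (\<omega> i))"
  interpret T: prob_space ?T by (rule prob_space_kernel_law[OF prob_space_axioms k])
  interpret PT: product_prob_space "\<lambda>_. ?T" "{..<n}" by (intro product_prob_spaceI T.prob_space_axioms)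
  note kn = channel_power[OF k, of n]
  define p where "p x = joint_pmf k x" for x
  define q where "q = out_pmf v k"
  define l where "l x = ln (p x / q (snd x))" for x
  have q_nonneg: "q z \<ge> 0" for z by (simp add: q_def v.out_pmf_nonneg)
  have p_nonneg: "p x \<ge> 0" for x by (simp add: p_def)
  have p_meas[measurable]: "p \<in> borel_measurable (v \<Otimes>\<^sub>M count_space UNIV)"
    unfolding p_def by (rule v.measurable_channel_joint_pmf[OF k])
  have l_meas[measurable]: "l \<in> borel_measurable (v \<Otimes>\<^sub>M count_space UNIV)"
    unfolding l_def by measurable
  note sets_T[measurable_cong] = sets_kernel_law[OF prob_space_axioms k]
  have info: "channel_info v UNIV k = kl (v \<Otimes>\<^sub>M count_space UNIV) p (\<lambda>x. q (snd x))"
    by (simp add: channel_info_def kernel_kl_def p_def[abs_def] q_def)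
  have ac: "AE x in v \<Otimes>\<^sub>M count_space UNIV. q (snd x) = 0 \<longrightarrow> p x = 0"
    using fin unfolding info by (intro kl_finite_imp_AE) auto
  have mass_p: "(\<integral>\<^sup>+x. ennreal (p x) \<partial>(v \<Otimes>\<^sub>M count_space UNIV)) = 1"
    unfolding p_def by (rule v.nn_integral_joint_pmf[OF k])
  have mass_q: "(\<integral>\<^sup>+x. ennreal (q (snd x)) \<partial>(v \<Otimes>\<^sub>M count_space UNIV)) = 1"
    unfolding q_def by (intro v.nn_integral_product_pmf v.nn_integral_out_pmf k)
  note kli = kl_eq_integral[of p _ "\<lambda>x. q (snd x)", OF _ _ _ _ ac mass_p mass_q]
  have int_l: "integrable ?T l"
    using kli(1) fin unfolding info v.integral_channel_law(2)[OF k l_meas]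
    by (simp add: l_def p_def q_nonneg)
  have info_l: "channel_info v UNIV k = ennreal (\<integral>x. l x \<partial>?T)" "(\<integral>x. l x \<partial>?T) \<ge> 0"
    using kli(2,3) fin unfolding info v.integral_channel_law(1)[OF k l_meas]
    by (simp_all add: l_def p_def q_nonneg)
  \<comment> \<open>Almost sure positivity under the law itself allows the logarithm of the product
    to be split into a sum.\<close>
  have ae_T: "AE x in ?T. p x > 0 \<and> q (snd x) > 0"
    unfolding v.channel_law_eq_density[OF k] p_def[symmetric]
    using ac p_nonneg q_nonneg by (subst AE_density) (auto simp: order_less_le)
  have ae_PT: "AE \<omega> in ?PT. \<forall>i\<in>{..<n}. p (\<omega> i) > 0 \<and> q (snd (\<omega> i)) > 0"
    using ae_T by (intro AE_finite_allI AE_PiM_component) (auto intro: T.prob_space_axioms)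
  define f where "f x = joint_pmf (power_kernel n k) x" for x
  have f_nonneg: "f x \<ge> 0" for x by (simp add: f_def)
  \<comment> \<open>The reference law on words: the product of the letter output laws.\<close>
  define g where "g z = (\<Prod>i<n. q (z i))" for z
  let ?M = "Vn n \<Otimes>\<^sub>M count_space (words n)"
  have f_meas[measurable]: "f \<in> borel_measurable ?M"
    unfolding f_def by (rule V.measurable_channel_joint_pmf[OF kn])
  have g_meas[measurable]: "(\<lambda>x. g (snd x)) \<in> borel_measurable ?M"
    by measurable
  have f_eq: "f (?u \<omega>) = (\<Prod>i<n. p (\<omega> i))" and g_eq: "g (snd (?u \<omega>)) = (\<Prod>i<n. q (snd (\<omega> i)))"
    if "\<omega> \<in> space ?PT" for \<omega>
  proof -
    have "?u \<omega> \<in> space (Vn n) \<times> words n"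
      using measurable_space[OF measurable_unzip[OF k] that] by (simp add: space_pair_measure)
    then have "f (?u \<omega>) = (\<Prod>i<n. measure (k (fst (?u \<omega>) i)) {snd (?u \<omega>) i})"
      unfolding f_def by (intro measure_power[OF k]) auto
    then show "f (?u \<omega>) = (\<Prod>i<n. p (\<omega> i))"
      by (simp add: p_def)
    show "g (snd (?u \<omega>)) = (\<Prod>i<n. q (snd (\<omega> i)))"
      by (simp add: g_def)
  qed
  have ln_eq: "AE \<omega> in ?PT. ln (f (?u \<omega>) / g (snd (?u \<omega>))) = (\<Sum>i<n. l (\<omega> i))"
    using ae_PT AE_space
  proof eventually_elim
    case (elim \<omega>)
    have "ln (f (?u \<omega>) / g (snd (?u \<omega>))) = ln (\<Prod>i<n. p (\<omega> i) / q (snd (\<omega> i)))"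
      unfolding f_eq[OF elim(2)] g_eq[OF elim(2)] by (simp add: prod_dividef)
    also have "\<dots> = (\<Sum>i<n. l (\<omega> i))"
      unfolding l_def using elim(1) by (intro ln_prod) (auto simp: order_less_imp_not_eq2)
    finally show ?case .
  qed
  have int_comp: "integrable ?PT (\<lambda>\<omega>. l (\<omega> i))" "(\<integral>\<omega>. l (\<omega> i) \<partial>?PT) = (\<integral>x. l x \<partial>?T)" if "i < n" for i
  proof -
    have D: "distr ?PT ?T (\<lambda>\<omega>. \<omega> i) = ?T"
      using that by (intro PT.PiM_component) auto
    have c: "(\<lambda>\<omega>. \<omega> i) \<in> ?PT \<rightarrow>\<^sub>M ?T"
      using that by (intro measurable_component_singleton) simp
    show "integrable ?PT (\<lambda>\<omega>. l (\<omega> i))"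
      using int_l integrable_distr[OF c, of l] by (simp add: D)
    show "(\<integral>\<omega>. l (\<omega> i) \<partial>?PT) = (\<integral>x. l x \<partial>?T)"
      using integral_distr[OF c, of l] by (simp add: D)
  qed
  have ac_n: "AE x in ?M. g (snd x) = 0 \<longrightarrow> f x = 0"
  proof -
    have "AE x in ?J. g (snd x) \<noteq> 0"
      unfolding word_law_power[OF k]
    proof (subst AE_distr_iff[OF measurable_unzip[OF k]])
      show "AE \<omega> in ?PT. g (snd (?u \<omega>)) \<noteq> 0"
        using ae_PT AE_space by eventually_elim (auto simp: g_def order_less_imp_not_eq2)
    qed measurable
    then have "AE x in density ?M (\<lambda>x. ennreal (f x)). g (snd x) \<noteq> 0"
      unfolding V.channel_law_eq_density[OF kn] f_def .
    then show ?thesis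
      using f_nonneg by (subst (asm) AE_density) (auto simp: order_less_le)
  qed
  have mass_f: "(\<integral>\<^sup>+x. ennreal (f x) \<partial>?M) = 1"
    unfolding f_def by (rule V.nn_integral_joint_pmf[OF kn])
  have mass_g: "(\<integral>\<^sup>+x. ennreal (g (snd x)) \<partial>?M) = 1"
  proof (rule V.nn_integral_product_pmf)
    interpret N: product_sigma_finite "\<lambda>_. count_space (UNIV :: 'z set)"
      by (intro product_sigma_finite.intro v.N.sigma_finite_measure_axioms)
    have "(\<integral>\<^sup>+z. ennreal (g z) \<partial>count_space (words n)) =
        (\<integral>\<^sup>+z. (\<Prod>i<n. ennreal (q (z i))) \<partial>zblock n)"
      unfolding zblock_eq g_def using q_nonneg by (simp add: prod_ennreal)
    also have "\<dots> = (\<Prod>i<n. \<integral>\<^sup>+z. ennreal (q z) \<partial>count_space UNIV)"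
      by (rule N.product_nn_integral_prod) auto
    also have "\<dots> = 1"
      using v.nn_integral_out_pmf[OF k] by (simp add: q_def)
    finally show "(\<integral>\<^sup>+z. ennreal (g z) \<partial>count_space (words n)) = 1" .
  qed
  have g_nonneg: "g z \<ge> 0" for z
    unfolding g_def using q_nonneg by (intro prod_nonneg) auto
  note kln = kl_eq_integral[of f ?M "\<lambda>x. g (snd x)", OF f_meas g_meas f_nonneg g_nonneg ac_n mass_f mass_g]
  have F_meas: "(\<lambda>x. ln (f x / g (snd x))) \<in> borel_measurable ?M" by measurable
  note ic = V.integral_channel_law[OF kn F_meas, folded f_def]
  have int_J: "integrable ?J (\<lambda>x. ln (f x / g (snd x)))"
    and val_J: "(\<integral>x. ln (f x / g (snd x)) \<partial>?J) = real n * (\<integral>x. l x \<partial>?T)"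
  proof -
    have m1: "(\<lambda>\<omega>. ln (f (?u \<omega>) / g (snd (?u \<omega>)))) \<in> borel_measurable ?PT"
      by (rule measurable_compose[OF measurable_unzip[OF k] F_meas])
    have m2: "(\<lambda>\<omega>. \<Sum>i<n. l (\<omega> i)) \<in> borel_measurable ?PT"
      by measurable
    have "integrable ?PT (\<lambda>\<omega>. \<Sum>i<n. l (\<omega> i))"
      using int_comp(1) by (intro Bochner_Integration.integrable_sum) auto
    then show "integrable ?J (\<lambda>x. ln (f x / g (snd x)))"
      unfolding word_law_power[OF k] integrable_distr_eq[OF measurable_unzip[OF k] F_meas]
      using integrable_cong_AE[OF m1 m2 ln_eq] by simp
    have "(\<integral>x. ln (f x / g (snd x)) \<partial>?J) = (\<integral>\<omega>. ln (f (?u \<omega>) / g (snd (?u \<omega>))) \<partial>?PT)"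
      unfolding word_law_power[OF k] by (rule integral_distr[OF measurable_unzip[OF k] F_meas])
    also have "\<dots> = (\<integral>\<omega>. (\<Sum>i<n. l (\<omega> i)) \<partial>?PT)"
      by (rule integral_cong_AE[OF m1 m2 ln_eq])
    also have "\<dots> = real n * (\<integral>x. l x \<partial>?T)"
      using int_comp by simp
    finally show "(\<integral>x. ln (f x / g (snd x)) \<partial>?J) = real n * (\<integral>x. l x \<partial>?T)" .
  qed
  have "kl ?M f (\<lambda>x. g (snd x)) < \<top>"
    using int_J kln(1) unfolding ic(2) by simp
  then have "kl ?M f (\<lambda>x. g (snd x)) = ennreal (\<integral>x. ln (f x / g (snd x)) \<partial>?J)"
    using kln(2) unfolding ic(1) by simp
  also have "\<dots> = of_nat n * channel_info v UNIV k"
    unfolding val_J info_l(1) using info_l(2) by (simp add: ennreal_mult ennreal_of_nat_eq_real_of_nat)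
  finally have "kernel_kl (Vn n) (words n) (power_kernel n k) g = of_nat n * channel_info v UNIV k"
    by (simp add: kernel_kl_def f_def[abs_def])
  then show ?thesis
    using V.kernel_kl_eq_info_add[OF kn, of g] g_nonneg by (metis le_iff_add)
qed

end

section \<open>Reduction of a block kernel to its averaged letter kernel\<close>

context memoryless
begin

lemma nn_integral_power_letters:
  assumes k: "letter_channel (k :: _ \<Rightarrow> 'z::countable measure)"
    and h[measurable]: "h \<in> borel_measurable (v \<Otimes>\<^sub>M count_space UNIV)"
  shows "(\<integral>\<^sup>+x. (\<Sum>i<n. h (fst x i, snd x i)) \<partial>word_law n (power_kernel n k)) =
    of_nat n * (\<integral>\<^sup>+x. h x \<partial>letter_law k)"
proof -
  let ?T = "letter_law k" and ?PT = "PiM {..<n} (\<lambda>_. letter_law k)"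
  interpret T: prob_space ?T by (rule prob_space_kernel_law[OF prob_space_axioms k])
  interpret PT: product_prob_space "\<lambda>_. ?T" "{..<n}" by (intro product_prob_spaceI T.prob_space_axioms)
  note sets_T[measurable_cong] = sets_kernel_law[OF prob_space_axioms k]
  have hT: "h \<in> borel_measurable ?T" by measurable
  have "(\<integral>\<^sup>+x. (\<Sum>i<n. h (fst x i, snd x i)) \<partial>word_law n (power_kernel n k)) =
      (\<integral>\<^sup>+\<omega>. (\<Sum>i<n. h (\<omega> i)) \<partial>?PT)"
    unfolding word_law_power[OF k]
    using measurable_letters[OF h]
    by (subst nn_integral_distr[OF measurable_unzip[OF k]]) auto
  also have "\<dots> = (\<Sum>i<n. \<integral>\<^sup>+\<omega>. h (\<omega> i) \<partial>?PT)"
    by (rule nn_integral_sum) (rule measurable_compose[OF _ hT], simp)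
  also have "\<dots> = (\<Sum>i<n. \<integral>\<^sup>+x. h x \<partial>?T)"
  proof (rule sum.cong[OF refl])
    fix i assume i: "i \<in> {..<n}"
    have "(\<integral>\<^sup>+\<omega>. h (\<omega> i) \<partial>?PT) = (\<integral>\<^sup>+x. h x \<partial>distr ?PT ?T (\<lambda>\<omega>. \<omega> i))"
      using i hT by (intro nn_integral_distr[symmetric]) auto
    also have "distr ?PT ?T (\<lambda>\<omega>. \<omega> i) = ?T"
      using i by (rule PT.PiM_component)
    finally show "(\<integral>\<^sup>+\<omega>. h (\<omega> i) \<partial>?PT) = (\<integral>\<^sup>+x. h x \<partial>?T)" .
  qed
  finally show ?thesis by simp
qed

lemma measurable_overwrite:
  assumes "i < n"
  shows "(\<lambda>(u, y). y(i := u)) \<in> v \<Otimes>\<^sub>M Vn n \<rightarrow>\<^sub>M Vn n"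
proof -
  have "(\<lambda>x. \<lambda>j\<in>{..<n}. if j = i then fst x else snd x j) \<in> v \<Otimes>\<^sub>M Vn n \<rightarrow>\<^sub>M Vn n"
    by measurable
  moreover have "(\<lambda>j\<in>{..<n}. if j = i then fst x else snd x j) = (case x of (u, y) \<Rightarrow> y(i := u))"
    if "x \<in> space (v \<Otimes>\<^sub>M Vn n)" for x
  proof -
    obtain u y where x: "x = (u, y)" by (cases x)
    with that have "y j = undefined" if "j \<notin> {..<n}" for j
      using that by (auto simp: space_pair_measure space_PiM PiE_iff extensional_def)
    then show ?thesis
      using assms by (auto simp: x fun_eq_iff)
  qed
  ultimately show ?thesis
    by (subst measurable_cong[where g = "\<lambda>x. \<lambda>j\<in>{..<n}. if j = i then fst x else snd x j"]) auto
qed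

text \<open>Under a product law the overwriting letter is an independent copy of the one it
  replaces. This turns the overwriting in \<open>avg_pmf\<close> back into the law of the
  block.\<close>

lemma nn_integral_resample:
  assumes i: "i < n" and f[measurable]: "f \<in> borel_measurable (Vn n)"
  shows "(\<integral>\<^sup>+u. \<integral>\<^sup>+y. f (y(i := u)) \<partial>Vn n \<partial>v) = (\<integral>\<^sup>+y. f y \<partial>Vn n)"
proof -
  interpret P: product_prob_space "\<lambda>_. v" UNIV
    by (intro product_prob_spaceI prob_space_axioms)
  let ?I = "{..<n} - {i}" and ?W = "PiM ({..<n} - {i}) (\<lambda>_. v)"
  have ins: "{..<n} = insert i ?I" using i by auto
  have upd: "(\<lambda>y. y(i := u)) \<in> Vn n \<rightarrow>\<^sub>M Vn n" if "u \<in> space v" for u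
    using measurable_compose[OF measurable_Pair1'[OF that] measurable_overwrite[OF i]] by simp
  \<comment> \<open>Once coordinate \<open>i\<close> is overwritten its old value no longer matters
    and integrates to 1.\<close>
  have "(\<integral>\<^sup>+y. f (y(i := u)) \<partial>Vn n) = (\<integral>\<^sup>+y. f (y(i := u)) \<partial>?W)" if u: "u \<in> space v" for u
  proof -
    have "(\<integral>\<^sup>+y. f (y(i := u)) \<partial>PiM (insert i ?I) (\<lambda>_. v)) = (\<integral>\<^sup>+y. \<integral>\<^sup>+u'. f ((y(i := u'))(i := u)) \<partial>v \<partial>?W)"
      using measurable_compose[OF upd[OF u] f] ins by (intro P.product_nn_integral_insert) auto
    then show ?thesis
      unfolding ins[symmetric] by (simp add: emeasure_space_1)
  qed
  then have "(\<integral>\<^sup>+u. \<integral>\<^sup>+y. f (y(i := u)) \<partial>Vn n \<partial>v) = (\<integral>\<^sup>+u. \<integral>\<^sup>+y. f (y(i := u)) \<partial>?W \<partial>v)"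
    by (intro nn_integral_cong) auto
  also have "\<dots> = (\<integral>\<^sup>+y. f y \<partial>PiM (insert i ?I) (\<lambda>_. v))"
    using f ins by (intro P.product_nn_integral_insert_rev[symmetric]) auto
  finally show ?thesis unfolding ins[symmetric] .
qed

text \<open>The last identity is stated with the factor \<open>n\<close> to avoid division in
  \<open>ennreal\<close>. It says that averaging the masses over \<open>i\<close> averages the
  expectations of any function of a single output letter.\<close>

lemma
  assumes k: "word_channel n (k :: _ \<Rightarrow> (nat \<Rightarrow> 'z::countable) measure)" and n: "n \<ge> 1"
  shows measurable_avg_pmf: "(\<lambda>u. avg_pmf v n k u z) \<in> borel_measurable v"
    and avg_pmf_nonneg: "avg_pmf v n k u z \<ge> 0"
    and nn_integral_avg_pmf: "u \<in> space v \<Longrightarrow>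
      of_nat n * (\<integral>\<^sup>+z. ennreal (avg_pmf v n k u z) * h z \<partial>count_space UNIV) =
      (\<Sum>i<n. \<integral>\<^sup>+y. \<integral>\<^sup>+\<zeta>. h (\<zeta> i) \<partial>k (y(i := u)) \<partial>Vn n)"
proof -
  interpret V: discrete_channel "Vn n" "words n :: (nat \<Rightarrow> 'z) set" by (rule discrete_Vn)
  let ?E = "\<lambda>i z. {\<zeta>\<in>words n. \<zeta> i = z} :: (nat \<Rightarrow> 'z) set"
  have kE: "(\<lambda>y. measure (k y) (?E i z)) \<in> borel_measurable (Vn n)" for i z
    by (rule measurable_compose[OF measurable_prob_algebraD[OF k] measurable_measure_subprob_algebra]) auto
  have kE2: "(\<lambda>(u, y). measure (k (y(i := u))) (?E i z)) \<in> borel_measurable (v \<Otimes>\<^sub>M Vn n)" if "i < n" for i z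
    using measurable_compose[OF measurable_overwrite[OF that] kE[of i z]] by (simp add: case_prod_unfold)
  show "(\<lambda>u. avg_pmf v n k u z) \<in> borel_measurable v"
  proof -
    have "(\<lambda>u. \<integral>y. measure (k (y(i := u))) (?E i z) \<partial>Vn n) \<in> borel_measurable v" if "i < n" for i
      using kE2[OF that] by (rule V.borel_measurable_lebesgue_integral)
    then show ?thesis
      unfolding avg_pmf_def by (intro borel_measurable_divide borel_measurable_sum) auto
  qed
  show "avg_pmf v n k u z \<ge> 0"
    unfolding avg_pmf_def by (intro divide_nonneg_nonneg sum_nonneg integral_nonneg_AE) auto
  assume u: "u \<in> space v"
  have upd: "y(i := u) \<in> space (Vn n)" if "y \<in> space (Vn n)" "i < n" for y i
    using that u by (auto simp: space_PiM PiE_iff extensional_def)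
  have kEu: "(\<lambda>y. measure (k (y(i := u))) (?E i z)) \<in> borel_measurable (Vn n)" if "i < n" for i z
    using measurable_compose[OF measurable_Pair1'[OF u] kE2[OF that]] by simp
  have inner: "(\<integral>\<^sup>+z. ennreal (measure (k y) (?E i z)) * h z \<partial>count_space UNIV) = (\<integral>\<^sup>+\<zeta>. h (\<zeta> i) \<partial>k y)"
    if y: "y \<in> space (Vn n)" for y i
  proof -
    interpret ky: prob_space "k y" by (rule V.prob_space_channel[OF k y])
    have c: "(\<lambda>\<zeta>. \<zeta> i) \<in> k y \<rightarrow>\<^sub>M count_space UNIV"
      using V.sets_channel[OF k y] by (auto simp: measurable_def)
    let ?D = "distr (k y) (count_space UNIV) (\<lambda>\<zeta>. \<zeta> i)"
    \<comment> \<open>The masses of the event that letter \<open>i\<close> equals \<open>z\<close>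
      describe the \<open>i\<close>-th marginal of \<open>k y\<close>.\<close>
    have D: "density (count_space UNIV) (\<lambda>z. ennreal (measure (k y) (?E i z))) = ?D"
      by (rule density_discrete)
         (use c V.space_channel[OF k y] in \<open>auto simp: emeasure_distr ky.emeasure_eq_measure vimage_def Int_def conj_commute\<close>)
    have "(\<integral>\<^sup>+\<zeta>. h (\<zeta> i) \<partial>k y) = (\<integral>\<^sup>+z. h z \<partial>?D)"
      using c by (intro nn_integral_distr[symmetric]) auto
    then show ?thesis
      unfolding D[symmetric] by (simp add: nn_integral_density)
  qed
  have pmf: "of_nat n * ennreal (avg_pmf v n k u z) =
      (\<Sum>i<n. \<integral>\<^sup>+y. ennreal (measure (k (y(i := u))) (?E i z)) \<partial>Vn n)" for z
  proof -
    have "of_nat n * ennreal (avg_pmf v n k u z) =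
        ennreal (\<Sum>i<n. \<integral>y. measure (k (y(i := u))) (?E i z) \<partial>Vn n)"
      using n unfolding avg_pmf_def ennreal_of_nat_eq_real_of_nat
      by (subst ennreal_mult[symmetric]) (auto intro!: divide_nonneg_nonneg sum_nonneg integral_nonneg_AE)
    also have "\<dots> = (\<Sum>i<n. ennreal (\<integral>y. measure (k (y(i := u))) (?E i z) \<partial>Vn n))"
      by (intro sum_ennreal[symmetric] integral_nonneg_AE) auto
    also have "\<dots> = (\<Sum>i<n. \<integral>\<^sup>+y. ennreal (measure (k (y(i := u))) (?E i z)) \<partial>Vn n)"
    proof (rule sum.cong[OF refl])
      fix i assume "i \<in> {..<n}"
      then have i: "i < n" by simp
      have "measure (k (y(i := u))) (?E i z) \<le> 1" if "y \<in> space (Vn n)" for y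
        using prob_space.prob_le_1[OF V.prob_space_channel[OF k upd[OF that i]]] .
      then have "integrable (Vn n) (\<lambda>y. measure (k (y(i := u))) (?E i z))"
        using kEu[OF i] by (intro V.integrable_const_bound[where B = 1]) auto
      then show "ennreal (\<integral>y. measure (k (y(i := u))) (?E i z) \<partial>Vn n) =
          (\<integral>\<^sup>+y. ennreal (measure (k (y(i := u))) (?E i z)) \<partial>Vn n)"
        by (intro nn_integral_eq_integral[symmetric]) auto
    qed
    finally show ?thesis .
  qed
  have "of_nat n * (\<integral>\<^sup>+z. ennreal (avg_pmf v n k u z) * h z \<partial>count_space UNIV) =
      (\<integral>\<^sup>+z. of_nat n * ennreal (avg_pmf v n k u z) * h z \<partial>count_space UNIV)"
    by (simp add: nn_integral_cmult mult.assoc)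
  also have "\<dots> = (\<Sum>i<n. \<integral>\<^sup>+z. (\<integral>\<^sup>+y. ennreal (measure (k (y(i := u))) (?E i z)) * h z \<partial>Vn n) \<partial>count_space UNIV)"
    unfolding pmf sum_distrib_right using kEu by (subst nn_integral_sum) (auto simp: nn_integral_multc)
  also have "\<dots> = (\<Sum>i<n. \<integral>\<^sup>+y. \<integral>\<^sup>+\<zeta>. h (\<zeta> i) \<partial>k (y(i := u)) \<partial>Vn n)"
  proof (rule sum.cong[OF refl])
    fix i assume "i \<in> {..<n}"
    then have i: "i < n" by simp
    interpret U: discrete_channel "Vn n" "UNIV :: 'z set"
      by (intro discrete_channel.intro discrete_channel_axioms.intro prob_space_Vn) auto
    have [measurable]: "(\<lambda>x. measure (k ((fst x)(i := u))) (?E i (snd x))) \<in> borel_measurable (Vn n \<Otimes>\<^sub>M count_space UNIV)"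
      using kEu[OF i] by (intro U.measurable_count_snd) auto
    have [measurable]: "(\<lambda>x. h (snd x)) \<in> borel_measurable (Vn n \<Otimes>\<^sub>M count_space UNIV)"
      by (intro U.measurable_count_snd) auto
    have "(\<integral>\<^sup>+z. (\<integral>\<^sup>+y. ennreal (measure (k (y(i := u))) (?E i z)) * h z \<partial>Vn n) \<partial>count_space UNIV) =
        (\<integral>\<^sup>+y. (\<integral>\<^sup>+z. ennreal (measure (k (y(i := u))) (?E i z)) * h z \<partial>count_space UNIV) \<partial>Vn n)"
      by (rule U.VN.Fubini') (simp add: case_prod_unfold)
    also have "\<dots> = (\<integral>\<^sup>+y. \<integral>\<^sup>+\<zeta>. h (\<zeta> i) \<partial>k (y(i := u)) \<partial>Vn n)"
      by (intro nn_integral_cong inner upd i)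
    finally show "(\<integral>\<^sup>+z. (\<integral>\<^sup>+y. ennreal (measure (k (y(i := u))) (?E i z)) * h z \<partial>Vn n) \<partial>count_space UNIV) =
        (\<integral>\<^sup>+y. \<integral>\<^sup>+\<zeta>. h (\<zeta> i) \<partial>k (y(i := u)) \<partial>Vn n)" .
  qed
  finally show "of_nat n * (\<integral>\<^sup>+z. ennreal (avg_pmf v n k u z) * h z \<partial>count_space UNIV) =
      (\<Sum>i<n. \<integral>\<^sup>+y. \<integral>\<^sup>+\<zeta>. h (\<zeta> i) \<partial>k (y(i := u)) \<partial>Vn n)" .
qed

lemma of_nat_mult_cancel_ennreal:
  fixes a b :: ennreal
  assumes "of_nat n * a = of_nat n * b" "n \<ge> 1"
  shows "a = b"
  using assms by (simp add: ennreal_mult_cancel_left)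

lemma
  assumes k: "word_channel n (k :: _ \<Rightarrow> (nat \<Rightarrow> 'z::countable) measure)" and n: "n \<ge> 1"
  shows channel_avg: "letter_channel (avg_kernel v n k)"
    and measure_avg: "measure (avg_kernel v n k u) {z} = avg_pmf v n k u z"
proof -
  interpret V: discrete_channel "Vn n" "words n :: (nat \<Rightarrow> 'z) set" by (rule discrete_Vn)
  show "letter_channel (avg_kernel v n k)"
    unfolding avg_kernel_def
  proof (rule kernel_of_pmf)
    fix u assume u: "u \<in> space v"
    have "of_nat n * (\<integral>\<^sup>+z. ennreal (avg_pmf v n k u z) * 1 \<partial>count_space UNIV) =
        (\<Sum>i<n. \<integral>\<^sup>+y. \<integral>\<^sup>+\<zeta>. 1 \<partial>k (y(i := u)) \<partial>Vn n)"
      using nn_integral_avg_pmf[OF k n u, of "\<lambda>_. 1"] by simp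
    also have "\<dots> = (\<Sum>i<n. \<integral>\<^sup>+y. 1 \<partial>Vn n)"
    proof (intro sum.cong refl nn_integral_cong)
      fix i y assume "i \<in> {..<n}" "y \<in> space (Vn n)"
      then have "y(i := u) \<in> space (Vn n)"
        using u by (auto simp: space_PiM PiE_iff extensional_def)
      then interpret ky: prob_space "k (y(i := u))" by (rule V.prob_space_channel[OF k])
      show "(\<integral>\<^sup>+\<zeta>. 1 \<partial>k (y(i := u))) = 1" by (simp add: ky.emeasure_space_1)
    qed
    also have "\<dots> = of_nat n * 1" by (simp add: V.emeasure_space_1)
    finally show "(\<integral>\<^sup>+z. ennreal (avg_pmf v n k u z) \<partial>count_space UNIV) = 1"
      using n of_nat_mult_cancel_ennreal by fastforce
  qed (use measurable_avg_pmf[OF k n] in auto)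
  show "measure (avg_kernel v n k u) {z} = avg_pmf v n k u z"
    unfolding avg_kernel_def using avg_pmf_nonneg[OF k n] by (intro measure_density_count_space) auto
qed

text \<open>The letter law of the averaged kernel is the average over \<open>i\<close> of the laws
  of \<open>(Y\<^sub>i, Z\<^sub>i)\<close>, so it gives the right expectation to every quantity that
  adds up over letters: the distortion, and the log-likelihood sums in
  \<open>info_avg_le\<close>.\<close>

lemma nn_integral_avg_law:
  assumes k: "word_channel n (k :: _ \<Rightarrow> (nat \<Rightarrow> 'z::countable) measure)" and n: "n \<ge> 1"
    and h[measurable]: "h \<in> borel_measurable (v \<Otimes>\<^sub>M count_space UNIV)"
  shows "(\<integral>\<^sup>+x. (\<Sum>i<n. h (fst x i, snd x i)) \<partial>word_law n k) =
    of_nat n * (\<integral>\<^sup>+x. h x \<partial>letter_law (avg_kernel v n k))"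
proof -
  interpret V: discrete_channel "Vn n" "words n :: (nat \<Rightarrow> 'z) set" by (rule discrete_Vn)
  interpret v: discrete_channel v "UNIV :: 'z set" by (rule discrete_v)
  note a = channel_avg[OF k n]
  have a': "of_nat n * (\<integral>\<^sup>+z. h (u, z) \<partial>avg_kernel v n k u) =
      (\<Sum>i<n. \<integral>\<^sup>+y. \<integral>\<^sup>+\<zeta>. h (u, \<zeta> i) \<partial>k (y(i := u)) \<partial>Vn n)" if "u \<in> space v" for u
    using nn_integral_avg_pmf[OF k n that, of "\<lambda>z. h (u, z)"]
    by (simp add: v.nn_integral_channel[OF a that] measure_avg[OF k n])
  define \<Phi> where "\<Phi> i y = (\<integral>\<^sup>+\<zeta>. h (y i, \<zeta> i) \<partial>k y)" for i y
  have hi: "(\<lambda>x. h (fst x i, snd x i)) \<in> borel_measurable (Vn n \<Otimes>\<^sub>M count_space (words n))" if "i < n" for i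
    by (rule measurable_letters[OF h that])
  have \<Phi>: "\<Phi> i \<in> borel_measurable (Vn n)" if "i < n" for i
  proof -
    have "(\<lambda>y. \<integral>\<^sup>+\<zeta>. (\<lambda>(y, \<zeta>). h (y i, \<zeta> i)) (y, \<zeta>) \<partial>k y) \<in> borel_measurable (Vn n)"
      by (rule nn_integral_measurable_subprob_algebra2[where N = "count_space (words n)"])
         (use hi[OF that] measurable_prob_algebraD[OF k] in \<open>auto simp: case_prod_unfold\<close>)
    then show ?thesis by (simp add: \<Phi>_def[abs_def])
  qed
  have \<Phi>_upd: "(\<lambda>u. \<integral>\<^sup>+y. \<Phi> i (y(i := u)) \<partial>Vn n) \<in> borel_measurable v" if "i < n" for i
  proof -
    have "(\<lambda>(u, y). \<Phi> i (y(i := u))) \<in> borel_measurable (v \<Otimes>\<^sub>M Vn n)"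
      using measurable_compose[OF measurable_overwrite[OF that] \<Phi>[OF that]] by (simp add: case_prod_unfold)
    then show ?thesis by (rule V.borel_measurable_nn_integral)
  qed
  have meas_avg: "(\<lambda>u. \<integral>\<^sup>+z. h (u, z) \<partial>avg_kernel v n k u) \<in> borel_measurable v"
  proof -
    have "(\<lambda>u. \<integral>\<^sup>+z. (\<lambda>(u, z). h (u, z)) (u, z) \<partial>avg_kernel v n k u) \<in> borel_measurable v"
      by (rule nn_integral_measurable_subprob_algebra2[where N = "count_space UNIV"])
         (use measurable_prob_algebraD[OF a] in auto)
    then show ?thesis by simp
  qed
  have "of_nat n * (\<integral>\<^sup>+x. h x \<partial>letter_law (avg_kernel v n k)) =
      (\<integral>\<^sup>+u. of_nat n * (\<integral>\<^sup>+z. h (u, z) \<partial>avg_kernel v n k u) \<partial>v)"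
    using meas_avg by (simp add: nn_integral_kernel_law[OF prob_space_axioms a h] nn_integral_cmult)
  also have "\<dots> = (\<integral>\<^sup>+u. (\<Sum>i<n. \<integral>\<^sup>+y. \<Phi> i (y(i := u)) \<partial>Vn n) \<partial>v)"
    by (intro nn_integral_cong) (simp add: a' \<Phi>_def)
  also have "\<dots> = (\<Sum>i<n. \<integral>\<^sup>+u. \<integral>\<^sup>+y. \<Phi> i (y(i := u)) \<partial>Vn n \<partial>v)"
    using \<Phi>_upd by (intro nn_integral_sum) auto
  also have "\<dots> = (\<Sum>i<n. \<integral>\<^sup>+y. \<Phi> i y \<partial>Vn n)"
    using \<Phi> by (intro sum.cong refl nn_integral_resample) auto
  also have "\<dots> = (\<Sum>i<n. \<integral>\<^sup>+x. h (fst x i, snd x i) \<partial>word_law n k)"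
    unfolding \<Phi>_def using hi
    by (intro sum.cong refl) (simp add: nn_integral_kernel_law[OF prob_space_Vn k])
  also have "\<dots> = (\<integral>\<^sup>+x. (\<Sum>i<n. h (fst x i, snd x i)) \<partial>word_law n k)"
  proof (rule nn_integral_sum[symmetric])
    fix i assume "i \<in> {..<n}"
    then show "(\<lambda>x. h (fst x i, snd x i)) \<in> borel_measurable (word_law n k)"
      using hi[of i] by (subst measurable_cong_sets[OF sets_kernel_law[OF prob_space_Vn k] refl]) simp
  qed
  finally show ?thesis by simp
qed

end

text \<open>An integrable majorant for the truncated log-likelihood ratio. Where the ratio is at
  least 1, truncation bounds its logarithm by \<open>ln K\<close>; below 1,
  \<open>abs_mult_ln_le_1\<close> scaled by \<open>b\<close> does.\<close>

lemma mult_abs_ln_min_le: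
  fixes a b K :: real
  assumes "a \<ge> 0" "b \<ge> 0" "K \<ge> 1"
  shows "a * \<bar>ln (min (a / b) K)\<bar> \<le> a * ln K + b"
proof (cases "a = 0 \<or> b = 0")
  case True
  with assms show ?thesis by auto
next
  case False
  with assms have *: "a > 0" "b > 0" by auto
  define r where "r = min (a / b) K"
  have r: "r > 0" "r \<le> K" "r * b \<le> a"
    using * assms by (auto simp: r_def min_def field_simps)
  show ?thesis
  proof (cases "r \<ge> 1")
    case True
    have "ln r \<le> ln K" using r assms by simp
    then have "a * \<bar>ln r\<bar> \<le> a * ln K" using True * by simp
    then show ?thesis using * unfolding r_def by linarith
  next
    case False
    then have r_eq: "r = a / b" using assms by (auto simp: r_def min_def split: if_splits)
    have "\<bar>r * ln r\<bar> \<le> 1" using False r by (intro abs_mult_ln_le_1) auto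
    then have "b * (r * \<bar>ln r\<bar>) \<le> b * 1" using r * by (intro mult_left_mono) (auto simp: abs_mult)
    then have "a * \<bar>ln r\<bar> \<le> b" using * by (simp add: r_eq)
    moreover have "a * ln K \<ge> 0" using * assms by simp
    ultimately show ?thesis by (simp add: r_def)
  qed
qed

context memoryless
begin

text \<open>
  The log-likelihood ratio of the averaged channel, summed over the letters and truncated at
  \<open>K\<close> to make it integrable, is a test function for the variational formula at block level;
  no convexity of the mutual information is needed.
\<close>

lemma info_avg_le:
  assumes k: "word_channel n (k :: _ \<Rightarrow> (nat \<Rightarrow> 'z::countable) measure)" and n: "n \<ge> 1"
  shows "of_nat n * channel_info v UNIV (avg_kernel v n k) \<le> channel_info (Vn n) (words n) k"
proof -
  interpret v: discrete_channel v "UNIV :: 'z set" by (rule discrete_v)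
  interpret V: discrete_channel "Vn n" "words n :: (nat \<Rightarrow> 'z) set" by (rule discrete_Vn)
  interpret P: product_prob_space "\<lambda>_. v" UNIV by (intro product_prob_spaceI prob_space_axioms)
  note a_ch = channel_avg[OF k n]
  let ?A = "letter_law (avg_kernel v n k)" and ?J = "word_law n k"
  let ?m = "v \<Otimes>\<^sub>M count_space (UNIV :: 'z set)" and ?M = "Vn n \<Otimes>\<^sub>M count_space (words n :: (nat \<Rightarrow> 'z) set)"
  define a where "a x = joint_pmf (avg_kernel v n k) x" for x
  define b where "b = out_pmf v (avg_kernel v n k)"
  define p where "p x = joint_pmf k x" for x
  define q where "q = out_pmf (Vn n) k"
  have a_nonneg: "a x \<ge> 0" and p_nonneg: "p y \<ge> 0" for x y by (auto simp: a_def p_def)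
  have b_nonneg: "b z \<ge> 0" and q_nonneg: "q w \<ge> 0" for z w
    by (auto simp: b_def q_def v.out_pmf_nonneg V.out_pmf_nonneg)
  have a_meas[measurable]: "a \<in> borel_measurable ?m"
    unfolding a_def by (rule v.measurable_channel_joint_pmf[OF a_ch])
  have p_meas[measurable]: "p \<in> borel_measurable ?M"
    unfolding p_def by (rule V.measurable_channel_joint_pmf[OF k])
  have b_meas[measurable]: "(\<lambda>x. b (snd x)) \<in> borel_measurable ?m" by measurable
  have q_meas[measurable]: "(\<lambda>x. q (snd x)) \<in> borel_measurable ?M" by measurable
  have mass_a: "(\<integral>\<^sup>+x. ennreal (a x) \<partial>?m) = 1"
    unfolding a_def by (rule v.nn_integral_joint_pmf[OF a_ch])
  have mass_b: "(\<integral>\<^sup>+x. ennreal (b (snd x)) \<partial>?m) = 1"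
    unfolding b_def by (intro v.nn_integral_product_pmf v.nn_integral_out_pmf a_ch)
  have mass_q: "(\<integral>\<^sup>+x. ennreal (q (snd x)) \<partial>?M) = 1"
    unfolding q_def by (intro V.nn_integral_product_pmf V.nn_integral_out_pmf k)
  have int_a: "integrable ?m a" and int_b: "integrable ?m (\<lambda>x. b (snd x))"
    using mass_a mass_b a_nonneg b_nonneg by (auto intro!: integrableI_nonneg)
  have b_eq: "(\<integral>\<^sup>+u. ennreal (a (u, z)) \<partial>v) = ennreal (b z)" for z
    unfolding a_def b_def using v.nn_integral_out_pmf_inner[OF a_ch, of z] by simp
  note lawA = v.nn_integral_channel_law[OF a_ch, folded a_def]
  note lawA_r = v.integral_channel_law[OF a_ch, folded a_def]
  note lawJ = V.nn_integral_channel_law[OF k, folded p_def]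
  note lawJ_r = V.integral_channel_law[OF k, folded p_def]
  \<comment> \<open>The output mass \<open>b z\<close> is the integral of the nonnegative function
    \<open>a (u, z)\<close> over \<open>u\<close>, so where it is 0 the joint mass vanishes almost
    everywhere.\<close>
  have ac: "AE x in ?m. b (snd x) = 0 \<longrightarrow> a x = 0"
  proof -
    have "(\<integral>\<^sup>+x. (if b (snd x) = 0 then ennreal (a x) else 0) \<partial>?m) =
        (\<integral>\<^sup>+z. \<integral>\<^sup>+u. (if b z = 0 then ennreal (a (u, z)) else 0) \<partial>v \<partial>count_space UNIV)"
      by (subst v.VN.nn_integral_snd[symmetric]) auto
    also have "\<dots> = (\<integral>\<^sup>+z. 0 \<partial>count_space (UNIV :: 'z set))"
    proof (rule nn_integral_cong)
      fix z :: 'z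
      show "(\<integral>\<^sup>+u. (if b z = 0 then ennreal (a (u, z)) else 0) \<partial>v) = 0"
        using b_eq[of z] by (cases "b z = 0") auto
    qed
    finally have "(\<integral>\<^sup>+x. (if b (snd x) = 0 then ennreal (a x) else 0) \<partial>?m) = 0"
      by simp
    then have "AE x in ?m. (if b (snd x) = 0 then ennreal (a x) else 0) = 0"
      by (subst (asm) nn_integral_0_iff_AE) auto
    then show ?thesis
      by eventually_elim (use a_nonneg in \<open>auto simp: ennreal_eq_0_iff intro: antisym split: if_splits\<close>)
  qed
  have letters: "(\<integral>\<^sup>+x. (\<Sum>i<n. h (fst x i, snd x i)) \<partial>?J) = of_nat n * (\<integral>\<^sup>+x. h x \<partial>?A)"
    if "h \<in> borel_measurable ?m" for h
    by (rule nn_integral_avg_law[OF k n that])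
  have letters_meas: "(\<lambda>x. h (fst x i, snd x i)) \<in> borel_measurable ?J"
    if "h \<in> borel_measurable ?m" "i < n" for h :: "_ \<Rightarrow> 'c :: topological_space" and i
    using measurable_letters[OF that] by (subst measurable_cong_sets[OF sets_kernel_law[OF prob_space_Vn k] refl])
  have letters_int: "integrable ?J (\<lambda>x. \<Sum>i<n. h (fst x i, snd x i))"
      "(\<integral>x. (\<Sum>i<n. h (fst x i, snd x i)) \<partial>?J) = real n * (\<integral>x. h x \<partial>?A)"
    if h: "integrable ?A h" for h :: "_ \<Rightarrow> real"
  proof -
    have h_meas: "h \<in> borel_measurable ?m"
      using borel_measurable_integrable[OF h]
      by (subst (asm) measurable_cong_sets[OF sets_kernel_law[OF prob_space_axioms a_ch] refl])
    have *: "integrable ?J (\<lambda>x. \<Sum>i<n. g (fst x i, snd x i)) \<and>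
        (\<integral>x. (\<Sum>i<n. g (fst x i, snd x i)) \<partial>?J) = real n * (\<integral>x. g x \<partial>?A)"
      if g: "integrable ?A g" "\<And>x. g x \<ge> 0" for g
    proof -
      have g_meas: "g \<in> borel_measurable ?m"
        using borel_measurable_integrable[OF g(1)]
        by (subst (asm) measurable_cong_sets[OF sets_kernel_law[OF prob_space_axioms a_ch] refl])
      have "(\<integral>\<^sup>+x. ennreal (\<Sum>i<n. g (fst x i, snd x i)) \<partial>?J) = of_nat n * (\<integral>\<^sup>+x. ennreal (g x) \<partial>?A)"
        using letters[of "\<lambda>x. ennreal (g x)"] g_meas g(2) by (simp add: sum_ennreal)
      also have "\<dots> = ennreal (real n * (\<integral>x. g x \<partial>?A))"
        using nn_integral_eq_integral[OF g(1)] g(2)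
        by (simp add: ennreal_of_nat_eq_real_of_nat ennreal_mult integral_nonneg_AE)
      finally have eq: "(\<integral>\<^sup>+x. ennreal (\<Sum>i<n. g (fst x i, snd x i)) \<partial>?J) = ennreal (real n * (\<integral>x. g x \<partial>?A))" .
      have m: "(\<lambda>x. \<Sum>i<n. g (fst x i, snd x i)) \<in> borel_measurable ?J"
        using letters_meas[OF g_meas] by (intro borel_measurable_sum) auto
      have nn: "AE x in ?J. (\<Sum>i<n. g (fst x i, snd x i)) \<ge> 0"
        using g(2) by (intro AE_I2 sum_nonneg) auto
      have "(\<integral>x. (\<Sum>i<n. g (fst x i, snd x i)) \<partial>?J) = real n * (\<integral>x. g x \<partial>?A)"
        unfolding integral_eq_nn_integral[OF m nn] eq using g(2) by (simp add: integral_nonneg_AE)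
      then show ?thesis
        using integrableI_nonneg[OF m nn] eq by simp
    qed
    \<comment> \<open>The identity for sums over letters is available for nonnegative integrands, so
      a signed \<open>h\<close> is treated through its positive and negative parts.\<close>
    have pos: "integrable ?A (\<lambda>x. max 0 (h x))" and neg: "integrable ?A (\<lambda>x. max 0 (- h x))"
      using h by auto
    have split: "h x = max 0 (h x) - max 0 (- h x)" for x by auto
    have sum_split: "(\<Sum>i<n. h (fst x i, snd x i)) =
        (\<Sum>i<n. max 0 (h (fst x i, snd x i))) - (\<Sum>i<n. max 0 (- h (fst x i, snd x i)))"
      for x :: "(nat \<Rightarrow> 'y) \<times> (nat \<Rightarrow> 'z)"
      unfolding sum_subtractf[symmetric] by (intro sum.cong refl split)
    show "integrable ?J (\<lambda>x. \<Sum>i<n. h (fst x i, snd x i))"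
      unfolding sum_split using *[OF pos] *[OF neg] by auto
    have "(\<integral>x. h x \<partial>?A) = (\<integral>x. max 0 (h x) \<partial>?A) - (\<integral>x. max 0 (- h x) \<partial>?A)"
      using pos neg by (subst split) (rule Bochner_Integration.integral_diff)
    then show "(\<integral>x. (\<Sum>i<n. h (fst x i, snd x i)) \<partial>?J) = real n * (\<integral>x. h x \<partial>?A)"
      unfolding sum_split using *[OF pos] *[OF neg] by (simp add: right_diff_distrib)
  qed
  \<comment> \<open>The bound on \<open>K\<close> gives \<open>ln K >= 1\<close>, which keeps the
    truncated integrand nonnegative where the truncation is active.\<close>
  have bound: "of_nat n * (\<integral>\<^sup>+x. ennreal (a x * ln (min (a x / b (snd x)) K) - a x + b (snd x)) \<partial>?m)
      \<le> channel_info (Vn n) (words n) k" if K: "K \<ge> exp 1" for K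
  proof -
    have K1: "K \<ge> 1" "ln K \<ge> 1"
    proof -
      show "K \<ge> 1" using K exp_ge_add_one_self[of "1::real"] by linarith
      then show "ln K \<ge> 1" using K by (subst ln_ge_iff) auto
    qed
    define r where "r x = min (a x / b (snd x)) K" for x
    have r_nonneg: "r x \<ge> 0" for x
      using a_nonneg b_nonneg K1 by (auto simp: r_def)
    have r_meas[measurable]: "r \<in> borel_measurable ?m" unfolding r_def by measurable
    have int_lnr: "integrable ?m (\<lambda>x. a x * ln (r x))"
    proof (rule Bochner_Integration.integrable_bound)
      show "integrable ?m (\<lambda>x. a x * ln K + b (snd x))"
        using int_a int_b by auto
      show "AE x in ?m. norm (a x * ln (r x)) \<le> norm (a x * ln K + b (snd x))"
      proof (rule AE_I2)
        fix x
        have "a x * \<bar>ln (r x)\<bar> \<le> a x * ln K + b (snd x)"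
          unfolding r_def using a_nonneg b_nonneg K1 by (intro mult_abs_ln_min_le) auto
        then show "norm (a x * ln (r x)) \<le> norm (a x * ln K + b (snd x))"
          using a_nonneg[of x] by (simp add: abs_mult)
      qed
    qed measurable
    then have int_lnr_A: "integrable ?A (\<lambda>x. ln (r x))"
      using lawA_r(2)[of "\<lambda>x. ln (r x)"] by simp
    define w where "w x = (\<Prod>i<n. r (fst x i, snd x i))" for x
    have w_nonneg: "w x \<ge> 0" for x unfolding w_def using r_nonneg by (intro prod_nonneg) auto
    have w_meas: "w \<in> borel_measurable ?M"
      unfolding w_def using measurable_letters[OF r_meas] by (intro borel_measurable_prod) auto
    have pos_J: "AE x in ?J. \<forall>i\<in>{..<n}. r (fst x i, snd x i) > 0"
    proof -
      \<comment> \<open>An indicator of vanishing ratio: it has expectation 0 under the letter law,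
        and \<open>letters\<close> carries this to all coordinates of the block at once.\<close>
      define e :: "'y \<times> 'z \<Rightarrow> ennreal" where "e x = (if r x = 0 then 1 else 0)" for x
      have e_meas: "e \<in> borel_measurable ?m" unfolding e_def by measurable
      have "(\<integral>\<^sup>+x. e x \<partial>?A) = (\<integral>\<^sup>+x. ennreal (a x) * e x \<partial>?m)"
        by (rule lawA[OF e_meas])
      also have "\<dots> = (\<integral>\<^sup>+x. 0 \<partial>?m)"
      proof (rule nn_integral_cong_AE, use ac in eventually_elim)
        case (elim x)
        then show ?case
          using K1 by (cases "b (snd x) = 0") (auto simp: e_def r_def min_def split: if_splits)
      qed
      finally have zero: "(\<integral>\<^sup>+x. (\<Sum>i<n. e (fst x i, snd x i)) \<partial>?J) = 0"
        unfolding letters[OF e_meas] by simp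
      have "(\<lambda>x. \<Sum>i<n. e (fst x i, snd x i)) \<in> borel_measurable ?J"
        using letters_meas[OF e_meas] by (intro borel_measurable_sum) auto
      then have "AE x in ?J. (\<Sum>i<n. e (fst x i, snd x i)) = 0"
        using zero by (subst (asm) nn_integral_0_iff_AE) auto
      then show ?thesis
      proof eventually_elim
        case (elim x)
        show ?case
        proof
          fix i assume i: "i \<in> {..<n}"
          then have "e (fst x i, snd x i) = 0"
            using elim by (subst (asm) sum_eq_0_iff) auto
          then have "r (fst x i, snd x i) \<noteq> 0"
            by (simp add: e_def split: if_splits)
          then show "r (fst x i, snd x i) > 0"
            using r_nonneg[of "(fst x i, snd x i)"] by linarith
        qed
      qed
    qed
    have ln_w: "AE x in ?J. ln (w x) = (\<Sum>i<n. ln (r (fst x i, snd x i)))"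
      using pos_J
    proof eventually_elim
      case (elim x)
      then show ?case
        unfolding w_def by (intro ln_prod) (auto simp: order_less_imp_not_eq2)
    qed
    have ln_w_meas: "(\<lambda>x. ln (w x)) \<in> borel_measurable ?M" using w_meas by measurable
    then have ln_w_meas_J: "(\<lambda>x. ln (w x)) \<in> borel_measurable ?J"
      by (subst measurable_cong_sets[OF sets_kernel_law[OF prob_space_Vn k] refl])
    note sum_meas_J = borel_measurable_integrable[OF letters_int(1)[OF int_lnr_A]]
    have int_w: "integrable ?J (\<lambda>x. ln (w x))"
      using letters_int(1)[OF int_lnr_A] integrable_cong_AE[OF ln_w_meas_J sum_meas_J ln_w] by simp
    have val_w: "(\<integral>x. ln (w x) \<partial>?J) = real n * (\<integral>x. ln (r x) \<partial>?A)"
      using integral_cong_AE[OF ln_w_meas_J sum_meas_J ln_w] letters_int(2)[OF int_lnr_A] by simp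
    have "ennreal (\<integral>x. p x * ln (w x) \<partial>?M) \<le> kl ?M p (\<lambda>x. q (snd x))"
    proof (rule kl_variational[OF p_meas q_meas w_meas p_nonneg q_nonneg w_nonneg _ mass_q])
      have "AE x in ?J. w x > 0"
        using pos_J by eventually_elim (auto simp: w_def intro!: prod_pos)
      then have "AE x in density ?M (\<lambda>x. ennreal (p x)). w x > 0"
        unfolding V.channel_law_eq_density[OF k] p_def .
      then show "AE x in ?M. p x > 0 \<longrightarrow> w x > 0"
        by (subst (asm) AE_density) auto
      show "integrable ?M (\<lambda>x. p x * ln (w x))"
        using int_w lawJ_r(2)[OF ln_w_meas] by simp
      \<comment> \<open>For a fixed output word the source letters are independent, so the integral
        of \<open>w\<close> factorises. Each factor is at most \<open>b / b\<close>, as truncation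
        only lowers the ratio.\<close>
      have "(\<integral>\<^sup>+x. ennreal (q (snd x) * w x) \<partial>?M) = (\<integral>\<^sup>+z. \<integral>\<^sup>+y. ennreal (q z * w (y, z)) \<partial>Vn n \<partial>count_space (words n))"
        using w_meas by (subst V.VN.nn_integral_snd[symmetric]) auto
      also have "\<dots> \<le> (\<integral>\<^sup>+z. ennreal (q z) \<partial>count_space (words n))"
      proof (rule nn_integral_mono)
        fix z :: "nat \<Rightarrow> 'z"
        have rz: "(\<lambda>u. r (u, z i)) \<in> borel_measurable v" for i by measurable
        have one: "(\<integral>\<^sup>+u. ennreal (r (u, z i)) \<partial>v) \<le> 1" for i
        proof -
          have "(\<integral>\<^sup>+u. ennreal (r (u, z i)) \<partial>v) \<le> (\<integral>\<^sup>+u. ennreal (1 / b (z i)) * ennreal (a (u, z i)) \<partial>v)"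
            using a_nonneg b_nonneg
            by (intro nn_integral_mono) (auto simp: r_def ennreal_mult[symmetric] intro!: ennreal_leI)
          also have "\<dots> = ennreal (1 / b (z i)) * ennreal (b (z i))"
            by (simp add: nn_integral_cmult b_eq)
          also have "\<dots> \<le> 1"
            using b_nonneg[of "z i"] by (cases "b (z i) = 0") (auto simp: ennreal_mult[symmetric])
          finally show ?thesis .
        qed
        have "(\<integral>\<^sup>+y. ennreal (q z * w (y, z)) \<partial>Vn n) = ennreal (q z) * (\<integral>\<^sup>+y. (\<Prod>i<n. ennreal (r (y i, z i))) \<partial>Vn n)"
          using rz q_nonneg r_nonneg
          by (subst nn_integral_cmult[symmetric])
             (auto simp: w_def prod_ennreal ennreal_mult prod_nonneg
                intro!: borel_measurable_prod_ennreal measurable_compose[OF measurable_component_singleton])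
        also have "(\<integral>\<^sup>+y. (\<Prod>i<n. ennreal (r (y i, z i))) \<partial>Vn n) = (\<Prod>i<n. \<integral>\<^sup>+u. ennreal (r (u, z i)) \<partial>v)"
          using rz by (intro P.product_nn_integral_prod[where f = "\<lambda>i u. ennreal (r (u, z i))"]) auto
        also have "\<dots> \<le> 1"
          using one by (intro prod_le_1) auto
        finally show "(\<integral>\<^sup>+y. ennreal (q z * w (y, z)) \<partial>Vn n) \<le> ennreal (q z)"
          by (simp add: mult_left_mono)
      qed
      also have "\<dots> = 1" unfolding q_def by (rule V.nn_integral_out_pmf[OF k])
      finally show "(\<integral>\<^sup>+x. ennreal (q (snd x) * w x) \<partial>?M) \<le> 1" .
    qed
    then have le: "ennreal (real n * (\<integral>x. ln (r x) \<partial>?A)) \<le> channel_info (Vn n) (words n) k"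
      unfolding channel_info_def kernel_kl_def lawJ_r(1)[OF ln_w_meas, symmetric] val_w
      by (simp add: p_def[abs_def] q_def)
    have phi_nonneg: "AE x in ?m. a x * ln (r x) - a x + b (snd x) \<ge> 0"
      using ac
    proof eventually_elim
      case (elim x)
      show ?case
      proof (cases "b (snd x) = 0 \<or> a x / b (snd x) \<le> K")
        case True
        then show ?thesis
          using elim b_nonneg[of "snd x"] ln_ratio_ge[OF a_nonneg, of "b (snd x)" x]
          by (cases "b (snd x) = 0") (auto simp: r_def min_def order_less_le)
      next
        case False
        then have "a x * ln (r x) \<ge> a x * 1"
          using K1 a_nonneg by (intro mult_left_mono) (auto simp: r_def min_def)
        then show ?thesis using b_nonneg[of "snd x"] by simp
      qed
    qed
    have "(\<integral>\<^sup>+x. ennreal (a x * ln (r x) - a x + b (snd x)) \<partial>?m) =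
        ennreal (\<integral>x. a x * ln (r x) - a x + b (snd x) \<partial>?m)"
      using int_lnr int_a int_b phi_nonneg by (intro nn_integral_eq_integral) auto
    also have "(\<integral>x. a x * ln (r x) - a x + b (snd x) \<partial>?m) = (\<integral>x. a x * ln (r x) \<partial>?m) - 1 + 1"
      using int_lnr int_a int_b mass_a mass_b a_nonneg b_nonneg
      by (simp add: integral_eq_nn_integral)
    also have "\<dots> = (\<integral>x. ln (r x) \<partial>?A)"
      using lawA_r(1)[of "\<lambda>x. ln (r x)"] by simp
    finally show ?thesis
      using le by (simp add: r_def ennreal_mult' ennreal_of_nat_eq_real_of_nat)
  qed
  \<comment> \<open>For each \<open>x\<close> the truncation is eventually inactive, so Fatou's
    lemma removes it.\<close>
  have "kl ?m a (\<lambda>x. b (snd x)) \<le>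
      (\<integral>\<^sup>+x. liminf (\<lambda>j. ennreal (a x * ln (min (a x / b (snd x)) (exp 1 + real j)) - a x + b (snd x))) \<partial>?m)"
    unfolding kl_def
  proof (rule nn_integral_mono_AE, use ac in eventually_elim)
    case (elim x)
    define \<phi> where "\<phi> j = ennreal (a x * ln (min (a x / b (snd x)) (exp 1 + real j)) - a x + b (snd x))" for j
    have "\<forall>\<^sub>F j in sequentially. kl_term (a x) (b (snd x)) \<le> \<phi> j"
    proof (cases "b (snd x) = 0")
      case True
      with elim show ?thesis by (simp add: kl_term_def)
    next
      case False
      obtain j0 :: nat where j0: "a x / b (snd x) \<le> real j0" using real_arch_simple by blast
      have "kl_term (a x) (b (snd x)) \<le> \<phi> j" if "j \<ge> j0" for j
      proof -
        have "a x / b (snd x) \<le> real j" using j0 that by linarith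
        then have "a x / b (snd x) \<le> exp 1 + real j"
          using exp_gt_zero[of "1::real"] by linarith
        then show ?thesis using False by (simp add: \<phi>_def kl_term_def min_def)
      qed
      then show ?thesis by (auto simp: eventually_sequentially)
    qed
    then show "kl_term (a x) (b (snd x)) \<le> liminf \<phi>"
      by (rule Liminf_bounded)
  qed
  also have "\<dots> \<le> liminf (\<lambda>j. \<integral>\<^sup>+x. ennreal (a x * ln (min (a x / b (snd x)) (exp 1 + real j)) - a x + b (snd x)) \<partial>?m)"
    by (rule nn_integral_liminf) measurable
  finally have "of_nat n * kl ?m a (\<lambda>x. b (snd x)) \<le>
      of_nat n * liminf (\<lambda>j. \<integral>\<^sup>+x. ennreal (a x * ln (min (a x / b (snd x)) (exp 1 + real j)) - a x + b (snd x)) \<partial>?m)"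
    by (intro mult_left_mono) auto
  also have "\<dots> \<le> channel_info (Vn n) (words n) k"
  proof -
    define I where "I j = (\<integral>\<^sup>+x. ennreal (a x * ln (min (a x / b (snd x)) (exp 1 + real j)) - a x + b (snd x)) \<partial>?m)" for j
    have le: "I j \<le> channel_info (Vn n) (words n) k / of_nat n" for j
    proof -
      have "I j = I j * of_nat n / of_nat n"
        using n by (intro ennreal_mult_divide_eq[symmetric]) auto
      also have "\<dots> \<le> channel_info (Vn n) (words n) k / of_nat n"
        using bound[of "exp 1 + real j"]
        by (intro divide_right_mono_ennreal) (simp add: I_def mult.commute)
      finally show ?thesis .
    qed
    have "liminf I \<le> channel_info (Vn n) (words n) k / of_nat n"
      using Liminf_mono[of I "\<lambda>_. channel_info (Vn n) (words n) k / of_nat n" sequentially] le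
      by (simp add: Liminf_const)
    then have "of_nat n * liminf I \<le> of_nat n * (channel_info (Vn n) (words n) k / of_nat n)"
      by (intro mult_left_mono) auto
    also have "\<dots> = channel_info (Vn n) (words n) k"
    proof -
      have "of_nat n * (channel_info (Vn n) (words n) k / of_nat n) = channel_info (Vn n) (words n) k * of_nat n / of_nat n"
        by (simp add: ennreal_times_divide mult.commute)
      then show ?thesis
        using n by (simp add: ennreal_mult_divide_eq)
    qed
    finally show ?thesis by (simp add: I_def[abs_def])
  qed
  finally show ?thesis
    by (simp add: channel_info_def kernel_kl_def a_def[abs_def] b_def)
qed

end

subsection \<open>Optimal kernels of memoryless sources\<close>

lemma enn2ereal_divide_le_iff:
  assumes c: "(0::real) < c"
  shows "enn2ereal a / ereal c \<le> enn2ereal b / ereal c \<longleftrightarrow> a \<le> b"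
proof (cases a rule: ennreal_cases)
  case (real r)
  note a = this
  show ?thesis
  proof (cases b rule: ennreal_cases)
    case (real s)
    with a c show ?thesis by (simp add: divide_le_cancel)
  next
    case top
    with a c show ?thesis by simp
  qed
next
  case top
  note a = this
  show ?thesis
  proof (cases b rule: ennreal_cases)
    case (real s)
    with a c show ?thesis by (simp add: top_unique)
  next
    case top
    with a c show ?thesis by simp
  qed
qed

context memoryless
begin

lemma kernel_info_eq:
  assumes "word_channel n (k :: _ \<Rightarrow> (nat \<Rightarrow> 'z::countable) measure)"
  shows "kernel_info n (Vn n) k = enn2ereal (channel_info (Vn n) (words n) k) / ereal (ln 2)"
proof -
  interpret V: discrete_channel "Vn n" "words n :: (nat \<Rightarrow> 'z) set" by (rule discrete_Vn)
  show ?thesis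
    unfolding kernel_info_def zblock_eq channel_info_def by (rule V.mutual_info_channel[OF assms])
qed

lemma kernel_distortion_eq:
  assumes k: "word_channel n (k :: _ \<Rightarrow> (nat \<Rightarrow> 'z::countable) measure)"
    and d: "\<And>y z. y \<in> space v \<Longrightarrow> d y z \<ge> 0"
  shows "kernel_distortion d n (Vn n) k = (\<integral>\<^sup>+x. (\<Sum>i<n. ennreal (d (fst x i) (snd x i))) \<partial>word_law n k)"
  unfolding kernel_distortion_def zblock_eq
proof (rule nn_integral_cong)
  fix x assume "x \<in> space (word_law n k)"
  then have "x \<in> space (Vn n \<Otimes>\<^sub>M count_space (words n))"
    using sets_eq_imp_space_eq[OF sets_kernel_law[OF prob_space_Vn k]] by simp
  then have "fst x \<in> space (Vn n)"
    by (simp add: space_pair_measure mem_Times_iff)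
  then have "d (fst x i) (snd x i) \<ge> 0" if "i < n" for i
    using that by (intro d) (simp add: space_PiM PiE_iff)
  then show "ennreal (\<Sum>i<n. d (fst x i) (snd x i)) = (\<Sum>i<n. ennreal (d (fst x i) (snd x i)))"
    by (intro sum_ennreal[symmetric]) auto
qed

lemma admissible_iff:
  "admissible d D n (Vn n) k \<longleftrightarrow>
    word_channel n (k :: _ \<Rightarrow> (nat \<Rightarrow> 'z::countable) measure) \<and>
    kernel_distortion d n (Vn n) k \<le> of_nat n * ennreal D"
proof -
  have "ennreal (real n * D) = of_nat n * ennreal D"
    unfolding ennreal_of_nat_eq_real_of_nat by (rule ennreal_mult') simp
  then show ?thesis unfolding admissible_def zblock_eq by simp
qed

context
  fixes d :: "'y \<Rightarrow> 'z::countable \<Rightarrow> real" and D :: real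
  assumes d_meas: "(\<lambda>x. d (fst x) (snd x)) \<in> borel_measurable (v \<Otimes>\<^sub>M count_space UNIV)"
    and d_nonneg: "\<And>y z. y \<in> space v \<Longrightarrow> d y z \<ge> 0"
begin

lemma distortion_avg_le:
  assumes k: "admissible d D n (Vn n) k" and n: "n \<ge> 1"
  shows "(\<integral>\<^sup>+x. ennreal (d (fst x) (snd x)) \<partial>letter_law (avg_kernel v n k)) \<le> ennreal D"
proof -
  have k': "word_channel n k" "kernel_distortion d n (Vn n) k \<le> of_nat n * ennreal D"
    using k by (auto simp: admissible_iff)
  have meas: "(\<lambda>x. ennreal (d (fst x) (snd x))) \<in> borel_measurable (v \<Otimes>\<^sub>M count_space UNIV)"
    using d_meas by (rule measurable_compose) simp
  have "of_nat n * (\<integral>\<^sup>+x. ennreal (d (fst x) (snd x)) \<partial>letter_law (avg_kernel v n k)) \<le> of_nat n * ennreal D"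
    using k'(2) kernel_distortion_eq[of k n d, OF k'(1) d_nonneg] nn_integral_avg_law[OF k'(1) n meas] by simp
  then show ?thesis
    using n by (subst (asm) ennreal_mult_le_mult_iff) auto
qed

lemma admissible_power:
  assumes k: "letter_channel k"
    and le: "(\<integral>\<^sup>+x. ennreal (d (fst x) (snd x)) \<partial>letter_law k) \<le> ennreal D"
  shows "admissible d D n (Vn n) (power_kernel n k)"
proof -
  have meas: "(\<lambda>x. ennreal (d (fst x) (snd x))) \<in> borel_measurable (v \<Otimes>\<^sub>M count_space UNIV)"
    using d_meas by (rule measurable_compose) simp
  have "kernel_distortion d n (Vn n) (power_kernel n k) =
      of_nat n * (\<integral>\<^sup>+x. ennreal (d (fst x) (snd x)) \<partial>letter_law k)"
    using kernel_distortion_eq[of "power_kernel n k" n d, OF channel_power[OF k] d_nonneg]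
      nn_integral_power_letters[OF k meas, of n] by simp
  then show ?thesis
    using channel_power[OF k] le by (simp add: admissible_iff mult_left_mono)
qed

lemma admissible_mix:
  assumes k: "admissible d D n (Vn n) k0" "admissible d D n (Vn n) k1" and t: "0 < t" "t < 1"
  shows "admissible d D n (Vn n) (mix_kernel (words n) t k0 k1)"
proof -
  interpret V: discrete_channel "Vn n" "words n :: (nat \<Rightarrow> 'z) set" by (rule discrete_Vn)
  have k': "word_channel n k0" "kernel_distortion d n (Vn n) k0 \<le> of_nat n * ennreal D"
      "word_channel n k1" "kernel_distortion d n (Vn n) k1 \<le> of_nat n * ennreal D"
    using k by (auto simp: admissible_iff)
  have m: "word_channel n (mix_kernel (words n) t k0 k1)"
    by (rule V.channel_mix[OF k'(1,3) t])
  have meas: "(\<lambda>x. \<Sum>i<n. ennreal (d (fst x i) (snd x i))) \<in> borel_measurable (Vn n \<Otimes>\<^sub>M count_space (words n))"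
    using measurable_letters[OF d_meas] by (intro borel_measurable_sum measurable_compose[OF _ measurable_ennreal]) auto
  have "kernel_distortion d n (Vn n) (mix_kernel (words n) t k0 k1) =
      ennreal (1 - t) * kernel_distortion d n (Vn n) k0 + ennreal t * kernel_distortion d n (Vn n) k1"
    using V.nn_integral_mix_law[OF k'(1,3) t meas] kernel_distortion_eq[OF k'(1), of d] d_nonneg
      kernel_distortion_eq[OF k'(3), of d] kernel_distortion_eq[OF m, of d] by simp
  also have "\<dots> \<le> ennreal (1 - t) * (of_nat n * ennreal D) + ennreal t * (of_nat n * ennreal D)"
    using k' by (intro add_mono mult_left_mono) auto
  also have "\<dots> = (ennreal (1 - t) + ennreal t) * (of_nat n * ennreal D)"
    by (rule distrib_right[symmetric])
  also have "ennreal (1 - t) + ennreal t = 1"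
    using t by (simp flip: ennreal_plus)
  finally show ?thesis
    using m by (simp add: admissible_iff)
qed

lemma optimal_info_le:
  assumes Q: "unique_rd_kernel d D n (Vn n) Q" and k: "admissible d D n (Vn n) k"
  shows "channel_info (Vn n) (words n) Q \<le> channel_info (Vn n) (words n) k"
proof -
  have Q': "admissible d D n (Vn n) Q" using Q by (simp add: unique_rd_kernel_def)
  have "kernel_info n (Vn n) Q = rd_block d D n (Vn n)"
    using Q by (simp add: unique_rd_kernel_def)
  also have "\<dots> \<le> kernel_info n (Vn n) k"
    unfolding rd_block_def using k by (intro INF_lower) auto
  finally show ?thesis
    using k Q' by (simp add: admissible_iff kernel_info_eq enn2ereal_divide_le_iff)
qed

text \<open>
  Comparing a block of length \<open>m\<close> with one of length \<open>n\<close> through the averaged letter channel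
  gives \<open>n R\<^sub>m \<le> m R\<^sub>n\<close> for all \<open>m\<close> and \<open>n\<close>, so equality holds throughout.
\<close>

lemma optimal_kernel_is_power:
  assumes Q: "\<And>n. n \<ge> 1 \<Longrightarrow> unique_rd_kernel d D n (Vn n) (Q n)"
    and fin: "channel_info (Vn 1) (words 1) (Q 1) < \<top>" and n: "n \<ge> 1"
  shows "channel_info (Vn n) (words n) (Q n) = of_nat n * channel_info (Vn 1) (words 1) (Q 1)"
    and "AE y in Vn n. Q n y = power_kernel n (avg_kernel v 1 (Q 1)) y"
proof -
  define R where "R n = channel_info (Vn n) (words n) (Q n)" for n
  define \<alpha> where "\<alpha> n = channel_info v UNIV (avg_kernel v n (Q n))" for n
  have adm: "admissible d D n (Vn n) (Q n)" if "n \<ge> 1" for n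
    using Q[OF that] by (simp add: unique_rd_kernel_def)
  have ch: "word_channel n (Q n)" if "n \<ge> 1" for n
    using adm[OF that] by (simp add: admissible_iff)
  have avg: "letter_channel (avg_kernel v n (Q n))" if "n \<ge> 1" for n
    by (rule channel_avg[OF ch[OF that] that])
  \<comment> \<open>Averaging the optimum for length \<open>n\<close> and taking its
    \<open>m\<close>-fold power preserves the distortion constraint per letter; this connects any
    two block lengths.\<close>
  have adm_pow: "admissible d D m (Vn m) (power_kernel m (avg_kernel v n (Q n)))" if "n \<ge> 1" for n m
    by (rule admissible_power[OF avg[OF that] distortion_avg_le[OF adm[OF that] that]])
  have avg_le: "of_nat n * \<alpha> n \<le> R n" if "n \<ge> 1" for n
    unfolding \<alpha>_def R_def by (rule info_avg_le[OF ch[OF that] that])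
  have pow_le: "channel_info (Vn m) (words m) (power_kernel m (avg_kernel v n (Q n))) \<le> of_nat m * \<alpha> n"
    if "n \<ge> 1" "\<alpha> n < \<top>" for n m
    using that unfolding \<alpha>_def by (intro info_power_le avg)
  have R_le: "R m \<le> of_nat m * \<alpha> n" if "n \<ge> 1" "m \<ge> 1" "\<alpha> n < \<top>" for m n
    using optimal_info_le[OF Q[OF that(2)] adm_pow[OF that(1)]] pow_le[OF that(1,3)]
    unfolding R_def by (rule order_trans)
  have \<alpha>1: "\<alpha> 1 \<le> R 1" using avg_le[of 1] by simp
  with fin have \<alpha>1_fin: "\<alpha> 1 < \<top>" by (simp add: R_def)
  have up: "R m \<le> of_nat m * R 1" if "m \<ge> 1" for m
    using R_le[OF _ that \<alpha>1_fin] mult_left_mono[OF \<alpha>1, of "of_nat m"] by auto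
  \<comment> \<open>Only length one is known to be finite; finiteness of \<open>R n\<close>, and
    then of \<open>\<alpha> n\<close>, has to be derived before \<open>R_le\<close> can be used with
    \<open>n\<close>.\<close>
  have "of_nat n * R 1 < \<top>"
    using fin by (simp add: R_def ennreal_mult_less_top of_nat_less_top)
  then have "R n < \<top>"
    by (rule le_less_trans[OF up[OF n]])
  then have "of_nat n * \<alpha> n < \<top>"
    using avg_le[OF n] by (rule le_less_trans[rotated])
  then have "\<alpha> n < \<top>"
    using n by (auto simp: ennreal_mult_less_top)
  \<comment> \<open>The averaged optimum of length \<open>n\<close> competes at length one, which
    gives the lower bound on \<open>R n\<close>.\<close>
  then have "R 1 \<le> \<alpha> n"
    using R_le[OF n, of 1] by simp
  then have "of_nat n * R 1 \<le> R n"
    using avg_le[OF n] by (meson mult_left_mono order_trans zero_le)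
  with up[OF n] have eq: "R n = of_nat n * R 1" by simp
  then show "channel_info (Vn n) (words n) (Q n) = of_nat n * channel_info (Vn 1) (words 1) (Q 1)"
    by (simp add: R_def)
  \<comment> \<open>This product kernel is admissible and costs no more than \<open>Q n\<close>, so
    it is also a minimizer and uniqueness applies.\<close>
  let ?p = "power_kernel n (avg_kernel v 1 (Q 1))"
  have adm_p: "admissible d D n (Vn n) ?p" by (rule adm_pow) simp
  have "channel_info (Vn n) (words n) ?p \<le> of_nat n * \<alpha> 1"
    by (rule pow_le[OF _ \<alpha>1_fin]) simp
  also have "\<dots> \<le> R n"
    unfolding eq using \<alpha>1 by (rule mult_left_mono) simp
  finally have "channel_info (Vn n) (words n) ?p = channel_info (Vn n) (words n) (Q n)"
    using optimal_info_le[OF Q[OF n] adm_p] by (simp add: R_def)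
  then have "kernel_info n (Vn n) ?p = kernel_info n (Vn n) (Q n)"
    using ch[OF n] adm_p by (simp add: kernel_info_eq admissible_iff)
  moreover have "kernel_info n (Vn n) (Q n) = rd_block d D n (Vn n)"
    using Q[OF n] by (simp add: unique_rd_kernel_def)
  ultimately have "AE y in Vn n. ?p y = Q n y"
    using Q[OF n] adm_p by (simp add: unique_rd_kernel_def)
  then show "AE y in Vn n. Q n y = ?p y"
    by eventually_elim simp
qed

end

end

text \<open>
  The side information \<open>f\<close> through which the channel sees \<open>S\<close> plays no role in the
  information quantities, so test functions may depend on all of \<open>S\<close>.
\<close>

lemma expectation_le_of_info_through:
  fixes F :: "'s \<times> 'b \<Rightarrow> real"
  assumes S: "prob_space S" and f: "f \<in> S \<rightarrow>\<^sub>M V0" and Z: "countable Z"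
    and V: "distr S V0 f = V"
    and k: "k0 \<in> V \<rightarrow>\<^sub>M prob_algebra (count_space Z)" "k1 \<in> V \<rightarrow>\<^sub>M prob_algebra (count_space Z)"
    and opt: "\<And>t. 0 < t \<Longrightarrow> t < 1 \<Longrightarrow> channel_info V Z k0 \<le> channel_info V Z (mix_kernel Z t k0 k1)"
    and fin: "channel_info V Z k0 < \<top>" and \<Delta>: "\<Delta> \<ge> 0"
    and le: "channel_info V Z k1 + kl (count_space Z) (out_pmf V k1) (out_pmf V k0) \<le>
      channel_info V Z k0 + ennreal \<Delta>"
    and F: "F \<in> borel_measurable (S \<Otimes>\<^sub>M count_space Z)"
    and bounded: "\<And>x. x \<in> space S \<times> Z \<Longrightarrow> \<bar>F x\<bar> \<le> b"
  shows "(\<integral>x. F x \<partial>kernel_law S (count_space Z) (\<lambda>x. k1 (f x))) \<le>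
    \<Delta> + ln (\<integral>x. exp (F x) \<partial>kernel_law S (count_space Z) (\<lambda>x. k0 (f x)))"
proof -
  interpret S: discrete_channel S Z
    by (intro discrete_channel.intro discrete_channel_axioms.intro S Z)
  have "prob_space V"
    unfolding V[symmetric] by (rule S.prob_space_distr[OF f])
  then interpret V: discrete_channel V Z
    by (intro discrete_channel.intro discrete_channel_axioms.intro Z)
  have sets: "sets V = sets V0" using V by auto
  have k': "k0 \<in> V0 \<rightarrow>\<^sub>M prob_algebra (count_space Z)" "k1 \<in> V0 \<rightarrow>\<^sub>M prob_algebra (count_space Z)"
    using k by (simp_all add: measurable_cong_sets[OF sets refl])
  have mix': "mix_kernel Z t k0 k1 \<in> V0 \<rightarrow>\<^sub>M prob_algebra (count_space Z)" if "0 < t" "t < 1" for t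
    using V.channel_mix[OF k that] by (simp add: measurable_cong_sets[OF sets refl])
  note tr = channel_info_distr[OF S f Z, unfolded V]
  have kl: "kl (count_space Z) (out_pmf V k1) (out_pmf V k0) =
      kl (count_space Z) (out_pmf S (\<lambda>x. k1 (f x))) (out_pmf S (\<lambda>x. k0 (f x)))"
    unfolding kl_def using tr(1)[OF k'(1)] tr(1)[OF k'(2)] by (intro nn_integral_cong) auto
  show ?thesis
  proof (rule S.expectation_le_of_info[OF measurable_compose[OF f k'(1)] measurable_compose[OF f k'(2)] _ _ \<Delta> _ F bounded])
    show "channel_info S Z (\<lambda>x. k0 (f x)) \<le> channel_info S Z (mix_kernel Z t (\<lambda>x. k0 (f x)) (\<lambda>x. k1 (f x)))"
      if "0 < t" "t < 1" for t
      using opt[OF that] unfolding tr(2)[OF k'(1)] tr(2)[OF mix'[OF that]]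
      by (simp add: mix_kernel_def[abs_def])
    show "channel_info S Z (\<lambda>x. k1 (f x)) +
        kl (count_space Z) (out_pmf S (\<lambda>x. k1 (f x))) (out_pmf S (\<lambda>x. k0 (f x))) \<le>
      channel_info S Z (\<lambda>x. k0 (f x)) + ennreal \<Delta>"
      using le unfolding kl tr(2)[OF k'(1)] tr(2)[OF k'(2)] .
    show "channel_info S Z (\<lambda>x. k0 (f x)) < \<top>"
      using fin unfolding tr(2)[OF k'(1)] .
  qed assumption
qed

subsection \<open>Estimation risks\<close>

locale bounded_source =
  fixes P :: "'t::polish_space measure" and MY :: "'y measure" and K :: "'t \<Rightarrow> 'y measure" and B :: real
  assumes prior: "prob_space P" "sets P = sets borel"
    and bounded: "\<And>x y :: 't. dist x y \<le> B"
    and channel: "K \<in> P \<rightarrow>\<^sub>M prob_algebra MY"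
begin

definition pair_law :: "('t \<times> 'y) measure" where
  "pair_law = kernel_law P MY K"

definition obs1 :: "'y measure" where
  "obs1 = distr pair_law MY snd"

abbreviation src :: "nat \<Rightarrow> ((nat \<Rightarrow> 't) \<times> (nat \<Rightarrow> 'y)) measure" where
  "src n \<equiv> source_law P MY K n"

lemma prob_space_pair_law: "prob_space pair_law"
  unfolding pair_law_def by (rule prob_space_kernel_law[OF prior(1) channel])

lemma sets_pair_law [measurable_cong]: "sets pair_law = sets (P \<Otimes>\<^sub>M MY)"
  unfolding pair_law_def by (rule sets_kernel_law[OF prior(1) channel])

lemma sets_obs1 [measurable_cong]: "sets obs1 = sets MY"
  by (simp add: obs1_def)

sublocale memoryless obs1
proof -
  interpret prob_space pair_law by (rule prob_space_pair_law)
  show "memoryless obs1"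
    unfolding obs1_def by (intro memoryless.intro prob_space_distr) measurable
qed

lemma source_law_eq:
  "src n = distr (PiM {..<n} (\<lambda>_. pair_law)) (block n P \<Otimes>\<^sub>M block n MY)
    (\<lambda>\<omega>. (\<lambda>i\<in>{..<n}. fst (\<omega> i), \<lambda>i\<in>{..<n}. snd (\<omega> i)))"
  unfolding source_law_def pair_law_def by (rule kernel_law_PiM[OF _ prior(1) channel]) simp

lemma sets_src [measurable_cong]: "sets (src n) = sets (block n P \<Otimes>\<^sub>M block n MY)"
  by (simp add: source_law_eq)

lemma measurable_unzip_pair [measurable]:
  "(\<lambda>\<omega>. (\<lambda>i\<in>{..<n}. fst (\<omega> i), \<lambda>i\<in>{..<n}. snd (\<omega> i))) \<in>
    PiM {..<n} (\<lambda>_. pair_law) \<rightarrow>\<^sub>M block n P \<Otimes>\<^sub>M block n MY"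
  by measurable

lemma prob_space_src: "prob_space (src n)"
proof -
  have "prob_space (PiM {..<n} (\<lambda>_. pair_law))" by (intro prob_space_PiM prob_space_pair_law)
  then show ?thesis unfolding source_law_eq by (rule prob_space.prob_space_distr) measurable
qed

lemma obs_law_eq: "obs_law P MY K n = Vn n"
proof -
  have "obs_law P MY K n = distr (PiM {..<n} (\<lambda>_. pair_law)) (block n MY) (compose {..<n} snd)"
    unfolding obs_law_def source_law_eq
    by (subst distr_distr) (auto simp: comp_def compose_def intro!: distr_cong)
  also have "\<dots> = distr (PiM {..<n} (\<lambda>_. pair_law)) (Vn n) (compose {..<n} snd)"
    by (intro distr_cong refl sets_PiM_cong) (simp_all add: sets_obs1)
  also have "\<dots> = PiM {..<n} (\<lambda>i. distr pair_law obs1 snd)"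
    using prob_space_pair_law prob_space_axioms by (intro distr_PiM_finite_prob_space') auto
  also have "distr pair_law obs1 snd = obs1"
    by (subst (2) obs1_def) (intro distr_cong refl sets_obs1)
  finally show ?thesis .
qed

lemma distr_src_snd: "distr (src n) (block n MY) snd = Vn n"
  using obs_law_eq[of n] by (simp add: obs_law_def)

lemma discrete_src: "discrete_channel (src n) (words n :: (nat \<Rightarrow> 'z::countable) set)"
  by (intro discrete_channel.intro discrete_channel_axioms.intro prob_space_src countable_words)

lemma sets_Vn: "sets (Vn n) = sets (block n MY)"
  by (intro sets_PiM_cong refl sets_obs1)

lemma src_channel:
  assumes "word_channel n (k :: _ \<Rightarrow> (nat \<Rightarrow> 'z::countable) measure)"
  shows "(\<lambda>x. k (snd x)) \<in> src n \<rightarrow>\<^sub>M prob_algebra (count_space (words n))"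
proof -
  have "k \<in> block n MY \<rightarrow>\<^sub>M prob_algebra (count_space (words n))"
    using assms by (simp add: measurable_cong_sets[OF sets_Vn refl])
  then show ?thesis by (rule measurable_compose[rotated]) measurable
qed

lemma full_law_eq: "full_law n S k = kernel_law S (count_space (words n)) (\<lambda>x. k (snd x))"
  by (simp add: full_law_def zblock_eq)

text \<open>The optimal kernel is identified up to a null set of source blocks; joint laws, and
  therefore risks, do not see the difference.\<close>

lemma full_law_cong:
  assumes "word_channel n k" "word_channel n k'" and ae: "AE y in Vn n. k y = k' y"
  shows "full_law n (src n) k = full_law n (src n) k'"
  unfolding full_law_eq
proof (rule kernel_law_cong_AE[OF prob_space_src src_channel src_channel])
  have "AE y in distr (src n) (block n MY) snd. k y = k' y"
    using ae by (subst distr_src_snd)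
  then show "AE x in src n. k (snd x) = k' (snd x)"
    by (rule AE_distrD[rotated]) measurable
qed (use assms in auto)

definition letter_joint :: "('y \<Rightarrow> 'z::countable measure) \<Rightarrow> (('t \<times> 'y) \<times> 'z) measure" where
  "letter_joint \<kappa> = kernel_law pair_law (count_space UNIV) (\<lambda>x. \<kappa> (snd x))"

definition letter_risk :: "('y \<Rightarrow> 'z::countable measure) \<Rightarrow> ('z \<Rightarrow> 't) \<Rightarrow> real" where
  "letter_risk \<kappa> \<phi> = (\<integral>x. dist (fst (fst x)) (\<phi> (snd x)) \<partial>letter_joint \<kappa>)"

context
  fixes \<kappa> :: "'y \<Rightarrow> 'z::countable measure"
  assumes \<kappa>: "letter_channel \<kappa>"
begin

lemma pair_channel: "(\<lambda>x. \<kappa> (snd x)) \<in> pair_law \<rightarrow>\<^sub>M prob_algebra (count_space UNIV)"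
proof -
  have "\<kappa> \<in> MY \<rightarrow>\<^sub>M prob_algebra (count_space UNIV)"
    using \<kappa> by (simp add: measurable_cong_sets[OF sets_obs1 refl])
  then show ?thesis by (rule measurable_compose[rotated]) measurable
qed

lemma prob_space_letter_joint: "prob_space (letter_joint \<kappa>)"
  unfolding letter_joint_def by (rule prob_space_kernel_law[OF prob_space_pair_law pair_channel])

lemma sets_letter_joint: "sets (letter_joint \<kappa>) = sets ((P \<Otimes>\<^sub>M MY) \<Otimes>\<^sub>M count_space UNIV)"
  unfolding letter_joint_def sets_kernel_law[OF prob_space_pair_law pair_channel]
  by (intro sets_pair_measure_cong refl sets_pair_law)

text \<open>The pairs \<open>(\<theta>\<^sub>i, Y\<^sub>i)\<close> are i.i.d. and the kernel acts
  letterwise on them, so a further use of \<open>kernel_law_PiM\<close> makes the triples i.i.d.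
  This is the product space on which the loss concentrates.\<close>

lemma full_law_power:
  "full_law n (src n) (power_kernel n \<kappa>) = distr (PiM {..<n} (\<lambda>_. letter_joint \<kappa>))
    (src n \<Otimes>\<^sub>M count_space (words n))
    (\<lambda>\<omega>. ((\<lambda>i\<in>{..<n}. fst (fst (\<omega> i)), \<lambda>i\<in>{..<n}. snd (fst (\<omega> i))), \<lambda>i\<in>{..<n}. snd (\<omega> i)))"
proof -
  let ?PT = "PiM {..<n} (\<lambda>_. letter_joint \<kappa>)" and ?Ps = "PiM {..<n} (\<lambda>_. pair_law)"
  let ?u = "\<lambda>\<omega> :: nat \<Rightarrow> 't \<times> 'y. (\<lambda>i\<in>{..<n}. fst (\<omega> i), \<lambda>i\<in>{..<n}. snd (\<omega> i))"
  note [measurable_cong] = sets_letter_joint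
  interpret Ps: prob_space ?Ps by (intro prob_space_PiM prob_space_pair_law)
  have pk: "power_kernel n \<kappa> \<in> block n MY \<rightarrow>\<^sub>M prob_algebra (zblock n)"
    using channel_power[OF \<kappa>, of n] by (simp add: zblock_eq measurable_cong_sets[OF sets_Vn refl])
  have pk': "(\<lambda>x. power_kernel n \<kappa> (snd x)) \<in> block n P \<Otimes>\<^sub>M block n MY \<rightarrow>\<^sub>M prob_algebra (zblock n)"
    by (rule measurable_compose[OF measurable_snd pk])
  have eq: "power_kernel n \<kappa> (snd (?u \<omega>)) = PiM {..<n} (\<lambda>i. \<kappa> (snd (\<omega> i)))" for \<omega>
    unfolding power_kernel_def by (intro PiM_cong) auto
  have law: "kernel_law ?Ps (zblock n) (\<lambda>\<omega>. PiM {..<n} (\<lambda>i. \<kappa> (snd (\<omega> i)))) =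
      distr ?PT (?Ps \<Otimes>\<^sub>M zblock n) (\<lambda>\<omega>. (\<lambda>i\<in>{..<n}. fst (\<omega> i), \<lambda>i\<in>{..<n}. snd (\<omega> i)))"
    unfolding letter_joint_def by (rule kernel_law_PiM[OF _ prob_space_pair_law pair_channel]) simp
  have "full_law n (src n) (power_kernel n \<kappa>) =
      distr (kernel_law ?Ps (zblock n) (\<lambda>\<omega>. power_kernel n \<kappa> (snd (?u \<omega>))))
        ((block n P \<Otimes>\<^sub>M block n MY) \<Otimes>\<^sub>M zblock n) (\<lambda>(a, b). (?u a, b))"
    unfolding full_law_def source_law_eq
    by (rule kernel_law_distr[OF Ps.prob_space_axioms measurable_unzip_pair pk'])
  also have "\<dots> = distr ?PT ((block n P \<Otimes>\<^sub>M block n MY) \<Otimes>\<^sub>M zblock n)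
      ((\<lambda>(a, b). (?u a, b)) \<circ> (\<lambda>\<omega>. (\<lambda>i\<in>{..<n}. fst (\<omega> i), \<lambda>i\<in>{..<n}. snd (\<omega> i))))"
    unfolding eq law by (rule distr_distr) measurable
  also have "\<dots> = distr ?PT (src n \<Otimes>\<^sub>M count_space (words n))
    (\<lambda>\<omega>. ((\<lambda>i\<in>{..<n}. fst (fst (\<omega> i)), \<lambda>i\<in>{..<n}. snd (fst (\<omega> i))), \<lambda>i\<in>{..<n}. snd (\<omega> i)))"
    by (intro distr_cong refl)
       (auto simp: zblock_eq sets_src intro!: sets_pair_measure_cong ext)
  finally show ?thesis .
qed

end

text \<open>Left unnormalised, so that changing one triple can alter it by an amount bounded
  independently of \<open>n\<close>.\<close>

definition loss :: "nat \<Rightarrow> (nat \<Rightarrow> (nat \<Rightarrow> 'z) \<Rightarrow> 't) \<Rightarrow> ((nat \<Rightarrow> 't) \<times> (nat \<Rightarrow> 'y)) \<times> (nat \<Rightarrow> 'z) \<Rightarrow> real" where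
  "loss n g \<omega> = (\<Sum>i<n. dist (fst (fst \<omega>) i) (g i (snd \<omega>)))"

text \<open>The words are countable, so measurability is checked for one word at a time, where the
  estimate \<open>h z\<close> is a constant.\<close>

lemma measurable_dist_coord:
  assumes "i < n"
  shows "(\<lambda>\<omega>. dist (fst (fst \<omega>) i) (h (snd \<omega>))) \<in>
    borel_measurable (src n \<Otimes>\<^sub>M count_space (words n :: (nat \<Rightarrow> 'z::countable) set))"
proof (rule measurable_pair_countable2[OF countable_words])
  fix z :: "nat \<Rightarrow> 'z"
  have i: "i \<in> {..<n}" using assms by simp
  have "(\<lambda>x. fst x i) \<in> src n \<rightarrow>\<^sub>M P"
    using i by measurable
  then have [measurable]: "(\<lambda>x. fst x i) \<in> borel_measurable (src n)"
    by (simp add: measurable_cong_sets[OF refl prior(2)])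
  show "(\<lambda>x. dist (fst (fst (x, z)) i) (h (snd (x, z)))) \<in> borel_measurable (src n)"
    by simp
qed

lemma measurable_loss:
  "loss n g \<in> borel_measurable (src n \<Otimes>\<^sub>M count_space (words n :: (nat \<Rightarrow> 'z::countable) set))"
  unfolding loss_def using measurable_dist_coord by (intro borel_measurable_sum) auto

lemma B_nonneg: "B \<ge> 0"
  using bounded[of undefined undefined] by simp

lemma loss_bounds: "0 \<le> loss n g \<omega>" "loss n g \<omega> \<le> real n * B"
proof -
  show "0 \<le> loss n g \<omega>" unfolding loss_def by (intro sum_nonneg) auto
  have "loss n g \<omega> \<le> (\<Sum>i<n. B)" unfolding loss_def by (intro sum_mono bounded)
  then show "loss n g \<omega> \<le> real n * B" by simp
qed

lemma sum_coord_risk: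
  assumes k: "word_channel n (k :: _ \<Rightarrow> (nat \<Rightarrow> 'z::countable) measure)"
  shows "(\<Sum>i<n. coord_risk n (src n) k i (g i)) = (\<integral>\<omega>. loss n g \<omega> \<partial>full_law n (src n) k)"
proof -
  interpret S: discrete_channel "src n" "words n :: (nat \<Rightarrow> 'z) set" by (rule discrete_src)
  have "integrable (full_law n (src n) k) (\<lambda>\<omega>. dist (fst (fst \<omega>) i) (g i (snd \<omega>)))" if "i < n" for i
    unfolding full_law_eq using bounded
    by (intro S.integrable_channel_law_bounded[OF src_channel[OF k] measurable_dist_coord[OF that], where b = B]) auto
  then show ?thesis
    unfolding coord_risk_def loss_def by (intro Bochner_Integration.integral_sum[symmetric]) auto
qed

lemma measurable_unzip_joint:
  assumes \<kappa>: "letter_channel (\<kappa> :: _ \<Rightarrow> 'z::countable measure)"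
  shows "(\<lambda>\<omega>. ((\<lambda>i\<in>{..<n}. fst (fst (\<omega> i)), \<lambda>i\<in>{..<n}. snd (fst (\<omega> i))), \<lambda>i\<in>{..<n}. snd (\<omega> i))) \<in>
    PiM {..<n} (\<lambda>_. letter_joint \<kappa>) \<rightarrow>\<^sub>M src n \<Otimes>\<^sub>M count_space (words n)"
proof -
  note [measurable_cong] = sets_letter_joint[OF \<kappa>]
  show ?thesis unfolding zblock_eq[symmetric] by measurable
qed

lemma integral_full_law_power:
  fixes F :: "((nat \<Rightarrow> 't) \<times> (nat \<Rightarrow> 'y)) \<times> (nat \<Rightarrow> 'z::countable) \<Rightarrow> real"
  assumes \<kappa>: "letter_channel \<kappa>"
    and F: "F \<in> borel_measurable (src n \<Otimes>\<^sub>M count_space (words n))"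
  shows "(\<integral>\<omega>. F \<omega> \<partial>full_law n (src n) (power_kernel n \<kappa>)) =
    (\<integral>\<omega>. F ((\<lambda>i\<in>{..<n}. fst (fst (\<omega> i)), \<lambda>i\<in>{..<n}. snd (fst (\<omega> i))), \<lambda>i\<in>{..<n}. snd (\<omega> i))
      \<partial>PiM {..<n} (\<lambda>_. letter_joint \<kappa>))"
  unfolding full_law_power[OF \<kappa>] by (rule integral_distr[OF measurable_unzip_joint[OF \<kappa>] F])

lemma measurable_letter_dist:
  assumes \<kappa>: "letter_channel (\<kappa> :: _ \<Rightarrow> 'z::countable measure)"
  shows "(\<lambda>x. dist (fst (fst x)) (\<phi> (snd x))) \<in> borel_measurable (letter_joint \<kappa>)"
proof -
  have "(\<lambda>x. dist (fst (fst x)) (\<phi> (snd x))) \<in> borel_measurable ((P \<Otimes>\<^sub>M MY) \<Otimes>\<^sub>M count_space UNIV)"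
  proof (rule measurable_pair_countable2)
    fix z
    have "fst \<in> P \<Otimes>\<^sub>M MY \<rightarrow>\<^sub>M P" by simp
    then have [measurable]: "fst \<in> borel_measurable (P \<Otimes>\<^sub>M MY)"
      by (simp add: measurable_cong_sets[OF refl prior(2)])
    show "(\<lambda>x. dist (fst (fst (x, z))) (\<phi> (snd (x, z)))) \<in> borel_measurable (P \<Otimes>\<^sub>M MY)"
      by simp
  qed simp
  then show ?thesis by (simp add: measurable_cong_sets[OF sets_letter_joint[OF \<kappa>] refl])
qed

lemma coord_risk_power_letter:
  assumes \<kappa>: "letter_channel (\<kappa> :: _ \<Rightarrow> 'z::countable measure)" and i: "i < n"
  shows "coord_risk n (src n) (power_kernel n \<kappa>) i (\<lambda>z. \<phi> (z i)) = letter_risk \<kappa> \<phi>"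
proof -
  interpret T: product_prob_space "\<lambda>_. letter_joint \<kappa>" "{..<n}"
    by (intro product_prob_spaceI prob_space_letter_joint[OF \<kappa>])
  have "coord_risk n (src n) (power_kernel n \<kappa>) i (\<lambda>z. \<phi> (z i)) =
      (\<integral>\<omega>. dist (fst (fst (\<omega> i))) (\<phi> (snd (\<omega> i))) \<partial>PiM {..<n} (\<lambda>_. letter_joint \<kappa>))"
    unfolding coord_risk_def using i
    by (subst integral_full_law_power[OF \<kappa> measurable_dist_coord[OF i]]) auto
  also have "\<dots> = (\<integral>x. dist (fst (fst x)) (\<phi> (snd x))
      \<partial>distr (PiM {..<n} (\<lambda>_. letter_joint \<kappa>)) (letter_joint \<kappa>) (\<lambda>\<omega>. \<omega> i))"
    using i by (intro integral_distr[symmetric] measurable_letter_dist[OF \<kappa>] measurable_component_singleton) auto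
  also have "distr (PiM {..<n} (\<lambda>_. letter_joint \<kappa>)) (letter_joint \<kappa>) (\<lambda>\<omega>. \<omega> i) = letter_joint \<kappa>"
    using i by (intro T.PiM_component) auto
  finally show ?thesis by (simp add: letter_risk_def)
qed

lemma letter_risk_nonneg: "letter_risk \<kappa> \<phi> \<ge> 0"
  unfolding letter_risk_def by (intro integral_nonneg_AE) auto

lemma letter_risk_le:
  assumes "letter_channel (\<kappa> :: _ \<Rightarrow> 'z::countable measure)"
  shows "letter_risk \<kappa> \<phi> \<le> B"
proof -
  interpret L: prob_space "letter_joint \<kappa>" by (rule prob_space_letter_joint[OF assms])
  have "letter_risk \<kappa> \<phi> \<le> (\<integral>x. B \<partial>letter_joint \<kappa>)"
    unfolding letter_risk_def using bounded B_nonneg by (intro integral_mono') auto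
  then show ?thesis by (simp add: L.prob_space)
qed

text \<open>The triples other than the \<open>i\<close>-th are independent of it. With them frozen,
  the block estimate is a function of the single letter \<open>Z\<^sub>i\<close>, so the inner
  integral is a letter risk and cannot fall below the infimum.\<close>

lemma coord_risk_power_ge:
  assumes \<kappa>: "letter_channel (\<kappa> :: _ \<Rightarrow> 'z::countable measure)" and i: "i < n"
  shows "coord_risk n (src n) (power_kernel n \<kappa>) i g \<ge> (INF \<phi>. letter_risk \<kappa> \<phi>)"
proof -
  let ?T = "letter_joint \<kappa>"
  let ?F = "\<lambda>\<omega>. dist (fst (fst (\<omega> i))) (g (\<lambda>j\<in>{..<n}. snd (\<omega> j)))"
  interpret L: prob_space ?T by (rule prob_space_letter_joint[OF \<kappa>])
  interpret T: product_prob_space "\<lambda>_. ?T" UNIV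
    by (intro product_prob_spaceI prob_space_letter_joint[OF \<kappa>])
  let ?I = "{..<n} - {i}"
  interpret PI: prob_space "PiM ?I (\<lambda>_. ?T)" by (intro prob_space_PiM prob_space_letter_joint[OF \<kappa>])
  interpret PN: prob_space "PiM {..<n} (\<lambda>_. ?T)" by (intro prob_space_PiM prob_space_letter_joint[OF \<kappa>])
  have ins: "{..<n} = insert i ?I" using i by auto
  have m: "?F \<in> borel_measurable (PiM {..<n} (\<lambda>_. ?T))"
    using measurable_compose[OF measurable_unzip_joint[OF \<kappa>] measurable_dist_coord[OF i, of g]] i by simp
  have int: "integrable (PiM {..<n} (\<lambda>_. ?T)) ?F"
    using m bounded by (intro PN.integrable_const_bound[where B = B]) auto
  define H where "H x = (\<integral>u. ?F (x(i := u)) \<partial>?T)" for x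
  have H_eq: "H x = letter_risk \<kappa> (\<lambda>a. g (\<lambda>j\<in>{..<n}. if j = i then a else snd (x j)))" for x
  proof -
    have "(\<lambda>j\<in>{..<n}. snd ((x(i := u)) j)) = (\<lambda>j\<in>{..<n}. if j = i then snd u else snd (x j))" for u
      by auto
    then show ?thesis unfolding H_def letter_risk_def by simp
  qed
  have H_meas: "H \<in> borel_measurable (PiM ?I (\<lambda>_. ?T))"
  proof -
    have "(\<lambda>(x, u). x(i := u)) \<in> PiM ?I (\<lambda>_. ?T) \<Otimes>\<^sub>M ?T \<rightarrow>\<^sub>M PiM {..<n} (\<lambda>_. ?T)"
      using measurable_add_dim[of i ?I "\<lambda>_. ?T"] by (simp only: ins[symmetric])
    from measurable_compose[OF this m]
    have "(\<lambda>(x, u). ?F (x(i := u))) \<in> borel_measurable (PiM ?I (\<lambda>_. ?T) \<Otimes>\<^sub>M ?T)"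
      by (simp only: case_prod_unfold)
    then show ?thesis
      unfolding H_def by (rule L.borel_measurable_lebesgue_integral)
  qed
  have "coord_risk n (src n) (power_kernel n \<kappa>) i g = (\<integral>\<omega>. ?F \<omega> \<partial>PiM {..<n} (\<lambda>_. ?T))"
    unfolding coord_risk_def using i
    by (subst integral_full_law_power[OF \<kappa> measurable_dist_coord[OF i]]) auto
  also have "\<dots> = (\<integral>x. H x \<partial>PiM ?I (\<lambda>_. ?T))"
    using T.product_integral_insert[of ?I i ?F] int unfolding ins[symmetric] H_def by simp
  also have "\<dots> \<ge> (\<integral>x. (INF \<phi>. letter_risk \<kappa> \<phi>) \<partial>PiM ?I (\<lambda>_. ?T))"
  proof (rule integral_mono')
    have "\<bar>H x\<bar> \<le> B" for x
      unfolding H_eq by (simp add: letter_risk_nonneg letter_risk_le[OF \<kappa>])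
    then show "integrable (PiM ?I (\<lambda>_. ?T)) H"
      using H_meas by (intro PI.integrable_const_bound[where B = B]) auto
    show "H x \<ge> (INF \<phi>. letter_risk \<kappa> \<phi>)" for x
      unfolding H_eq using letter_risk_nonneg by (intro cINF_lower bdd_belowI2[where m = 0]) auto
    show "0 \<le> H x" for x
      unfolding H_eq by (rule letter_risk_nonneg)
  qed
  finally show ?thesis by (simp add: PI.prob_space)
qed

text \<open>The risk is a sum over the values \<open>z\<close> of the observed letter, and on each
  event the estimate is constant. Conditional minimality compares the terms of positive probability;
  the others are 0.\<close>

lemma letter_risk_bayes:
  assumes \<kappa>: "letter_channel (\<kappa> :: _ \<Rightarrow> 'z::countable measure)" and i: "i < n"
    and bayes: "bayes_estimator n (src n) (power_kernel n \<kappa>) i \<phi>B"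
  shows "letter_risk \<kappa> \<phi>B \<le> letter_risk \<kappa> \<phi>"
proof -
  interpret S: discrete_channel "src n" "words n :: (nat \<Rightarrow> 'z) set" by (rule discrete_src)
  note ch = src_channel[OF channel_power[OF \<kappa>, of n]]
  define J where "J = full_law n (src n) (power_kernel n \<kappa>)"
  interpret J: prob_space J
    unfolding J_def full_law_eq by (rule prob_space_kernel_law[OF prob_space_src ch])
  have sets_J: "sets J = sets (src n \<Otimes>\<^sub>M count_space (words n))"
    unfolding J_def full_law_eq by (rule sets_kernel_law[OF prob_space_src ch])
  define E where "E z = {\<omega>\<in>space J. snd \<omega> i = z}" for z
  have coord: "(\<lambda>\<omega>. snd \<omega> i) \<in> J \<rightarrow>\<^sub>M count_space UNIV"
  proof -
    have "(\<lambda>\<omega>. snd \<omega> i) \<in> src n \<Otimes>\<^sub>M count_space (words n) \<rightarrow>\<^sub>M count_space (UNIV :: 'z set)"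
      by (rule measurable_pair_countable2[OF countable_words]) auto
    then show ?thesis by (simp add: measurable_cong_sets[OF sets_J refl])
  qed
  have E[measurable]: "E z \<in> sets J" for z
    using measurable_sets[OF coord, of "{z}"] by (simp add: E_def vimage_def Int_def conj_commute)
  have dist_meas[measurable]: "(\<lambda>\<omega>. dist (fst (fst \<omega>) i) t) \<in> borel_measurable J" for t
    using measurable_dist_coord[OF i, of "\<lambda>_. t"] by (simp add: measurable_cong_sets[OF sets_J refl])
  \<comment> \<open>The conditional risk without its normalisation, hence defined also on null
    events.\<close>
  define A where "A z t = (\<integral>\<omega>. indicator (E z) \<omega> * dist (fst (fst \<omega>) i) t \<partial>J)" for z t
  have int: "integrable J (\<lambda>\<omega>. indicator (E z) \<omega> * dist (fst (fst \<omega>) i) t)" for z t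
    using bounded B_nonneg by (intro J.integrable_const_bound[where B = B]) (auto split: split_indicator)
  have A_le: "A z (\<phi>B z) \<le> A z (\<phi> z)" for z
  proof (cases "measure J (E z) > 0")
    case True
    have unif: "(\<integral>\<omega>. dist (fst (fst \<omega>) i) t \<partial>uniform_measure J (E z)) = A z t / measure J (E z)" for t
    proof -
      have "1 / ennreal (measure J (E z)) = ennreal (1 / measure J (E z))"
        using divide_ennreal[of 1 "measure J (E z)"] True by simp
      then have "uniform_measure J (E z) = density J (\<lambda>\<omega>. ennreal (indicator (E z) \<omega> / measure J (E z)))"
        unfolding uniform_measure_def
        by (intro arg_cong[where f = "density J"] ext)
           (auto simp: J.emeasure_eq_measure split: split_indicator)
      then have "(\<integral>\<omega>. dist (fst (fst \<omega>) i) t \<partial>uniform_measure J (E z)) =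
          (\<integral>\<omega>. indicator (E z) \<omega> / measure J (E z) * dist (fst (fst \<omega>) i) t \<partial>J)"
        by (simp add: integral_real_density)
      then show ?thesis by (simp add: A_def)
    qed
    have "\<not> (\<integral>\<omega>. dist (fst (fst \<omega>) i) (\<phi> z) \<partial>uniform_measure J (E z)) <
        (\<integral>\<omega>. dist (fst (fst \<omega>) i) (\<phi>B z) \<partial>uniform_measure J (E z))"
      using bayes True unfolding bayes_estimator_def Let_def is_arg_min_def J_def[symmetric] E_def by blast
    then show ?thesis
      unfolding unif using True by (simp add: not_less divide_le_cancel)
  next
    case False
    then have "measure J (E z) = 0" using measure_nonneg[of J "E z"] by linarith
    then have "AE \<omega> in J. \<omega> \<notin> E z"
      by (simp add: J.emeasure_eq_measure AE_iff_null_sets[OF E, symmetric] null_setsI)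
    then have "A z t = 0" for t
      unfolding A_def by (intro integral_eq_zero_AE) (auto split: split_indicator)
    then show ?thesis by simp
  qed
  have risk: "ennreal (letter_risk \<kappa> \<psi>) = (\<integral>\<^sup>+z. ennreal (A z (\<psi> z)) \<partial>count_space UNIV)" for \<psi>
  proof -
    interpret JN: discrete_channel J "UNIV :: 'z set"
      by (intro discrete_channel.intro discrete_channel_axioms.intro J.prob_space_axioms) auto
    have m: "(\<lambda>\<omega>. dist (fst (fst \<omega>) i) (\<psi> (snd \<omega> i))) \<in> borel_measurable J"
      using measurable_dist_coord[OF i, of "\<lambda>z. \<psi> (z i)"] by (simp add: measurable_cong_sets[OF sets_J refl])
    have "letter_risk \<kappa> \<psi> = (\<integral>\<omega>. dist (fst (fst \<omega>) i) (\<psi> (snd \<omega> i)) \<partial>J)"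
      using coord_risk_power_letter[OF \<kappa> i, of \<psi>] by (simp add: coord_risk_def J_def)
    moreover have "integrable J (\<lambda>\<omega>. dist (fst (fst \<omega>) i) (\<psi> (snd \<omega> i)))"
      using m bounded by (intro J.integrable_const_bound[where B = B]) auto
    ultimately have "ennreal (letter_risk \<kappa> \<psi>) = (\<integral>\<^sup>+\<omega>. ennreal (dist (fst (fst \<omega>) i) (\<psi> (snd \<omega> i))) \<partial>J)"
      by (simp add: nn_integral_eq_integral)
    \<comment> \<open>Each outcome lies in exactly one event \<open>E z\<close>, so the inner sum
      has a single nonzero term.\<close>
    also have "\<dots> = (\<integral>\<^sup>+\<omega>. (\<integral>\<^sup>+z. ennreal (indicator (E z) \<omega> * dist (fst (fst \<omega>) i) (\<psi> z)) \<partial>count_space UNIV) \<partial>J)"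
    proof (rule nn_integral_cong)
      fix \<omega> assume "\<omega> \<in> space J"
      then have "(\<integral>\<^sup>+z. ennreal (indicator (E z) \<omega> * dist (fst (fst \<omega>) i) (\<psi> z)) \<partial>count_space UNIV) =
          (\<integral>\<^sup>+z. ennreal (dist (fst (fst \<omega>) i) (\<psi> (snd \<omega> i))) * indicator {snd \<omega> i} z \<partial>count_space UNIV)"
        by (intro nn_integral_cong) (auto simp: E_def split: split_indicator)
      then show "ennreal (dist (fst (fst \<omega>) i) (\<psi> (snd \<omega> i))) =
          (\<integral>\<^sup>+z. ennreal (indicator (E z) \<omega> * dist (fst (fst \<omega>) i) (\<psi> z)) \<partial>count_space UNIV)"
        by simp
    qed
    also have "\<dots> = (\<integral>\<^sup>+z. (\<integral>\<^sup>+\<omega>. ennreal (indicator (E z) \<omega> * dist (fst (fst \<omega>) i) (\<psi> z)) \<partial>J) \<partial>count_space UNIV)"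
    proof (rule JN.VN.Fubini'[symmetric])
      show "(\<lambda>(\<omega>, z). ennreal (indicator (E z) \<omega> * dist (fst (fst \<omega>) i) (\<psi> z))) \<in>
          borel_measurable (J \<Otimes>\<^sub>M count_space UNIV)"
        by (rule JN.measurable_count_snd) simp
    qed
    also have "\<dots> = (\<integral>\<^sup>+z. ennreal (A z (\<psi> z)) \<partial>count_space UNIV)"
      unfolding A_def using int by (intro nn_integral_cong nn_integral_eq_integral) auto
    finally show ?thesis .
  qed
  have "ennreal (letter_risk \<kappa> \<phi>B) \<le> ennreal (letter_risk \<kappa> \<phi>)"
    unfolding risk using A_le by (intro nn_integral_mono ennreal_leI)
  then show ?thesis by (simp add: ennreal_le_iff letter_risk_nonneg)
qed

end

section \<open>Transfer of the risk from the optimal kernel to the codes\<close>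

text \<open>The order of choices is what matters: \<open>t\<close> is fixed by the target accuracy,
  and only then does \<open>n\<close> grow to absorb the factor \<open>1 / t\<close>.\<close>

lemma tendsto_zero_tradeoff:
  fixes x \<delta> :: "nat \<Rightarrow> real"
  assumes \<delta>: "\<delta> \<longlonglongrightarrow> 0" and k: "k \<ge> 0" and x: "\<And>n. x n \<ge> 0"
    and le: "\<And>t. t > 0 \<Longrightarrow> \<forall>\<^sub>F n in sequentially. x n \<le> \<delta> n / t + t * k"
  shows "x \<longlonglongrightarrow> 0"
proof (rule order_tendstoI)
  fix \<epsilon> :: real assume \<epsilon>: "0 < \<epsilon>"
  \<comment> \<open>Half of the accuracy goes to each term; \<open>k + 1\<close> keeps the
    denominator positive when \<open>k = 0\<close>.\<close>
  define t where "t = \<epsilon> / (2 * (k + 1))"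
  have t: "t > 0" using \<epsilon> k by (simp add: t_def)
  have tk: "t * k \<le> \<epsilon> / 2"
    using \<epsilon> k by (simp add: t_def field_simps)
  have "\<forall>\<^sub>F n in sequentially. \<delta> n < t * (\<epsilon> / 2)"
    using order_tendstoD(2)[OF \<delta>, of "t * (\<epsilon> / 2)"] t \<epsilon> by simp
  then show "\<forall>\<^sub>F n in sequentially. x n < \<epsilon>"
    using le[OF t]
  proof eventually_elim
    case (elim n)
    then have "\<delta> n / t < \<epsilon> / 2"
      using t by (simp add: pos_divide_less_eq mult.commute)
    with elim(2) tk show "x n < \<epsilon>" by linarith
  qed
next
  fix a :: real assume "a < 0"
  then show "\<forall>\<^sub>F n in sequentially. a < x n"
    using x by (intro always_eventually allI) (meson less_le_trans)
qed

context bounded_source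
begin

text \<open>Changing one triple changes one parameter, which affects a single summand by at most
  \<open>B\<close>, and one output letter, which moves all estimates together by at most
  \<open>c\<close>.\<close>

lemma loss_bounded_differences:
  fixes g :: "nat \<Rightarrow> (nat \<Rightarrow> 'z) \<Rightarrow> 't" and x :: "nat \<Rightarrow> ('t \<times> 'y) \<times> 'z"
  fixes n :: nat
  defines "G \<equiv> \<lambda>x. loss n g ((\<lambda>i\<in>{..<n}. fst (fst (x i)), \<lambda>i\<in>{..<n}. snd (fst (x i)) :: 'y), \<lambda>i\<in>{..<n}. snd (x i))"
  assumes i: "i < n"
    and stable: "\<And>z a. z \<in> words n \<Longrightarrow> (\<Sum>j<n. dist (g j (z(i := a))) (g j z)) \<le> c"
  shows "\<bar>G (x(i := u)) - G x\<bar> \<le> B + c"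
proof -
  let ?z = "\<lambda>j\<in>{..<n}. snd (x j)" and ?z' = "\<lambda>j\<in>{..<n}. snd ((x(i := u)) j)"
  let ?t = "\<lambda>j. fst (fst (x j))" and ?t' = "\<lambda>j. fst (fst ((x(i := u)) j))"
  have z': "?z' = ?z(i := snd u)" using i by (auto simp: fun_eq_iff)
  have G: "G x = (\<Sum>j<n. dist (fst (fst (x j))) (g j (\<lambda>j\<in>{..<n}. snd (x j))))" for x
    unfolding G_def loss_def by simp
  have "\<bar>G (x(i := u)) - G x\<bar> = \<bar>\<Sum>j<n. dist (?t' j) (g j ?z') - dist (?t j) (g j ?z)\<bar>"
    unfolding G sum_subtractf ..
  also have "\<dots> \<le> (\<Sum>j<n. \<bar>dist (?t' j) (g j ?z') - dist (?t j) (g j ?z)\<bar>)"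
    by (rule sum_abs)
  also have "\<dots> \<le> (\<Sum>j<n. (if j = i then B else 0) + dist (g j ?z') (g j ?z))"
  proof (rule sum_mono)
    fix j
    have "\<bar>dist (?t' j) (g j ?z') - dist (?t j) (g j ?z)\<bar> \<le> dist (?t' j) (?t j) + dist (g j ?z') (g j ?z)"
      using dist_triangle[of "?t' j" "g j ?z'" "?t j"] dist_triangle[of "?t j" "g j ?z'" "g j ?z"]
        dist_triangle[of "?t j" "g j ?z" "?t' j"] dist_triangle[of "?t' j" "g j ?z" "g j ?z'"]
      by (simp add: dist_commute abs_le_iff)
    moreover have "dist (?t' j) (?t j) \<le> (if j = i then B else 0)"
      using bounded by auto
    ultimately show "\<bar>dist (?t' j) (g j ?z') - dist (?t j) (g j ?z)\<bar> \<le>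
        (if j = i then B else 0) + dist (g j ?z') (g j ?z)" by linarith
  qed
  also have "\<dots> = B + (\<Sum>j<n. dist (g j ?z') (g j ?z))"
    using i by (simp add: sum.distrib)
  also have "\<dots> \<le> B + c"
    unfolding z' using stable[of ?z "snd u"] by simp
  finally show ?thesis .
qed

text \<open>The variational bound for \<open>t\<close> times the signed loss meets the exponential
  moment bound under the i.i.d. triples. Dividing by \<open>t\<close> leaves
  \<open>\<Delta> / t\<close> and an error linear in \<open>t\<close>.\<close>

lemma risk_transfer:
  fixes k0 k1 :: "(nat \<Rightarrow> 'y) \<Rightarrow> (nat \<Rightarrow> 'z::countable) measure"
  assumes k: "word_channel n k0" "word_channel n k1"
    and opt: "\<And>t. 0 < t \<Longrightarrow> t < 1 \<Longrightarrow>
      channel_info (Vn n) (words n) k0 \<le> channel_info (Vn n) (words n) (mix_kernel (words n) t k0 k1)"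
    and fin: "channel_info (Vn n) (words n) k0 < \<top>" and \<Delta>: "\<Delta> \<ge> 0"
    and le: "channel_info (Vn n) (words n) k1 + kl (count_space (words n)) (out_pmf (Vn n) k1) (out_pmf (Vn n) k0) \<le>
      channel_info (Vn n) (words n) k0 + ennreal \<Delta>"
    and \<kappa>: "letter_channel \<kappa>" and k0: "AE y in Vn n. k0 y = power_kernel n \<kappa> y"
    and stable: "\<And>i z a. i < n \<Longrightarrow> z \<in> words n \<Longrightarrow> (\<Sum>j<n. dist (g j (z(i := a))) (g j z)) \<le> c"
    and t: "t > 0"
  shows "\<bar>(\<Sum>i<n. coord_risk n (src n) k1 i (g i)) - (\<Sum>i<n. coord_risk n (src n) k0 i (g i))\<bar> \<le>
    \<Delta> / t + real n * (t * ((B + c)\<^sup>2 / 2))"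
proof -
  let ?J0 = "full_law n (src n) k0" and ?J1 = "full_law n (src n) k1"
  let ?PT = "PiM {..<n} (\<lambda>_. letter_joint \<kappa>)"
  let ?u = "\<lambda>\<omega> :: nat \<Rightarrow> ('t \<times> 'y) \<times> 'z.
    ((\<lambda>i\<in>{..<n}. fst (fst (\<omega> i)), \<lambda>i\<in>{..<n}. snd (fst (\<omega> i))), \<lambda>i\<in>{..<n}. snd (\<omega> i))"
  have J0: "?J0 = full_law n (src n) (power_kernel n \<kappa>)"
    by (rule full_law_cong[OF k(1) channel_power[OF \<kappa>] k0])
  \<comment> \<open>The sign \<open>\<sigma>\<close> treats the upper and the lower bound at
    once.\<close>
  have step: "\<sigma> * (\<integral>\<omega>. loss n g \<omega> \<partial>?J1) \<le>
      \<sigma> * (\<integral>\<omega>. loss n g \<omega> \<partial>?J0) + (\<Delta> / t + real n * (t * ((B + c)\<^sup>2 / 2)))"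
    if \<sigma>: "\<bar>\<sigma>\<bar> = 1" for \<sigma> :: real
  proof -
    define G where "G \<omega> = \<sigma> * loss n g (?u \<omega>)" for \<omega>
    have sl: "(\<lambda>\<omega>. t * (\<sigma> * loss n g \<omega>)) \<in> borel_measurable (src n \<Otimes>\<^sub>M count_space (words n))"
      using measurable_loss by measurable
    have "(\<integral>\<omega>. t * (\<sigma> * loss n g \<omega>) \<partial>?J1) \<le> \<Delta> + ln (\<integral>\<omega>. exp (t * (\<sigma> * loss n g \<omega>)) \<partial>?J0)"
      unfolding full_law_eq
    proof (rule expectation_le_of_info_through[OF prob_space_src _ countable_words distr_src_snd k opt fin \<Delta> le sl])
      show "\<bar>t * (\<sigma> * loss n g x)\<bar> \<le> t * (real n * B)" for x
        using \<sigma> t loss_bounds[of n g x] by (simp add: abs_mult)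
    qed measurable
    also have "(\<integral>\<omega>. exp (t * (\<sigma> * loss n g \<omega>)) \<partial>?J0) = (\<integral>\<omega>. exp (t * G \<omega>) \<partial>?PT)"
      unfolding J0 G_def using sl by (intro integral_full_law_power[OF \<kappa>]) auto
    also have "ln \<dots> \<le> t * (\<integral>\<omega>. G \<omega> \<partial>?PT) + real n * (t\<^sup>2 * (B + c)\<^sup>2 / 2)"
    proof -
      interpret PT: prob_space ?PT by (intro prob_space_PiM prob_space_letter_joint[OF \<kappa>])
      have G_meas: "G \<in> borel_measurable ?PT"
        unfolding G_def using measurable_compose[OF measurable_unzip_joint[OF \<kappa>] measurable_loss] by measurable
      have G_bound: "\<bar>G \<omega>\<bar> \<le> real n * B" for \<omega>
        using \<sigma> loss_bounds[of n g "?u \<omega>"] by (simp add: G_def abs_mult)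
      have "(\<integral>\<omega>. exp (t * G \<omega>) \<partial>?PT) \<le> exp (t * (\<integral>\<omega>. G \<omega> \<partial>?PT) + real n * (t\<^sup>2 * (B + c)\<^sup>2 / 2))"
      proof (rule mcdiarmid_mgf[OF prob_space_letter_joint[OF \<kappa>] t G_meas G_bound])
        fix x i u assume i: "i < n"
        have "\<bar>G (x(i := u)) - G x\<bar> = \<bar>\<sigma>\<bar> * \<bar>loss n g (?u (x(i := u))) - loss n g (?u x)\<bar>"
          unfolding G_def by (simp only: abs_mult[symmetric] right_diff_distrib)
        also have "\<dots> \<le> B + c"
          unfolding \<sigma> using loss_bounded_differences[OF i stable[OF i], of x u] by simp
        finally show "\<bar>G (x(i := u)) - G x\<bar> \<le> B + c" .
      qed
      moreover have "(\<integral>\<omega>. exp (t * G \<omega>) \<partial>?PT) > 0"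
      proof (rule PT.expectation_greater)
        show "integrable ?PT (\<lambda>\<omega>. exp (t * G \<omega>))"
          using G_meas G_bound t
          by (intro PT.integrable_const_bound[where B = "exp (t * (real n * B))"]) (auto simp: abs_le_iff)
      qed auto
      ultimately show ?thesis
        using ln_le_cancel_iff[of "\<integral>\<omega>. exp (t * G \<omega>) \<partial>?PT" "exp (t * (\<integral>\<omega>. G \<omega> \<partial>?PT) + real n * (t\<^sup>2 * (B + c)\<^sup>2 / 2))"]
        by simp
    qed
    also have "(\<integral>\<omega>. G \<omega> \<partial>?PT) = (\<integral>\<omega>. \<sigma> * loss n g \<omega> \<partial>?J0)"
      unfolding J0 G_def using measurable_loss
      by (intro integral_full_law_power[OF \<kappa>, symmetric] borel_measurable_times) auto
    finally have "t * (\<sigma> * (\<integral>\<omega>. loss n g \<omega> \<partial>?J1)) \<le>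
        \<Delta> + (t * (\<sigma> * (\<integral>\<omega>. loss n g \<omega> \<partial>?J0)) + real n * (t\<^sup>2 * (B + c)\<^sup>2 / 2))"
      by simp
    also have "\<dots> = t * (\<sigma> * (\<integral>\<omega>. loss n g \<omega> \<partial>?J0) + (\<Delta> / t + real n * (t * ((B + c)\<^sup>2 / 2))))"
      using t by (simp add: distrib_left power2_eq_square)
    finally show ?thesis
      using t by (simp only: mult_le_cancel_left_pos)
  qed
  show ?thesis
    unfolding sum_coord_risk[OF k(1)] sum_coord_risk[OF k(2)]
    using step[of 1] step[of "-1"] by (simp add: abs_le_iff)
qed

end

section \<open>Asymptotics of the information gap and of the three kinds of risk\<close>

theorem theorem1:
  fixes P :: "'t::polish_space measure"
    and MY :: "'y measure"
    and K :: "'t \<Rightarrow> 'y measure"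
    and B :: real
    and d :: "'y \<Rightarrow> 'z::countable \<Rightarrow> real"
    and Dy :: real
    and Q :: "nat \<Rightarrow> (nat \<Rightarrow> 'y) \<Rightarrow> (nat \<Rightarrow> 'z) measure"
    and M :: "nat \<Rightarrow> nat"
    and W :: "nat \<Rightarrow> 'w measure"
    and enc :: "nat \<Rightarrow> 'w \<Rightarrow> (nat \<Rightarrow> 'y) \<Rightarrow> nat"
    and dec :: "nat \<Rightarrow> 'w \<Rightarrow> nat \<Rightarrow> (nat \<Rightarrow> 'z)"
  defines "S \<equiv> source_law P MY K"
    and "V \<equiv> obs_law P MY K"
    and "C \<equiv> \<lambda>n. code_kernel n (W n) (enc n) (dec n)"
  assumes prior: "prob_space P" "sets P = sets borel"
    and support: "\<And>U. open U \<Longrightarrow> U \<noteq> {} \<Longrightarrow> emeasure P U > 0"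
    and bounded_metric: "B > 0" "\<And>s t :: 't. dist s t \<le> B"
    and channel: "K \<in> P \<rightarrow>\<^sub>M prob_algebra MY"
    and d_measurable: "(\<lambda>(y, z). d y z) \<in> borel_measurable (MY \<Otimes>\<^sub>M count_space UNIV)"
    and d_nonneg: "\<And>y z. y \<in> space MY \<Longrightarrow> d y z \<ge> 0"
    and Dy: "Dy \<ge> (INF p\<in>space MY \<times> UNIV. d (fst p) (snd p))"
    and A_RD: "\<And>n. n \<ge> 1 \<Longrightarrow> unique_rd_kernel d Dy n (V n) (Q n)"
    and code: "\<And>n. n \<ge> 1 \<Longrightarrow> block_code MY n (M n) (W n) (enc n) (dec n)"
    and code_admissible: "\<And>n. n \<ge> 1 \<Longrightarrow> admissible d Dy n (V n) (C n)"
    and rate: "(\<lambda>n. ereal (log 2 (real (M n)) / real n)) \<longlonglongrightarrow> rd_fun d Dy V"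
    and abs_cont: "\<And>n. n \<ge> 1 \<Longrightarrow> (AE y in V n. absolutely_continuous (Q n y) (C n y))"
    and output_close:
      "(\<lambda>n. rel_entropy (out_law n (V n) (C n)) (out_law n (V n) (Q n)) / ereal (real n)) \<longlonglongrightarrow> 0"
  shows
    "(\<forall>\<phi>. (\<lambda>n. (\<Sum>i<n. coord_risk n (S n) (C n) i (\<lambda>z. \<phi> (z i))) / real n)
              \<longlonglongrightarrow> rd_risk (S 1) (Q 1) \<phi>) \<and>
     (\<forall>\<phi>B :: nat \<Rightarrow> nat \<Rightarrow> 'z \<Rightarrow> 't.
        (\<forall>n\<ge>1. \<forall>i<n. bayes_estimator n (S n) (Q n) i (\<phi>B n i)) \<longrightarrow>
        (\<lambda>n. (\<Sum>i<n. coord_risk n (S n) (C n) i (\<lambda>z. \<phi>B n i (z i))) / real n)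
              \<longlonglongrightarrow> bayes_rd_risk (S 1) (Q 1)) \<and>
     (\<forall>(g :: nat \<Rightarrow> (nat \<Rightarrow> 'z) \<Rightarrow> (nat \<Rightarrow> 't)) L.
        (\<forall>n\<ge>1. lipschitz_estimator L n (g n)) \<longrightarrow>
        liminf (\<lambda>n. ereal ((\<Sum>i<n. coord_risk n (S n) (C n) i (\<lambda>z. g n z i)) / real n))
              \<ge> ereal (bayes_rd_risk (S 1) (Q 1)))"
proof -
  interpret bounded_source P MY K B
    using prior bounded_metric channel by (intro bounded_source.intro) auto
  have V: "V n = Vn n" for n
    unfolding V_def by (rule obs_law_eq)
  note Q = A_RD[unfolded V]
  have space_obs1: "space obs1 = space MY"
    using sets_eq_imp_space_eq[OF sets_obs1] .
  have d_meas: "(\<lambda>x. d (fst x) (snd x)) \<in> borel_measurable (obs1 \<Otimes>\<^sub>M count_space UNIV)"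
    using d_measurable
    by (simp add: case_prod_unfold measurable_cong_sets[OF sets_pair_measure_cong[OF sets_obs1 refl] refl])
  have d_nonneg': "d y z \<ge> 0" if "y \<in> space obs1" for y z
    using that d_nonneg by (simp add: space_obs1)
  have adm_Q: "admissible d Dy n (Vn n) (Q n)" and adm_C: "admissible d Dy n (Vn n) (C n)" if "n \<ge> 1" for n
    using Q[OF that] code_admissible[OF that] by (auto simp: unique_rd_kernel_def V)
  have ch_Q: "word_channel n (Q n)" and ch_C: "word_channel n (C n)" if "n \<ge> 1" for n
    using adm_Q[OF that] adm_C[OF that] by (auto simp: admissible_iff)
  define I where "I n k = channel_info (Vn n) (words n) k" for n and k :: "(nat \<Rightarrow> 'y) \<Rightarrow> (nat \<Rightarrow> 'z) measure"
  have opt: "I n (Q n) \<le> I n k" if "n \<ge> 1" "admissible d Dy n (Vn n) k" for n k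
    unfolding I_def using optimal_info_le[OF d_meas d_nonneg' Q[OF that(1)] that(2)] .
  have M: "M n \<ge> 1" and info_C: "I n (C n) \<le> ennreal (ln (real (M n)))" if n: "n \<ge> 1" for n
  proof -
    interpret Vn: discrete_channel "Vn n" "words n :: (nat \<Rightarrow> 'z) set" by (rule discrete_Vn)
    note bc = code[OF n, unfolded block_code_def zblock_eq]
    have C_eq: "C n = (\<lambda>y. distr (W n) (count_space (words n)) (\<lambda>w. dec n w (enc n w y)))"
      unfolding C_def code_kernel_def[abs_def] zblock_eq ..
    have enc: "(\<lambda>(w, y). enc n w y) \<in> W n \<Otimes>\<^sub>M Vn n \<rightarrow>\<^sub>M count_space {1..M n}"
      using bc by (simp add: measurable_cong_sets[OF sets_pair_measure_cong[OF refl sets_Vn] refl])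
    show "M n \<ge> 1" "I n (C n) \<le> ennreal (ln (real (M n)))"
      using Vn.info_code_le[OF _ ch_C[OF n, unfolded C_eq] enc] bc by (auto simp: C_eq I_def)
  qed
  \<comment> \<open>The code of length one is an admissible competitor with at most
    \<open>ln (M 1)\<close> nats.\<close>
  have fin1: "I 1 (Q 1) < \<top>"
    using opt[OF _ adm_C[of 1]] info_C[of 1] by (auto simp: less_top[symmetric] top_unique)
  define r where "r = enn2real (I 1 (Q 1))"
  have I_Q: "I n (Q n) = ennreal (real n * r)" if "n \<ge> 1" for n
  proof -
    have "I n (Q n) = of_nat n * I 1 (Q 1)"
      using optimal_kernel_is_power(1)[OF d_meas d_nonneg' Q _ that] fin1 by (simp add: I_def)
    also have "I 1 (Q 1) = ennreal r"
      using fin1 by (simp add: r_def)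
    finally show ?thesis
      by (simp add: ennreal_of_nat_eq_real_of_nat ennreal_mult r_def)
  qed
  \<comment> \<open>Averaging at length one merely turns a kernel between one-letter blocks into a
    kernel between letters.\<close>
  define \<kappa> where "\<kappa> = avg_kernel obs1 1 (Q 1)"
  have \<kappa>: "letter_channel \<kappa>"
    unfolding \<kappa>_def by (intro channel_avg ch_Q) auto
  have Q_pow: "AE y in Vn n. Q n y = power_kernel n \<kappa> y" if "n \<ge> 1" for n
    using optimal_kernel_is_power(2)[OF d_meas d_nonneg' Q _ that] fin1 by (simp add: I_def \<kappa>_def)
  have full_Q: "full_law n (src n) (Q n) = full_law n (src n) (power_kernel n \<kappa>)" if "n \<ge> 1" for n
    by (rule full_law_cong[OF ch_Q[OF that] channel_power[OF \<kappa>] Q_pow[OF that]])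
  have S: "S n = src n" for n by (simp add: S_def)
  have coord_Q: "coord_risk n (src n) (Q n) i g = coord_risk n (src n) (power_kernel n \<kappa>) i g" if "n \<ge> 1" for n i g
    unfolding coord_risk_def full_Q[OF that] ..
  have risk: "rd_risk (S 1) (Q 1) \<phi> = letter_risk \<kappa> \<phi>" for \<phi>
    unfolding rd_risk_def S coord_Q[OF order_refl] by (rule coord_risk_power_letter[OF \<kappa>]) simp
  have bayes: "bayes_rd_risk (S 1) (Q 1) = (INF \<phi>. letter_risk \<kappa> \<phi>)"
    unfolding bayes_rd_risk_def risk ..

  define X where "X n = kl (count_space (words n)) (out_pmf (Vn n) (C n)) (out_pmf (Vn n) (Q n))" for n
  define x where "x n = enn2real (X n)" for n
  define \<Delta> where "\<Delta> n = max 0 (ln (real (M n)) + x n - real n * r)" for n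
  have rate': "(\<lambda>n. ln (real (M n)) / real n) \<longlonglongrightarrow> r"
  proof -
    have rd: "rd_block d Dy n (V n) / ereal (real n) = ereal (r / ln 2)" if "n \<ge> 1" for n
    proof -
      have "rd_block d Dy n (V n) = kernel_info n (Vn n) (Q n)"
        using Q[OF that] by (simp add: unique_rd_kernel_def V)
      also have "\<dots> = ereal (real n * r / ln 2)"
        using kernel_info_eq[OF ch_Q[OF that]] I_Q[OF that] by (simp add: I_def r_def)
      finally show ?thesis using that by simp
    qed
    \<comment> \<open>The sequence is constant from \<open>n = 1\<close> on, by
      \<open>I_Q\<close>.\<close>
    have "(\<lambda>n. rd_block d Dy n (V n) / ereal (real n)) \<longlonglongrightarrow> ereal (r / ln 2)"
      using rd by (intro tendsto_eventually) (auto simp: eventually_sequentially)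
    then have "rd_fun d Dy V = ereal (r / ln 2)"
      unfolding rd_fun_def by (rule limI)
    then have "(\<lambda>n. log 2 (real (M n)) / real n) \<longlonglongrightarrow> r / ln 2"
      using rate by simp
    then have "(\<lambda>n. log 2 (real (M n)) / real n * ln 2) \<longlonglongrightarrow> r / ln 2 * ln 2"
      by (rule tendsto_mult_right)
    then show ?thesis by (simp add: log_def)
  qed
  have rel: "rel_entropy (out_law n (V n) (C n)) (out_law n (V n) (Q n)) = enn2ereal (X n) / ereal (ln 2)"
    if "n \<ge> 1" for n
  proof -
    interpret Vn: discrete_channel "Vn n" "words n :: (nat \<Rightarrow> 'z) set" by (rule discrete_Vn)
    show ?thesis
      unfolding out_law_def zblock_eq V X_def by (rule Vn.rel_entropy_out[OF ch_C[OF that] ch_Q[OF that]])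
  qed
  \<comment> \<open>A limit of 0 forces finite divergence only eventually; before that
    \<open>x n\<close> is the default value 0 and carries no information.\<close>
  have X_fin: "\<forall>\<^sub>F n in sequentially. n \<ge> 1 \<and> X n < \<top>"
  proof -
    have "\<forall>\<^sub>F n in sequentially. rel_entropy (out_law n (V n) (C n)) (out_law n (V n) (Q n)) / ereal (real n) < 1"
      using order_tendstoD(2)[OF output_close, of 1] by simp
    then show ?thesis
      using eventually_ge_at_top[of 1]
    proof eventually_elim
      case (elim n)
      then show ?case by (cases "X n = \<top>") (auto simp: rel less_top)
    qed
  qed
  have x_lim: "(\<lambda>n. x n / real n) \<longlonglongrightarrow> 0"
  proof -
    have "\<forall>\<^sub>F n in sequentially. rel_entropy (out_law n (V n) (C n)) (out_law n (V n) (Q n)) / ereal (real n) =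
        ereal (x n / ln 2 / real n)"
      using X_fin
    proof eventually_elim
      case (elim n)
      then have "X n = ennreal (x n)" "x n \<ge> 0" by (auto simp: x_def)
      then show ?case using elim by (simp add: rel)
    qed
    from tendsto_cong[OF this] have "(\<lambda>n. ereal (x n / ln 2 / real n)) \<longlonglongrightarrow> ereal 0"
      using output_close by (simp add: zero_ereal_def)
    then have "(\<lambda>n. x n / ln 2 / real n) \<longlonglongrightarrow> 0" by simp
    then have "(\<lambda>n. x n / ln 2 / real n * ln 2) \<longlonglongrightarrow> 0 * ln 2"
      by (rule tendsto_mult_right)
    then show ?thesis by simp
  qed
  have \<Delta>_lim: "(\<lambda>n. \<Delta> n / real n) \<longlonglongrightarrow> 0"
  proof -
    have "(\<lambda>n. max 0 (ln (real (M n)) / real n + x n / real n - r)) \<longlonglongrightarrow> max 0 (r + 0 - r)"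
      by (intro tendsto_intros rate' x_lim)
    moreover have "\<forall>\<^sub>F n in sequentially. max 0 (ln (real (M n)) / real n + x n / real n - r) = \<Delta> n / real n"
      using eventually_ge_at_top[of 1]
    proof eventually_elim
      case (elim n)
      then have "(ln (real (M n)) + x n - real n * r) / real n = ln (real (M n)) / real n + x n / real n - r"
        by (simp add: add_divide_distrib diff_divide_distrib)
      then show ?case
        using elim by (simp add: \<Delta>_def max_divide_distrib_right)
    qed
    ultimately show ?thesis by (simp add: tendsto_cong)
  qed

  define A where "A n g = (\<Sum>i<n. coord_risk n (src n) (C n) i (g i)) / real n"
    for n and g :: "nat \<Rightarrow> (nat \<Rightarrow> 'z) \<Rightarrow> 't"
  define A' where "A' n g = (\<Sum>i<n. coord_risk n (src n) (power_kernel n \<kappa>) i (g i)) / real n"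
    for n and g :: "nat \<Rightarrow> (nat \<Rightarrow> 'z) \<Rightarrow> 't"
  \<comment> \<open>The stability constant \<open>c\<close> is common to all \<open>n\<close>, so
    the error per letter is \<open>\<Delta> n / real n / t\<close> plus a multiple of
    \<open>t\<close>.\<close>
  have conv: "(\<lambda>n. A n (g n) - A' n (g n)) \<longlonglongrightarrow> 0"
    if stable: "\<And>n i z a. n \<ge> 1 \<Longrightarrow> i < n \<Longrightarrow> z \<in> words n \<Longrightarrow> (\<Sum>j<n. dist (g n j (z(i := a))) (g n j z)) \<le> c"
    for g :: "nat \<Rightarrow> nat \<Rightarrow> (nat \<Rightarrow> 'z) \<Rightarrow> 't" and c
  proof (rule tendsto_rabs_zero_cancel, rule tendsto_zero_tradeoff[OF \<Delta>_lim])
    fix t :: real assume t: "t > 0"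
    show "\<forall>\<^sub>F n in sequentially. \<bar>A n (g n) - A' n (g n)\<bar> \<le> \<Delta> n / real n / t + t * ((B + c)\<^sup>2 / 2)"
      using X_fin
    proof eventually_elim
      case (elim n)
      then have n: "n \<ge> 1" by simp
      have "I n (C n) + X n \<le> ennreal (ln (real (M n))) + ennreal (x n)"
        using info_C[OF n] elim by (intro add_mono) (auto simp: x_def)
      also have "\<dots> = ennreal (ln (real (M n)) + x n)"
        using M[OF n] by (simp add: x_def)
      also have "\<dots> \<le> ennreal (real n * r + \<Delta> n)"
        by (intro ennreal_leI) (simp add: \<Delta>_def)
      also have "\<dots> = I n (Q n) + ennreal (\<Delta> n)"
        unfolding I_Q[OF n] by (intro ennreal_plus) (auto simp: \<Delta>_def r_def)
      finally have le: "I n (C n) + X n \<le> I n (Q n) + ennreal (\<Delta> n)" .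
      have "\<bar>(\<Sum>i<n. coord_risk n (src n) (C n) i (g n i)) - (\<Sum>i<n. coord_risk n (src n) (Q n) i (g n i))\<bar> \<le>
          \<Delta> n / t + real n * (t * ((B + c)\<^sup>2 / 2))"
      proof (rule risk_transfer[OF ch_Q[OF n] ch_C[OF n] _ _ _ _ \<kappa> Q_pow[OF n] stable[OF n] t])
        show "channel_info (Vn n) (words n) (Q n) \<le> channel_info (Vn n) (words n) (mix_kernel (words n) s (Q n) (C n))"
          if "0 < s" "s < 1" for s
          using opt[OF n admissible_mix[OF d_meas d_nonneg' adm_Q[OF n] adm_C[OF n] that]] by (simp add: I_def)
        show "channel_info (Vn n) (words n) (Q n) < \<top>"
          using I_Q[OF n] by (simp add: I_def)
        show "\<Delta> n \<ge> 0" by (simp add: \<Delta>_def)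
      qed (use le in \<open>simp_all add: I_def X_def\<close>)
      then have "\<bar>A n (g n) - A' n (g n)\<bar> \<le> (\<Delta> n / t + real n * (t * ((B + c)\<^sup>2 / 2))) / real n"
        unfolding A_def A'_def coord_Q[OF n] diff_divide_distrib[symmetric] abs_divide
        by (simp add: divide_right_mono)
      also have "\<dots> = \<Delta> n / real n / t + t * ((B + c)\<^sup>2 / 2)"
        using n by (simp add: add_divide_distrib)
      finally show ?case .
    qed
  qed auto
  \<comment> \<open>Changing one output letter changes only the estimate in the same position, so a
    letterwise estimator is stable with constant \<open>B\<close>.\<close>
  have letterwise: "(\<Sum>j<n. dist (\<psi> j ((z(i := a)) j)) (\<psi> j (z j))) \<le> B"
    if "i < n" for n i a and z :: "nat \<Rightarrow> 'z" and \<psi> :: "nat \<Rightarrow> 'z \<Rightarrow> 't"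
  proof -
    have "(\<Sum>j<n. dist (\<psi> j ((z(i := a)) j)) (\<psi> j (z j))) \<le> (\<Sum>j<n. if j = i then B else 0)"
      using bounded_metric(2) by (intro sum_mono) auto
    then show ?thesis using that by simp
  qed
  \<comment> \<open>The family may vary with \<open>n\<close> and \<open>i\<close>, since Bayes
    estimators may break ties differently; only their common letter risk matters.\<close>
  have letter_conv: "(\<lambda>n. A n (\<lambda>i z. \<psi> n i (z i))) \<longlonglongrightarrow> l"
    if \<psi>: "\<And>n i. n \<ge> 1 \<Longrightarrow> i < n \<Longrightarrow> letter_risk \<kappa> (\<psi> n i) = l" for \<psi> :: "nat \<Rightarrow> nat \<Rightarrow> 'z \<Rightarrow> 't" and l
  proof -
    have A': "A' n (\<lambda>i z. \<psi> n i (z i)) = l" if "n \<ge> 1" for n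
    proof -
      have "coord_risk n (src n) (power_kernel n \<kappa>) i (\<lambda>z. \<psi> n i (z i)) = l" if "i < n" for i
        using coord_risk_power_letter[OF \<kappa> that] \<psi>[OF \<open>n \<ge> 1\<close> that] by simp
      then show ?thesis using that by (simp add: A'_def)
    qed
    have "(\<lambda>n. A n (\<lambda>i z. \<psi> n i (z i)) - A' n (\<lambda>i z. \<psi> n i (z i))) \<longlonglongrightarrow> 0"
      by (rule conv) (rule letterwise)
    moreover have "\<forall>\<^sub>F n in sequentially. A n (\<lambda>i z. \<psi> n i (z i)) - A' n (\<lambda>i z. \<psi> n i (z i)) =
        A n (\<lambda>i z. \<psi> n i (z i)) - l"
      using A' by (auto simp: eventually_sequentially)
    ultimately have "(\<lambda>n. A n (\<lambda>i z. \<psi> n i (z i)) - l) \<longlonglongrightarrow> 0"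
      by (simp add: tendsto_cong)
    then show ?thesis by (simp add: LIM_zero_iff)
  qed
  show ?thesis
  proof (intro conjI allI impI)
    fix \<phi> :: "'z \<Rightarrow> 't"
    show "(\<lambda>n. (\<Sum>i<n. coord_risk n (S n) (C n) i (\<lambda>z. \<phi> (z i))) / real n) \<longlonglongrightarrow> rd_risk (S 1) (Q 1) \<phi>"
      using letter_conv[of "\<lambda>_ _. \<phi>"] unfolding risk by (simp add: A_def S)
  next
    fix \<phi>B :: "nat \<Rightarrow> nat \<Rightarrow> 'z \<Rightarrow> 't"
    assume \<phi>B: "\<forall>n\<ge>1. \<forall>i<n. bayes_estimator n (S n) (Q n) i (\<phi>B n i)"
    have "letter_risk \<kappa> (\<phi>B n i) = (INF \<phi>. letter_risk \<kappa> \<phi>)" if "n \<ge> 1" "i < n" for n i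
    proof (rule antisym)
      have "bayes_estimator n (src n) (power_kernel n \<kappa>) i (\<phi>B n i)"
        using \<phi>B that unfolding bayes_estimator_def S by (simp add: full_Q)
      then show "letter_risk \<kappa> (\<phi>B n i) \<le> (INF \<phi>. letter_risk \<kappa> \<phi>)"
        by (intro cINF_greatest letter_risk_bayes[OF \<kappa> that(2)]) auto
      show "(INF \<phi>. letter_risk \<kappa> \<phi>) \<le> letter_risk \<kappa> (\<phi>B n i)"
        by (intro cINF_lower bdd_belowI2[where m = 0]) (auto simp: letter_risk_nonneg)
    qed
    then show "(\<lambda>n. (\<Sum>i<n. coord_risk n (S n) (C n) i (\<lambda>z. \<phi>B n i (z i))) / real n) \<longlonglongrightarrow> bayes_rd_risk (S 1) (Q 1)"
      using letter_conv[of \<phi>B] unfolding bayes by (simp add: A_def S)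
  next
    fix g :: "nat \<Rightarrow> (nat \<Rightarrow> 'z) \<Rightarrow> (nat \<Rightarrow> 't)" and L
    assume g: "\<forall>n\<ge>1. lipschitz_estimator L n (g n)"
    define h where "h n i z = g n z i" for n i z
    \<comment> \<open>Words differing in one position are at Hamming distance at most
      \<open>1 / n\<close>, and this factor cancels the one in \<open>block_dist\<close>. The
      absolute value covers any sign of \<open>L\<close>.\<close>
    have stable: "(\<Sum>j<n. dist (h n j (z(i := a))) (h n j z)) \<le> \<bar>L\<bar>"
      if "n \<ge> 1" "i < n" "z \<in> words n" for n i z a
    proof -
      have "z(i := a) \<in> space (zblock n)" "z \<in> space (zblock n)"
        using that by (auto simp: space_PiM PiE_iff extensional_def)
      then have "block_dist n (g n (z(i := a))) (g n z) \<le> L * hamming_dist n (z(i := a)) z"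
        using g that unfolding lipschitz_estimator_def by blast
      then have "(\<Sum>j<n. dist (h n j (z(i := a))) (h n j z)) \<le> L * (\<Sum>j<n. of_bool ((z(i := a)) j \<noteq> z j))"
        using that by (simp add: block_dist_def hamming_dist_def h_def divide_le_cancel)
      also have "\<dots> \<le> \<bar>L\<bar> * 1"
      proof (rule mult_mono)
        have "(\<Sum>j<n. of_bool ((z(i := a)) j \<noteq> z j)) \<le> (\<Sum>j<n. if j = i then 1 else 0 :: real)"
          by (intro sum_mono) auto
        then show "(\<Sum>j<n. of_bool ((z(i := a)) j \<noteq> z j)) \<le> (1 :: real)"
          using that by simp
      qed (auto intro: sum_nonneg)
      finally show ?thesis by simp
    qed
    have lim: "(\<lambda>n. A n (h n) - A' n (h n)) \<longlonglongrightarrow> 0"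
      by (rule conv[OF stable])
    define b where "b = (INF \<phi>. letter_risk \<kappa> \<phi>)"
    have "b \<le> A' n (h n)" if "n \<ge> 1" for n
    proof -
      have "(\<Sum>i<n. b) \<le> (\<Sum>i<n. coord_risk n (src n) (power_kernel n \<kappa>) i (h n i))"
        unfolding b_def by (intro sum_mono coord_risk_power_ge[OF \<kappa>]) auto
      then show ?thesis using that by (simp add: A'_def pos_le_divide_eq mult.commute)
    qed
    \<comment> \<open>The risk under the optimal kernel need not converge, so it is replaced by its
      lower bound \<open>b\<close>, leaving a convergent minorant.\<close>
    then have "\<forall>\<^sub>F n in sequentially. ereal (b + (A n (h n) - A' n (h n))) \<le> ereal (A n (h n))"
      by (auto simp: eventually_sequentially)
    then have "liminf (\<lambda>n. ereal (b + (A n (h n) - A' n (h n)))) \<le> liminf (\<lambda>n. ereal (A n (h n)))"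
      by (rule Liminf_mono)
    moreover have "(\<lambda>n. b + (A n (h n) - A' n (h n))) \<longlonglongrightarrow> b + 0"
      by (intro tendsto_add tendsto_const lim)
    then have "liminf (\<lambda>n. ereal (b + (A n (h n) - A' n (h n)))) = ereal b"
      by (intro lim_imp_Liminf) auto
    ultimately show "ereal (bayes_rd_risk (S 1) (Q 1)) \<le>
        liminf (\<lambda>n. ereal ((\<Sum>i<n. coord_risk n (S n) (C n) i (\<lambda>z. g n z i)) / real n))"
      unfolding bayes by (simp add: b_def A_def h_def[abs_def] S)
  qed
qed


end
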